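(* Let $D\subset\mathbb{R}^d$ be a bounded domain with regular boundary, let $G(x,y)$ be the classical Green function of $D$ (set equal to $0$ outside of $D$), and let $\dot\eta$ be the $d$-parameter Lévy white noise. Then there exists a unique stochastic distribution process $U:\overline{D}\to(\mathcal{S})^*$ solving the stochastic Poisson equation $$\Delta U(x)=-\dot\eta(x),\quad x\in D,\qquad U(x)=0,\quad x\in\partial D,$$ where $\Delta=\sum_{k=1}^d \partial^2/\partial x_k^2$ and $\Delta U(x)$ is defined in the sense of the topology on $(\mathcal{S})_{-1}$. The solution is twice continuously differentiable in $(\mathcal{S})^*$ and takes the form $$U(x)=\int_{\mathbb{R}^d}G(x,y)\,\dot\eta(y)\,dy = m\sum_{k\ge1}\int_{\mathbb{R}^d}G(x,y)\zeta_k(y)\,dy\;K_{\epsilon^{z(k,1)}},\qquad m=\|z\|_{L^2(\nu)}.$$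
   Context: Setting. $\mathbb{N}=\{1,2,\dots\}$, $\mathbb{R}_0=\mathbb{R}\setminus\{0\}$, $X=\mathbb{R}^d\times\mathbb{R}_0$. $\nu$ is a Lévy measure on $\mathbb{R}_0$ (i.e. $\int (1\wedge z^2)\,\nu(dz)<\infty$) such that for every $\varepsilon>0$ there is $\lambda>0$ with $\int_{\mathbb{R}\setminus(-\varepsilon,\varepsilon)}e^{\lambda|z|}\nu(dz)<\infty$. $\pi=\lambda^{\times d}\times\nu$, with $\lambda^{\times d}$ Lebesgue measure on $\mathbb{R}^d$. White noise space. $\mathcal{S}(X)$ is the closed subspace of the Schwartz space $\mathcal{S}(\mathbb{R}^{d+1})$ of those $\varphi$ with $\varphi(z_1,\dots,z_d,0)=(\partial\varphi/\partial z_{d+1})(z_1,\dots,z_d,0)=0$; $\mathcal{N}_\pi=\{\varphi\in\mathcal{S}(X):\|\varphi\|_{L^2(\pi)}=0\}$; $\widetilde{\mathcal{S}}(X)=\mathcal{S}(X)/\mathcal{N}_\pi$ with the quotient topology, a nuclear space with dual $\widetilde{\mathcal{S}}'(X)$. The Lévy white noise measure $\mu$ is the unique probability measure on the Borel sets of $\widetilde{\mathcal{S}}'(X)$ with $\int e^{i\langle\omega,\phi\rangle}d\mu(\omega)=\exp\left(\int_X(e^{i\phi}-1)\,d\pi\right)$ for all $\phi\in\widetilde{\mathcal{S}}(X)$. Generalized Charlier polynomials. For $\phi$ in an open neighborhood of $0$ in $\widetilde{\mathcal{S}}(X)$, $\dfrac{\exp\langle\omega,\log(1+\phi)\rangle}{E_\mu[\exp\langle\omega,\log(1+\phi)\rangle]}=\sum_{n\ge0}\frac1{n!}\langle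 C_n(\omega),\phi^{\otimes n}\rangle$ defines the symmetric kernels $C_n(\omega)$. One has the orthogonality $E_\mu[\langle C_n,\phi^{(n)}\rangle\langle C_m,\psi^{(m)}\rangle]=\delta_{n,m}n!(\phi^{(n)},\psi^{(n)})_{L^2(\pi^{\times n})}$ for symmetric test functions, and $\langle C_n(\omega),f\rangle$ is defined for every symmetric $f\in L^2(X^n,\pi^{\times n})$ as the limit in $L^2(\mu)$ along symmetric test functions converging to $f$ in $L^2(\pi^{\times n})$. Basis. $\{\xi_k\}_{k\ge1}$ are the Hermite functions on $\mathbb{R}$. Fix a bijection $h:\mathbb{N}^d\to\mathbb{N}$ and set $\zeta_k(x_1,\dots,x_d)=\xi_{i_1}(x_1)\cdots\xi_{i_d}(x_d)$ if $k=h(i_1,\dots,i_d)$; $\{\zeta_k\}_{k\ge1}$ is an orthonormal basis of $L^2(\mathbb{R}^d)$. Let $\{l_m\}_{m\ge0}$ be the orthogonalization of $\{1,z,z^2,\dots\}$ in $L^2(\varrho)$, $\varrho(dz)=z^2\nu(dz)$, and $p_m(z)=\|l_{m-1}\|_{L^2(\varrho)}^{-1}\,z\,l_{m-1}(z)$; these form a complete orthonormal system in $L^2(\nu)$. Let $z(i,j)=j+(i+j-2)(i+j-1)/2$, a bijection $\mathbb{N}\times\mathbb{N}\to\mathbb{N}$, and $\delta_k(x,z)=\zeta_i(x)p_j(z)$ if $k=z(i,j)$. $\mathcal{J}$ is the set of sequences $\alpha=(\alpha_1,\alpha_2,\dots)$ in $\mathbb{N}_0$ with finitely many nonzero entries,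 $|\alpha|=\sum_i\alpha_i$, $\alpha!=\prod_i\alpha_i!$. $\delta^{\widehat\otimes\alpha}$ is the symmetrization (average over all permutations of the $|\alpha|$ variables in $X$) of $\delta_1^{\otimes\alpha_1}\otimes\delta_2^{\otimes\alpha_2}\otimes\cdots$, and $K_\alpha(\omega)=\langle C_{|\alpha|}(\omega),\delta^{\widehat\otimes\alpha}\rangle$, $K_0=1$. $\epsilon^l\in\mathcal{J}$ has $l$-th entry $1$ and all others $0$. Stochastic distributions. For $k\in\mathbb{N}_0$, $(2\mathbb{N})^{k\alpha}=\prod_i(2i)^{k\alpha_i}$. The Hida test function space $(\mathcal{S})$ consists of $f=\sum_\alpha c_\alpha K_\alpha$ with $\sum_\alpha\alpha!\,c_\alpha^2(2\mathbb{N})^{k\alpha}<\infty$ for all $k$ (projective topology). For $\rho\in\{0,1\}$, $(\mathcal{S})_{-\rho}=\bigcup_k(\mathcal{S})_{-\rho,-k}$ (inductive topology), where $(\mathcal{S})_{-\rho,-k}$ is the space of formal sums $F=\sum_\alpha b_\alpha K_\alpha$ with $\|F\|_{-\rho,-k}^2=\sum_\alpha(\alpha!)^{1-\rho}\,b_\alpha^2(2\mathbb{N})^{-k\alpha}<\infty$. The case $\rho=0$ is the Hida distribution space $(\mathcal{S})^*$, with $\langle F,f\rangle=\sum_\alpha\alpha!\,b_\alpha c_\alpha$ for $f\in(\mathcal{S})$; the case $\rho=1$ is the Kondratiev space $(\mathcal{S})_{-1}\supset(\mathcal{S})^*$. Lévy white noise: $\dot\eta(x)=m\sum_{k\ge1}\zeta_k(x)K_{\epsilon^{z(k,1)}}\in(\mathcal{S})^*$,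 $m=\|z\|_{L^2(\nu)}=\left(\int z^2\nu(dz)\right)^{1/2}$. The integral $\int_{\mathbb{R}^d}G(x,y)\dot\eta(y)\,dy$ is a Bochner integral in $(\mathcal{S})^*$; its action on $f\in(\mathcal{S})$ is $\int G(x,y)\langle\dot\eta(y),f\rangle\,dy$. "Regular boundary" is meant in the usual sense of the Dirichlet problem for $\Delta$.
   Formalization: A solution is required to be continuous on the closure of D in the topology of (S)_{-1}; without this uniqueness fails, since adding K_0 on D only gives another solution. The solution found is continuous on the closure in (S)*. *)

theory Defs
  imports "HOL-Analysis.Analysis" "HOL-Library.Poly_Mapping"
begin

section \<open>The Levy measure\<close>

text \<open>
  A Levy measure lives on the subspace \<open>- {0}\<close> of the real line. The last clause is the standing
  exponential moment condition.
\<close>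

definition levy_measure :: "real measure \<Rightarrow> bool" where
  "levy_measure \<nu> \<longleftrightarrow>
     sets \<nu> = sets (restrict_space borel (- {0})) \<and>
     (\<integral>\<^sup>+z. ennreal (min 1 (z\<^sup>2)) \<partial>\<nu>) < \<infinity> \<and>
     (\<forall>\<epsilon>>0. \<exists>\<kappa>>0. (\<integral>\<^sup>+z. ennreal (exp (\<kappa> * \<bar>z\<bar>)) * indicator {z. \<epsilon> \<le> \<bar>z\<bar>} z \<partial>\<nu>) < \<infinity>)"

definition levy_L2_norm :: "real measure \<Rightarrow> real" where
  "levy_L2_norm \<nu> = sqrt (\<integral>z. z\<^sup>2 \<partial>\<nu>)"


section \<open>Hermite functions and their tensor products\<close>

text \<open>Probabilists' Hermite polynomials, by Rodrigues' formula.\<close>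

definition hermite_poly :: "nat \<Rightarrow> real \<Rightarrow> real" where
  "hermite_poly n x = (- 1) ^ n * exp (x\<^sup>2 / 2) * (deriv ^^ n) (\<lambda>t. exp (- (t\<^sup>2 / 2))) x"

text \<open>The numbering starts at \<open>k = 1\<close>; the normalisation makes the family orthonormal in
  \<open>L\<^sup>2(\<real>)\<close> with respect to Lebesgue measure.\<close>

definition hermite_fun :: "nat \<Rightarrow> real \<Rightarrow> real" where
  "hermite_fun k x =
     hermite_poly (k - 1) (sqrt 2 * x) * exp (- (x\<^sup>2 / 2)) / sqrt (sqrt pi * fact (k - 1))"

text \<open>\<open>h\<close> enumerates the \<open>d\<close>-tuples of positive integers by the positive integers.\<close>

definition pos_tuples :: "(nat ^ 'n) set" where
  "pos_tuples = {i. \<forall>j. 1 \<le> i $ j}"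

definition zeta_basis :: "(nat ^ 'n \<Rightarrow> nat) \<Rightarrow> nat \<Rightarrow> real ^ 'n \<Rightarrow> real" where
  "zeta_basis h k x = (\<Prod>j\<in>UNIV. hermite_fun (inv_into pos_tuples h k $ j) (x $ j))"


section \<open>Multi-indices and formal chaos expansions\<close>

text \<open>
  A multi-index \<open>\<alpha> = (\<alpha>\<^sub>1, \<alpha>\<^sub>2, \<dots>)\<close> with finitely many nonzero entries is a finitely supported function
  on \<open>nat\<close>; since \<open>nat\<close> starts at 0, the entry \<open>\<alpha>\<^sub>i\<close> (\<open>i \<ge> 1\<close>) is stored at position \<open>i - 1\<close>.
\<close>

type_synonym multi_index = "nat \<Rightarrow>\<^sub>0 nat"

definition unit_index :: "nat \<Rightarrow> multi_index" where
  "unit_index l = Poly_Mapping.single (l - 1) 1"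

definition mi_fact :: "multi_index \<Rightarrow> real" where
  "mi_fact \<alpha> = (\<Prod>i\<in>Poly_Mapping.keys \<alpha>. fact (Poly_Mapping.lookup \<alpha> i))"

text \<open>The weight \<open>(2\<nat>)\<^bsup>k\<alpha>\<^esup>\<close>; the factor \<open>2 (i + 1)\<close> accounts for the shift of positions.\<close>

definition mi_weight :: "nat \<Rightarrow> multi_index \<Rightarrow> real" where
  "mi_weight k \<alpha> =
     (\<Prod>i\<in>Poly_Mapping.keys \<alpha>. (2 * real (i + 1)) ^ (k * Poly_Mapping.lookup \<alpha> i))"

definition zpair :: "nat \<Rightarrow> nat \<Rightarrow> nat" where
  "zpair i j = j + (i + j - 2) * (i + j - 1) div 2"

text \<open>
  The formal sum \<open>\<Sum>\<^sub>\<alpha> b\<^sub>\<alpha> K\<^sub>\<alpha>\<close> is the coefficient family \<open>b\<close>; in particular \<open>K\<^sub>\<alpha>\<close> is the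
  family that is 1 at \<open>\<alpha>\<close> and 0 elsewhere.
\<close>

type_synonym chaos = "multi_index \<Rightarrow> real"

definition chaos_K :: "multi_index \<Rightarrow> chaos" where
  "chaos_K \<alpha> = (\<lambda>\<beta>. if \<beta> = \<alpha> then 1 else 0)"

text \<open>
  The formal sum \<open>c \<Sum>\<^sub>k a\<^sub>k K\<^bsub>\<epsilon>(z(k,1))\<^esub>\<close> over \<open>k \<ge> 1\<close>, \<open>\<epsilon>(l)\<close> being the unit multi-index. It is taken
  coefficientwise, and each coefficient receives at most one nonzero contribution.
\<close>

definition first_chaos_sum :: "real \<Rightarrow> (nat \<Rightarrow> real) \<Rightarrow> chaos" where
  "first_chaos_sum c a = (\<lambda>\<alpha>. c * (\<Sum>\<^sub>\<infinity>k\<in>{1..}. a k * chaos_K (unit_index (zpair k 1)) \<alpha>))"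


section \<open>Stochastic test functions and distributions\<close>

definition hida_test :: "chaos set" where
  "hida_test = {f. \<forall>k. (\<lambda>\<alpha>. mi_fact \<alpha> * (f \<alpha>)\<^sup>2 * mi_weight k \<alpha>) summable_on UNIV}"

text \<open>
  In the following \<open>\<rho> \<in> {0, 1}\<close>: \<open>\<rho> = 0\<close> gives the Hida distributions, \<open>\<rho> = 1\<close> the Kondratiev
  distributions.
\<close>

definition dist_space_at :: "nat \<Rightarrow> nat \<Rightarrow> chaos set" where
  "dist_space_at \<rho> k =
     {F. (\<lambda>\<alpha>. mi_fact \<alpha> ^ (1 - \<rho>) * (F \<alpha>)\<^sup>2 / mi_weight k \<alpha>) summable_on UNIV}"

definition dist_norm :: "nat \<Rightarrow> nat \<Rightarrow> chaos \<Rightarrow> real" where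
  "dist_norm \<rho> k F = sqrt (\<Sum>\<^sub>\<infinity>\<alpha>. mi_fact \<alpha> ^ (1 - \<rho>) * (F \<alpha>)\<^sup>2 / mi_weight k \<alpha>)"

definition dist_space :: "nat \<Rightarrow> chaos set" where
  "dist_space \<rho> = (\<Union>k. dist_space_at \<rho> k)"

text \<open>
  The locally convex inductive limit topology: a base of neighbourhoods of 0 consists of the
  absolutely convex sets that contain a norm ball around 0 of each of the spaces
  \<open>dist_space_at \<rho> k\<close>.
\<close>

definition dist_nhds0 :: "nat \<Rightarrow> chaos set set" where
  "dist_nhds0 \<rho> = {W. W \<subseteq> dist_space \<rho> \<and>
     (\<forall>F\<in>W. \<forall>G\<in>W. \<forall>a b. \<bar>a\<bar> + \<bar>b\<bar> \<le> 1 \<longrightarrow> (\<lambda>\<alpha>. a * F \<alpha> + b * G \<alpha>) \<in> W) \<and>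
     (\<forall>k. \<exists>e>0. \<forall>F\<in>dist_space_at \<rho> k. dist_norm \<rho> k F < e \<longrightarrow> F \<in> W)}"

definition dist_topology :: "nat \<Rightarrow> chaos topology" where
  "dist_topology \<rho> = topology (\<lambda>V. V \<subseteq> dist_space \<rho> \<and>
     (\<forall>F\<in>V. \<exists>W\<in>dist_nhds0 \<rho>. \<forall>H\<in>W. (\<lambda>\<alpha>. F \<alpha> + H \<alpha>) \<in> V))"

abbreviation "hida_dist \<equiv> dist_space 0"
abbreviation "hida_topology \<equiv> dist_topology 0"
abbreviation "kondratiev_topology \<equiv> dist_topology 1"

definition dist_pairing :: "chaos \<Rightarrow> chaos \<Rightarrow> real" where
  "dist_pairing F f = (\<Sum>\<^sub>\<infinity>\<alpha>. mi_fact \<alpha> * F \<alpha> * f \<alpha>)"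

definition levy_noise :: "real measure \<Rightarrow> (nat ^ 'n \<Rightarrow> nat) \<Rightarrow> real ^ 'n \<Rightarrow> chaos" where
  "levy_noise \<nu> h x = first_chaos_sum (levy_L2_norm \<nu>) (\<lambda>k. zeta_basis h k x)"

text \<open>Well-formedness of \<open>dist_topology\<close>.\<close>

lemma mi_fact_pos: "mi_fact \<alpha> > 0"
  by (simp add: mi_fact_def prod_pos)

lemma mi_weight_pos: "mi_weight k \<alpha> > 0"
  by (simp add: mi_weight_def prod_pos)

lemma mi_weight_mono: "k \<le> l \<Longrightarrow> mi_weight k \<alpha> \<le> mi_weight l \<alpha>"
  unfolding mi_weight_def by (intro prod_mono conjI power_increasing) auto

lemma dist_space_at_mono:
  assumes "k \<le> l" shows "dist_space_at \<rho> k \<subseteq> dist_space_at \<rho> l"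
proof
  fix F assume F: "F \<in> dist_space_at \<rho> k"
  show "F \<in> dist_space_at \<rho> l"
    unfolding dist_space_at_def mem_Collect_eq
  proof (rule summable_on_comparison_test[where f = "\<lambda>\<alpha>. mi_fact \<alpha> ^ (1 - \<rho>) * (F \<alpha>)\<^sup>2 / mi_weight k \<alpha>"])
    show "(\<lambda>\<alpha>. mi_fact \<alpha> ^ (1 - \<rho>) * (F \<alpha>)\<^sup>2 / mi_weight k \<alpha>) summable_on UNIV"
      using F by (simp add: dist_space_at_def)
  next
    fix \<alpha>
    show "mi_fact \<alpha> ^ (1 - \<rho>) * (F \<alpha>)\<^sup>2 / mi_weight l \<alpha> \<le> mi_fact \<alpha> ^ (1 - \<rho>) * (F \<alpha>)\<^sup>2 / mi_weight k \<alpha>"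
      using mi_weight_mono[OF assms] mi_weight_pos mi_fact_pos
      by (intro divide_left_mono mult_nonneg_nonneg mult_pos_pos) (auto simp: less_imp_le)
    show "0 \<le> mi_fact \<alpha> ^ (1 - \<rho>) * (F \<alpha>)\<^sup>2 / mi_weight l \<alpha>"
      using mi_weight_pos[of l \<alpha>] mi_fact_pos[of \<alpha>] by (simp add: less_imp_le)
  qed
qed

lemma dist_space_at_add:
  assumes F: "F \<in> dist_space_at \<rho> k" and G: "G \<in> dist_space_at \<rho> k"
  shows "(\<lambda>\<alpha>. F \<alpha> + G \<alpha>) \<in> dist_space_at \<rho> k"
  unfolding dist_space_at_def mem_Collect_eq
proof (rule summable_on_comparison_test)
  let ?w = "\<lambda>\<alpha>. mi_fact \<alpha> ^ (1 - \<rho>) / mi_weight k \<alpha>"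
  show "(\<lambda>\<alpha>. 2 * (mi_fact \<alpha> ^ (1 - \<rho>) * (F \<alpha>)\<^sup>2 / mi_weight k \<alpha>) +
      2 * (mi_fact \<alpha> ^ (1 - \<rho>) * (G \<alpha>)\<^sup>2 / mi_weight k \<alpha>)) summable_on UNIV"
    using F G unfolding dist_space_at_def mem_Collect_eq
    by (intro summable_on_add summable_on_cmult_right)
  fix \<alpha>
  have w: "?w \<alpha> \<ge> 0"
    using mi_weight_pos[of k \<alpha>] mi_fact_pos[of \<alpha>] by (simp add: less_imp_le)
  have "(F \<alpha> + G \<alpha>)\<^sup>2 \<le> 2 * (F \<alpha>)\<^sup>2 + 2 * (G \<alpha>)\<^sup>2"
    using sum_squares_bound[of "F \<alpha>" "G \<alpha>"] by (simp add: power2_sum)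
  from mult_left_mono[OF this w]
  show "mi_fact \<alpha> ^ (1 - \<rho>) * (F \<alpha> + G \<alpha>)\<^sup>2 / mi_weight k \<alpha>
      \<le> 2 * (mi_fact \<alpha> ^ (1 - \<rho>) * (F \<alpha>)\<^sup>2 / mi_weight k \<alpha>) +
        2 * (mi_fact \<alpha> ^ (1 - \<rho>) * (G \<alpha>)\<^sup>2 / mi_weight k \<alpha>)"
    by (simp add: distrib_left add_divide_distrib mult_ac)
  show "0 \<le> mi_fact \<alpha> ^ (1 - \<rho>) * (F \<alpha> + G \<alpha>)\<^sup>2 / mi_weight k \<alpha>"
    using mi_weight_pos[of k \<alpha>] mi_fact_pos[of \<alpha>] by (simp add: less_imp_le)
qed

lemma dist_space_add:
  assumes "F \<in> dist_space \<rho>" "G \<in> dist_space \<rho>"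
  shows "(\<lambda>\<alpha>. F \<alpha> + G \<alpha>) \<in> dist_space \<rho>"
proof -
  obtain k l where "F \<in> dist_space_at \<rho> k" "G \<in> dist_space_at \<rho> l"
    using assms by (auto simp: dist_space_def)
  then have "F \<in> dist_space_at \<rho> (max k l)" "G \<in> dist_space_at \<rho> (max k l)"
    using dist_space_at_mono[of k "max k l" \<rho>] dist_space_at_mono[of l "max k l" \<rho>] by auto
  then show ?thesis
    unfolding dist_space_def by (blast intro: dist_space_at_add)
qed

lemma dist_nhds0_Int:
  assumes "V \<in> dist_nhds0 \<rho>" "W \<in> dist_nhds0 \<rho>" shows "V \<inter> W \<in> dist_nhds0 \<rho>"
  unfolding dist_nhds0_def mem_Collect_eq
proof (intro conjI allI)
  show "V \<inter> W \<subseteq> dist_space \<rho>" using assms by (auto simp: dist_nhds0_def)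
  show "\<forall>F\<in>V \<inter> W. \<forall>G\<in>V \<inter> W. \<forall>a b. \<bar>a\<bar> + \<bar>b\<bar> \<le> 1 \<longrightarrow> (\<lambda>\<alpha>. a * F \<alpha> + b * G \<alpha>) \<in> V \<inter> W"
    using assms by (auto simp: dist_nhds0_def)
  fix k
  obtain d where "d > 0" "\<forall>F\<in>dist_space_at \<rho> k. dist_norm \<rho> k F < d \<longrightarrow> F \<in> V"
    using assms(1) unfolding dist_nhds0_def by blast
  moreover obtain e where "e > 0" "\<forall>F\<in>dist_space_at \<rho> k. dist_norm \<rho> k F < e \<longrightarrow> F \<in> W"
    using assms(2) unfolding dist_nhds0_def by blast
  ultimately show "\<exists>e>0. \<forall>F\<in>dist_space_at \<rho> k. dist_norm \<rho> k F < e \<longrightarrow> F \<in> V \<inter> W"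
    by (intro exI[of _ "min d e"]) auto
qed

lemma dist_space_nhds0: "dist_space \<rho> \<in> dist_nhds0 \<rho>"
  unfolding dist_nhds0_def mem_Collect_eq
proof (intro conjI ballI allI impI)
  have scale: "(\<lambda>\<alpha>. a * F \<alpha>) \<in> dist_space \<rho>" if F: "F \<in> dist_space \<rho>" for a F
  proof -
    obtain k where "(\<lambda>\<alpha>. mi_fact \<alpha> ^ (1 - \<rho>) * (F \<alpha>)\<^sup>2 / mi_weight k \<alpha>) summable_on UNIV"
      using F by (auto simp: dist_space_def dist_space_at_def)
    then have "(\<lambda>\<alpha>. a\<^sup>2 * (mi_fact \<alpha> ^ (1 - \<rho>) * (F \<alpha>)\<^sup>2 / mi_weight k \<alpha>)) summable_on UNIV"
      by (rule summable_on_cmult_right)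
    moreover have "(\<lambda>\<alpha>. a\<^sup>2 * (mi_fact \<alpha> ^ (1 - \<rho>) * (F \<alpha>)\<^sup>2 / mi_weight k \<alpha>)) =
        (\<lambda>\<alpha>. mi_fact \<alpha> ^ (1 - \<rho>) * (a * F \<alpha>)\<^sup>2 / mi_weight k \<alpha>)"
      by (simp add: fun_eq_iff power_mult_distrib)
    ultimately show ?thesis
      by (auto simp: dist_space_def dist_space_at_def)
  qed
  fix F G :: chaos and a b :: real
  assume "F \<in> dist_space \<rho>" "G \<in> dist_space \<rho>"
  then show "(\<lambda>\<alpha>. a * F \<alpha> + b * G \<alpha>) \<in> dist_space \<rho>"
    by (intro dist_space_add scale)
next
  fix k
  show "\<exists>e>0. \<forall>F\<in>dist_space_at \<rho> k. dist_norm \<rho> k F < e \<longrightarrow> F \<in> dist_space \<rho>"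
    by (intro exI[of _ 1]) (auto simp: dist_space_def)
qed simp

lemma openin_dist_topology:
  "openin (dist_topology \<rho>) V \<longleftrightarrow> V \<subseteq> dist_space \<rho> \<and>
     (\<forall>F\<in>V. \<exists>W\<in>dist_nhds0 \<rho>. \<forall>H\<in>W. (\<lambda>\<alpha>. F \<alpha> + H \<alpha>) \<in> V)"
proof -
  have "istopology (\<lambda>V. V \<subseteq> dist_space \<rho> \<and>
     (\<forall>F\<in>V. \<exists>W\<in>dist_nhds0 \<rho>. \<forall>H\<in>W. (\<lambda>\<alpha>. F \<alpha> + H \<alpha>) \<in> V))"
    unfolding istopology_def
  proof (intro conjI allI impI)
    fix S T
    assume S: "S \<subseteq> dist_space \<rho> \<and> (\<forall>F\<in>S. \<exists>W\<in>dist_nhds0 \<rho>. \<forall>H\<in>W. (\<lambda>\<alpha>. F \<alpha> + H \<alpha>) \<in> S)"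
      and T: "T \<subseteq> dist_space \<rho> \<and> (\<forall>F\<in>T. \<exists>W\<in>dist_nhds0 \<rho>. \<forall>H\<in>W. (\<lambda>\<alpha>. F \<alpha> + H \<alpha>) \<in> T)"
    show "S \<inter> T \<subseteq> dist_space \<rho>" using S by blast
    show "\<forall>F\<in>S \<inter> T. \<exists>W\<in>dist_nhds0 \<rho>. \<forall>H\<in>W. (\<lambda>\<alpha>. F \<alpha> + H \<alpha>) \<in> S \<inter> T"
    proof
      fix F assume "F \<in> S \<inter> T"
      then obtain V W where "V \<in> dist_nhds0 \<rho>" "\<forall>H\<in>V. (\<lambda>\<alpha>. F \<alpha> + H \<alpha>) \<in> S"
        "W \<in> dist_nhds0 \<rho>" "\<forall>H\<in>W. (\<lambda>\<alpha>. F \<alpha> + H \<alpha>) \<in> T"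
        using S T by blast
      then show "\<exists>W\<in>dist_nhds0 \<rho>. \<forall>H\<in>W. (\<lambda>\<alpha>. F \<alpha> + H \<alpha>) \<in> S \<inter> T"
        by (intro bexI[of _ "V \<inter> W"] dist_nhds0_Int) auto
    qed
  qed fastforce+
  then show ?thesis
    by (simp add: dist_topology_def topology_inverse')
qed

lemma topspace_dist_topology: "topspace (dist_topology \<rho>) = dist_space \<rho>"
proof -
  have "openin (dist_topology \<rho>) (dist_space \<rho>)"
    unfolding openin_dist_topology
    by (auto intro!: bexI[OF _ dist_space_nhds0] dist_space_add)
  then show ?thesis
    by (meson openin_dist_topology openin_subset openin_topspace subset_antisym)
qed


section \<open>Differentiation and integration of distribution processes\<close>

definition has_partial_dist ::
  "nat \<Rightarrow> (real ^ 'n) set \<Rightarrow> 'n \<Rightarrow> (real ^ 'n \<Rightarrow> chaos) \<Rightarrow> (real ^ 'n \<Rightarrow> chaos) \<Rightarrow> bool" where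
  "has_partial_dist \<rho> D j U V \<longleftrightarrow>
     (\<forall>x\<in>D. limitin (dist_topology \<rho>)
        (\<lambda>t \<alpha>. (U (x + t *\<^sub>R axis j 1) \<alpha> - U x \<alpha>) / t) (V x) (at 0))"

definition has_laplacian_dist ::
  "nat \<Rightarrow> (real ^ 'n) set \<Rightarrow> (real ^ 'n \<Rightarrow> chaos) \<Rightarrow> (real ^ 'n \<Rightarrow> chaos) \<Rightarrow> bool" where
  "has_laplacian_dist \<rho> D U L \<longleftrightarrow>
     (\<exists>V W. (\<forall>j. has_partial_dist \<rho> D j U (V j) \<and> has_partial_dist \<rho> D j (V j) (W j)) \<and>
            (\<forall>x\<in>D. L x = (\<lambda>\<alpha>. \<Sum>j\<in>UNIV. W j x \<alpha>)))"

definition C2_dist :: "nat \<Rightarrow> (real ^ 'n) set \<Rightarrow> (real ^ 'n \<Rightarrow> chaos) \<Rightarrow> bool" where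
  "C2_dist \<rho> D U \<longleftrightarrow>
     continuous_map (top_of_set D) (dist_topology \<rho>) U \<and>
     (\<exists>V W. \<forall>i. has_partial_dist \<rho> D i U (V i) \<and>
        continuous_map (top_of_set D) (dist_topology \<rho>) (V i) \<and>
        (\<forall>j. has_partial_dist \<rho> D j (V i) (W i j) \<and>
             continuous_map (top_of_set D) (dist_topology \<rho>) (W i j)))"

text \<open>
  The Bochner integral in \<open>dist_space \<rho>\<close>: the integrand is almost everywhere in one of the Hilbert
  spaces \<open>dist_space_at \<rho> k\<close> and is there the \<open>L\<^sup>1\<close>-limit of simple functions whose integrals
  converge to the value. The library's Bochner integral needs a Banach space given as a type,
  which is not available for these spaces. Measurability of the distances, together with the
  \<open>L\<^sup>1\<close>-convergence, includes strong measurability of the integrand.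
\<close>

definition simple_dist_integrable ::
  "nat \<Rightarrow> nat \<Rightarrow> 'a measure \<Rightarrow> ('a \<Rightarrow> chaos) \<Rightarrow> bool" where
  "simple_dist_integrable \<rho> k M s \<longleftrightarrow>
     simple_function M s \<and> s ` space M \<subseteq> dist_space_at \<rho> k \<and>
     emeasure M {y\<in>space M. s y \<noteq> (\<lambda>\<alpha>. 0)} < \<infinity>"

definition simple_dist_integral :: "'a measure \<Rightarrow> ('a \<Rightarrow> chaos) \<Rightarrow> chaos" where
  "simple_dist_integral M s = (\<lambda>\<alpha>. \<Sum>F\<in>s ` space M. measure M {y\<in>space M. s y = F} * F \<alpha>)"

definition has_bochner_integral_dist ::
  "nat \<Rightarrow> 'a measure \<Rightarrow> ('a \<Rightarrow> chaos) \<Rightarrow> chaos \<Rightarrow> bool" where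
  "has_bochner_integral_dist \<rho> M f I \<longleftrightarrow>
     (\<exists>k s. (AE y in M. f y \<in> dist_space_at \<rho> k) \<and> I \<in> dist_space_at \<rho> k \<and>
        (\<forall>n. simple_dist_integrable \<rho> k M (s n)) \<and>
        (\<forall>n. (\<lambda>y. dist_norm \<rho> k (\<lambda>\<alpha>. f y \<alpha> - s n y \<alpha>)) \<in> borel_measurable M) \<and>
        (\<lambda>n. \<integral>\<^sup>+y. ennreal (dist_norm \<rho> k (\<lambda>\<alpha>. f y \<alpha> - s n y \<alpha>)) \<partial>M) \<longlonglongrightarrow> 0 \<and>
        (\<lambda>n. dist_norm \<rho> k (\<lambda>\<alpha>. simple_dist_integral M (s n) \<alpha> - I \<alpha>)) \<longlonglongrightarrow> 0)"


section \<open>Classical potential theory\<close>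

definition has_partial_real ::
  "(real ^ 'n) set \<Rightarrow> 'n \<Rightarrow> (real ^ 'n \<Rightarrow> real) \<Rightarrow> (real ^ 'n \<Rightarrow> real) \<Rightarrow> bool" where
  "has_partial_real D j u v \<longleftrightarrow>
     (\<forall>x\<in>D. ((\<lambda>t. u (x + t *\<^sub>R axis j 1)) has_real_derivative v x) (at 0))"

definition harmonic_fun :: "(real ^ 'n) set \<Rightarrow> (real ^ 'n \<Rightarrow> real) \<Rightarrow> bool" where
  "harmonic_fun D u \<longleftrightarrow>
     continuous_on D u \<and>
     (\<exists>v w. (\<forall>i. has_partial_real D i u (v i) \<and> continuous_on D (v i) \<and>
                 (\<forall>j. has_partial_real D j (v i) (w i j) \<and> continuous_on D (w i j))) \<and>
            (\<forall>x\<in>D. (\<Sum>i\<in>UNIV. w i i x) = 0))"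

definition solves_dirichlet ::
  "(real ^ 'n) set \<Rightarrow> (real ^ 'n \<Rightarrow> real) \<Rightarrow> (real ^ 'n \<Rightarrow> real) \<Rightarrow> bool" where
  "solves_dirichlet D g u \<longleftrightarrow>
     continuous_on (closure D) u \<and> harmonic_fun D u \<and> (\<forall>x\<in>frontier D. u x = g x)"

text \<open>Regularity for the Dirichlet problem: it is solvable for all continuous boundary data.\<close>

definition regular_boundary :: "(real ^ 'n) set \<Rightarrow> bool" where
  "regular_boundary D \<longleftrightarrow> (\<forall>g. continuous_on (frontier D) g \<longrightarrow> (\<exists>u. solves_dirichlet D g u))"

text \<open>
  The fundamental solution of the negative Laplacian, with \<open>unit_ball_vol d\<close> the volume of the unit
  ball. For \<open>d = 1\<close> the second branch is \<open>- \<bar>x\<bar> / 2\<close>.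
\<close>

definition newton_kernel :: "real ^ 'n \<Rightarrow> real" where
  "newton_kernel x = (let d = real CARD('n) in
     if d = 2 then - ln (norm x) / (2 * pi)
     else norm x powr (2 - d) / (d * (d - 2) * unit_ball_vol d))"

text \<open>
  The Green function of \<open>D\<close>: the kernel with pole \<open>x\<close>, corrected by a harmonic function so as to vanish
  on the boundary, and extended by 0. The value at the pole, a null set, is left open.
\<close>

definition green_function :: "(real ^ 'n) set \<Rightarrow> (real ^ 'n \<Rightarrow> real ^ 'n \<Rightarrow> real) \<Rightarrow> bool" where
  "green_function D G \<longleftrightarrow>
     (\<forall>x y. x \<notin> D \<or> y \<notin> D \<longrightarrow> G x y = 0) \<and>
     (\<forall>x\<in>D. \<exists>u. solves_dirichlet D (\<lambda>y. newton_kernel (y - x)) u \<and>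
               (\<forall>y\<in>D - {x}. G x y = newton_kernel (y - x) - u y))"


section \<open>The stochastic Poisson equation\<close>

text \<open>
  As in the classical Dirichlet problem, a solution is required to be continuous up to the
  boundary; without this the boundary condition would not restrict the values in \<open>D\<close>. Only the
  weaker topology on the Kondratiev space, in which the Laplacian is taken, is used here.
\<close>

definition solves_stochastic_poisson ::
  "real measure \<Rightarrow> (nat ^ 'n \<Rightarrow> nat) \<Rightarrow> (real ^ 'n) set \<Rightarrow> (real ^ 'n \<Rightarrow> chaos) \<Rightarrow> bool" where
  "solves_stochastic_poisson \<nu> h D U \<longleftrightarrow>
     (\<forall>x\<in>closure D. U x \<in> hida_dist) \<and>
     continuous_map (top_of_set (closure D)) kondratiev_topology U \<and>
     has_laplacian_dist 1 D U (\<lambda>x \<alpha>. - levy_noise \<nu> h x \<alpha>) \<and>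
     (\<forall>x\<in>frontier D. U x = (\<lambda>\<alpha>. 0))"

end

theory Submission
  imports Defs
begin

text \<open>
  A coefficient functional is continuous on the Kondratiev space, so a solution is determined by
  real functions on \<open>D\<close>, and the maximum principle (which needs only the pure second partial
  derivatives) gives uniqueness. For existence one solves \<open>- \<Delta> u\<^sub>k = \<zeta>\<^sub>k\<close>, \<open>u\<^sub>k = 0\<close> on the boundary, for each
  basis function. The noise only charges the indices \<open>\<epsilon>(z(k, 1))\<close>, whose weights \<open>2 z(k, 1)\<close> have
  summable inverses; hence everything holds in the topology of \<open>(S)\<^sup>*\<close> as soon as \<open>u\<^sub>k\<close> and its first two
  derivatives are bounded locally uniformly in \<open>D\<close> and uniformly in \<open>k\<close>.

  The enumeration \<open>h\<close> is arbitrary, so bounds that grow with the Hermite indices are useless. Instead,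
  \<open>- \<Delta>\<zeta>\<^sub>k + \<bar>x\<bar>\<^sup>2 \<zeta>\<^sub>k = \<Lambda>\<^sub>k \<zeta>\<^sub>k\<close> together with an energy estimate shows that the derivatives of \<open>\<zeta>\<^sub>k\<close> up to
  order two are \<open>O(\<Lambda>\<^sub>k)\<close> on bounded sets, and \<open>(\<zeta>\<^sub>k + N(\<bar>x\<bar>\<^sup>2 \<zeta>\<^sub>k)) / \<Lambda>\<^sub>k\<close>, with \<open>N\<close> the Newton potential after a cut-off,
  is a particular solution with uniform bounds. The harmonic correction with the same boundary values
  is controlled by the maximum principle and interior estimates. Finally \<open>u\<^sub>k = \<integral> G(\<cdot>, y) \<zeta>\<^sub>k(y) dy\<close> by testing
  the Green function against cut-offs of \<open>u\<^sub>k\<close>, and sums over \<open>k\<close> are handled by dominated convergence.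
\<close>

section \<open>Twice continuously differentiable functions and integration by parts\<close>

text \<open>The boundary of \<open>D\<close> is only regular for the Dirichlet problem. It may be
  rough, gradients of solutions may blow up there, and Green's formula cannot be applied up to it.
  Every integration by parts is therefore made against a compactly supported function, where it
  reduces to translation invariance of Lebesgue measure, and the boundary is approached through
  level sets of a positive solution. Positivity is arranged by adding a multiple of the solution of
  \<open>- \<Delta> t = 1\<close> with zero boundary values. Derivatives up to order two are what
  the statement speaks of, so cut-offs are piecewise polynomial C^2 functions. Second derivatives of
  a harmonic function are estimated by differentiating the mean value identity for an averaging
  weight once; the averages are then Lipschitz because the weight is. On the indices \<epsilon>(z(k,
  1)) the factorial is 1 and the weight grows quadratically in k. Thus one Hilbert space, with
  exponent 1, carries the whole construction, and the same estimates serve \<rho> = 0 (regularity of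
  the solution) and \<rho> = 1 (the equation).\<close>

text \<open>Along an arbitrary null sequence the difference quotients are dominated by
  \<open>g\<close>, by the mean value inequality, so dominated convergence gives both claims;
  \<open>f' t0\<close> is measurable as a limit of the quotients.\<close>

lemma has_real_derivative_integral:
  fixes f f' :: "real \<Rightarrow> 'a \<Rightarrow> real"
  assumes \<delta>: "\<delta> > 0"
    and int: "\<And>t. \<bar>t - t0\<bar> < \<delta> \<Longrightarrow> integrable M (f t)"
    and der: "\<And>t y. \<bar>t - t0\<bar> < \<delta> \<Longrightarrow> y \<in> space M \<Longrightarrow> ((\<lambda>t. f t y) has_real_derivative f' t y) (at t)"
    and bnd: "\<And>t y. \<bar>t - t0\<bar> < \<delta> \<Longrightarrow> y \<in> space M \<Longrightarrow> \<bar>f' t y\<bar> \<le> g y"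
    and g: "integrable M g"
  shows "integrable M (f' t0)"
    and "((\<lambda>t. \<integral>y. f t y \<partial>M) has_real_derivative (\<integral>y. f' t0 y \<partial>M)) (at t0)"
proof -
  have main: "integrable M (f' t0) \<and>
      (\<lambda>n. ((\<integral>y. f (t0 + S n) y \<partial>M) - (\<integral>y. f t0 y \<partial>M)) / S n) \<longlonglongrightarrow> (\<integral>y. f' t0 y \<partial>M)"
    if S: "S \<longlonglongrightarrow> 0" "\<And>n. S n \<noteq> 0" for S :: "nat \<Rightarrow> real"
  proof -
    \<comment> \<open>The domination holds only inside the \<delta>-interval, so the sequence is
      entered at index \<open>N\<close>; \<open>LIMSEQ_offset\<close> undoes the shift at the
      end.\<close>
    obtain N where N: "\<And>n. n \<ge> N \<Longrightarrow> \<bar>S n\<bar> < \<delta>"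
      using S(1) \<delta> unfolding LIMSEQ_iff by auto
    define q where "q n y = (f (t0 + S (n + N)) y - f t0 y) / S (n + N)" for n y
    have qi: "integrable M (q n)" for n
      unfolding q_def using N[of "n + N"] \<delta> by (intro integrable_divide_zero Bochner_Integration.integrable_diff int) auto
    have ql: "(\<lambda>n. q n y) \<longlonglongrightarrow> f' t0 y" if "y \<in> space M" for y
    proof -
      have "(\<lambda>h. (f (t0 + h) y - f t0 y) / h) \<midarrow>0\<rightarrow> f' t0 y"
        using der[of t0 y] \<delta> that by (simp add: DERIV_def)
      then have "(\<lambda>n. (f (t0 + S n) y - f t0 y) / S n) \<longlonglongrightarrow> f' t0 y"
        using S unfolding LIMSEQ_SEQ_conv[symmetric] by auto
      then show ?thesis unfolding q_def by (rule LIMSEQ_ignore_initial_segment)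
    qed
    have qb: "\<bar>q n y\<bar> \<le> g y" if y: "y \<in> space M" for n y
    proof -
      define h where "h = S (n + N)"
      have h: "h \<noteq> 0" "\<bar>h\<bar> < \<delta>" using S N[of "n+N"] by (auto simp: h_def)
      have "\<bar>f (t0 + h) y - f t0 y\<bar> \<le> g y * \<bar>h\<bar>"
      proof -
        have "norm (f (t0 + h) y - f t0 y) \<le> g y * norm (t0 + h - t0)"
        proof (rule field_differentiable_bound[of "{t0 - \<bar>h\<bar>..t0 + \<bar>h\<bar>}"])
          fix t assume t: "t \<in> {t0 - \<bar>h\<bar>..t0 + \<bar>h\<bar>}"
          then have td: "\<bar>t - t0\<bar> < \<delta>" using h by auto
          show "((\<lambda>t. f t y) has_field_derivative f' t y) (at t within {t0 - \<bar>h\<bar>..t0 + \<bar>h\<bar>})"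
            using der[OF td y] by (rule has_field_derivative_at_within)
          show "norm (f' t y) \<le> g y" using bnd[OF td y] by simp
        qed auto
        then show ?thesis by simp
      qed
      then show ?thesis using h unfolding q_def h_def[symmetric] by (simp add: divide_simps)
    qed
    have meas: "f' t0 \<in> borel_measurable M"
      by (rule borel_measurable_LIMSEQ_real[OF ql]) (use qi in auto)
    have dc: "(\<lambda>n. \<integral>y. q n y \<partial>M) \<longlonglongrightarrow> (\<integral>y. f' t0 y \<partial>M)"
      by (rule integral_dominated_convergence[OF meas _ g]) (use qi ql qb in auto)
    have fi: "integrable M (f' t0)"
      by (rule Bochner_Integration.integrable_bound[OF g meas]) (use bnd[of t0] \<delta> in \<open>auto intro: order_trans[OF _ abs_ge_self]\<close>)
    have "(\<integral>y. q n y \<partial>M) = ((\<integral>y. f (t0 + S (n+N)) y \<partial>M) - (\<integral>y. f t0 y \<partial>M)) / S (n+N)" for n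
      unfolding q_def using int[of "t0 + S (n+N)"] int[of t0] N[of "n+N"] \<delta>
      by (simp add: Bochner_Integration.integral_diff)
    then show ?thesis
      using dc fi by (auto intro: LIMSEQ_offset[where k=N])
  qed
  have "(\<lambda>n. inverse (real (Suc n))) \<longlonglongrightarrow> 0" by (rule LIMSEQ_inverse_real_of_nat)
  from main[OF this] show "integrable M (f' t0)" by simp
  show "((\<lambda>t. \<integral>y. f t y \<partial>M) has_real_derivative (\<integral>y. f' t0 y \<partial>M)) (at t0)"
    unfolding DERIV_def LIMSEQ_SEQ_conv[symmetric] using main by auto
qed

text \<open>Measurability of \<open>f\<close> and of its translate are equivalent, and a function
  that is not integrable has integral 0. Both equations hence hold for arbitrary \<open>f\<close>
  and can be used as plain rewriting.\<close>

lemma lborel_integral_translate: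
  fixes f :: "'a::euclidean_space \<Rightarrow> real"
  shows "(\<integral>y. f (c + y) \<partial>lborel) = (\<integral>y. f y \<partial>lborel)"
    and "integrable lborel (\<lambda>y. f (c + y)) \<longleftrightarrow> integrable lborel f"
proof -
  have *: "lborel = distr lborel borel ((+) c)" by (rule lborel_distr_plus[symmetric])
  have m: "(\<lambda>y. f (c + y)) \<in> borel_measurable borel \<longleftrightarrow> f \<in> borel_measurable borel"
  proof
    assume "(\<lambda>y. f (c + y)) \<in> borel_measurable borel"
    then have "(\<lambda>y. f (c + (- c + y))) \<in> borel_measurable borel"
      by (rule measurable_compose_rev) simp
    then show "f \<in> borel_measurable borel" by simp
  qed simp
  show "integrable lborel (\<lambda>y. f (c + y)) \<longleftrightarrow> integrable lborel f"
  proof (cases "f \<in> borel_measurable borel")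
    case True
    then show ?thesis by (subst (2) *, subst integrable_distr_eq) auto
  next
    case False
    then show ?thesis using m by (auto dest!: borel_measurable_integrable)
  qed
  then show "(\<integral>y. f (c + y) \<partial>lborel) = (\<integral>y. f y \<partial>lborel)"
    by (cases "integrable lborel f")
      (subst (2) *, subst integral_distr, auto simp: not_integrable_integral_eq)
qed

section \<open>Calculus of twice continuously differentiable functions\<close>

text \<open>The derivatives are explicit arguments rather than bound by an existential quantifier,
  so that Laplacians can be written as sums of \<open>w i i\<close> and carried through the product
  and chain rules.\<close>

definition C2_real :: "(real ^ 'n) set \<Rightarrow> (real ^ 'n \<Rightarrow> real) \<Rightarrow> ('n \<Rightarrow> real ^ 'n \<Rightarrow> real) \<Rightarrow>
    ('n \<Rightarrow> 'n \<Rightarrow> real ^ 'n \<Rightarrow> real) \<Rightarrow> bool" where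
  "C2_real D u v w \<longleftrightarrow> continuous_on D u \<and>
     (\<forall>i. has_partial_real D i u (v i) \<and> continuous_on D (v i) \<and>
       (\<forall>j. has_partial_real D j (v i) (w i j) \<and> continuous_on D (w i j)))"

lemma harmonic_fun_C2_real:
  "harmonic_fun D u \<longleftrightarrow> (\<exists>v w. C2_real D u v w \<and> (\<forall>x\<in>D. (\<Sum>i\<in>UNIV. w i i x) = 0))"
  unfolding harmonic_fun_def C2_real_def by blast

lemma has_partial_real_at:
  assumes "has_partial_real D j u v" "x + t *\<^sub>R axis j 1 \<in> D"
  shows "((\<lambda>t. u (x + t *\<^sub>R axis j 1)) has_real_derivative v (x + t *\<^sub>R axis j 1)) (at t)"
proof -
  have "((\<lambda>s. u ((x + t *\<^sub>R axis j 1) + s *\<^sub>R axis j 1)) has_real_derivative v (x + t *\<^sub>R axis j 1)) (at 0)"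
    using assms by (simp add: has_partial_real_def)
  then show ?thesis
    using DERIV_shift[of "\<lambda>t. u (x + t *\<^sub>R axis j 1)" "v (x + t *\<^sub>R axis j 1)" 0 t]
    by (simp add: algebra_simps)
qed

lemma eventually_axis_in_open:
  assumes "open D" "x \<in> D"
  shows "eventually (\<lambda>t. x + t *\<^sub>R axis j (1::real) \<in> D) (nhds 0)"
proof -
  have "((\<lambda>t. x + t *\<^sub>R axis j (1::real)) \<longlongrightarrow> x + 0 *\<^sub>R axis j 1) (nhds 0)"
    by (intro tendsto_intros filterlim_ident)
  then show ?thesis using topological_tendstoD[OF _ assms(1)] assms(2) by force
qed

lemma has_partial_real_cong:
  assumes "open D" "\<And>x. x \<in> D \<Longrightarrow> u x = u' x" "\<And>x. x \<in> D \<Longrightarrow> v x = v' x"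
    "has_partial_real D j u v"
  shows "has_partial_real D j u' v'"
  unfolding has_partial_real_def
proof
  fix x assume x: "x \<in> D"
  have "((\<lambda>t. u (x + t *\<^sub>R axis j 1)) has_real_derivative v x) (at 0)"
    using assms(4) x by (auto simp: has_partial_real_def)
  moreover have "eventually (\<lambda>t. u (x + t *\<^sub>R axis j 1) = u' (x + t *\<^sub>R axis j 1)) (nhds 0)"
    using eventually_axis_in_open[OF assms(1) x, of j] by eventually_elim (auto simp: assms)
  ultimately show "((\<lambda>t. u' (x + t *\<^sub>R axis j 1)) has_real_derivative v' x) (at 0)"
    using x assms(3) by (subst (asm) DERIV_cong_ev) auto
qed

lemma C2_real_subset: "C2_real D u v w \<Longrightarrow> E \<subseteq> D \<Longrightarrow> C2_real E u v w"
  unfolding C2_real_def has_partial_real_def by (blast intro: continuous_on_subset)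

lemma C2_real_add:
  "C2_real D u v w \<Longrightarrow> C2_real D u' v' w' \<Longrightarrow>
   C2_real D (\<lambda>x. u x + u' x) (\<lambda>i x. v i x + v' i x) (\<lambda>i j x. w i j x + w' i j x)"
  unfolding C2_real_def has_partial_real_def by (auto intro!: continuous_intros derivative_intros)

lemma C2_real_cmult:
  "C2_real D u v w \<Longrightarrow> C2_real D (\<lambda>x. c * u x) (\<lambda>i x. c * v i x) (\<lambda>i j x. c * w i j x)"
  unfolding C2_real_def has_partial_real_def by (auto intro!: continuous_intros DERIV_cmult)

lemma has_partial_real_mult:
  assumes "has_partial_real D j f f'" "has_partial_real D j g g'"
  shows "has_partial_real D j (\<lambda>x. f x * g x) (\<lambda>x. f' x * g x + f x * g' x)"
  unfolding has_partial_real_def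
proof
  fix x assume "x \<in> D"
  then have "((\<lambda>t. f (x + t *\<^sub>R axis j 1)) has_real_derivative f' x) (at 0)"
    "((\<lambda>t. g (x + t *\<^sub>R axis j 1)) has_real_derivative g' x) (at 0)"
    using assms by (auto simp: has_partial_real_def)
  from DERIV_mult[OF this]
  show "((\<lambda>t. f (x + t *\<^sub>R axis j 1) * g (x + t *\<^sub>R axis j 1)) has_real_derivative f' x * g x + f x * g' x) (at 0)"
    by (simp add: algebra_simps)
qed

lemma has_partial_real_add:
  "has_partial_real D j f f' \<Longrightarrow> has_partial_real D j g g' \<Longrightarrow>
    has_partial_real D j (\<lambda>x. f x + g x) (\<lambda>x. f' x + g' x)"
  unfolding has_partial_real_def by (auto intro!: derivative_intros)

lemma has_partial_real_diff:
  "has_partial_real D j f f' \<Longrightarrow> has_partial_real D j g g' \<Longrightarrow>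
    has_partial_real D j (\<lambda>x. f x - g x) (\<lambda>x. f' x - g' x)"
  unfolding has_partial_real_def by (auto intro!: DERIV_diff)

lemma C2_real_mult:
  assumes "C2_real D u v w" "C2_real D u' v' w'"
  shows "C2_real D (\<lambda>x. u x * u' x) (\<lambda>i x. v i x * u' x + u x * v' i x)
     (\<lambda>i j x. w i j x * u' x + v i x * v' j x + (v j x * v' i x + u x * w' i j x))"
  using assms unfolding C2_real_def
  by (intro conjI allI continuous_intros has_partial_real_mult has_partial_real_add) blast+

text \<open>The set \<open>S\<close> admits outer functions that are smooth only on the range of
  \<open>u\<close>, such as the Newton profile on the positive half-line.\<close>

lemma C2_real_compose:
  assumes u: "C2_real D u v w" and S: "\<And>x. x \<in> D \<Longrightarrow> u x \<in> S"
    and p: "\<And>s. s \<in> S \<Longrightarrow> (\<psi> has_real_derivative \<psi>' s) (at s)"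
      "\<And>s. s \<in> S \<Longrightarrow> (\<psi>' has_real_derivative \<psi>'' s) (at s)"
    and c: "continuous_on S \<psi>''"
  shows "C2_real D (\<lambda>x. \<psi> (u x)) (\<lambda>i x. \<psi>' (u x) * v i x)
     (\<lambda>i j x. \<psi>'' (u x) * v j x * v i x + \<psi>' (u x) * w i j x)"
proof -
  have cont: "continuous_on S \<psi>" "continuous_on S \<psi>'"
    using p by (auto intro!: continuous_at_imp_continuous_on DERIV_isCont)
  note cc = continuous_on_compose2[OF cont(1), of D u] continuous_on_compose2[OF cont(2), of D u]
    continuous_on_compose2[OF c, of D u]
  have ch: "has_partial_real D j (\<lambda>x. f (u x)) (\<lambda>x. f' (u x) * v j x)"
    if f: "\<And>s. s \<in> S \<Longrightarrow> (f has_real_derivative f' s) (at s)" for f f' j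
    unfolding has_partial_real_def
  proof
    fix x assume x: "x \<in> D"
    then have "((\<lambda>t. u (x + t *\<^sub>R axis j 1)) has_real_derivative v j x) (at 0)"
      using u by (auto simp: C2_real_def has_partial_real_def)
    from DERIV_chain2[OF f this] S[OF x]
    show "((\<lambda>t. f (u (x + t *\<^sub>R axis j 1))) has_real_derivative f' (u x) * v j x) (at 0)" by simp
  qed
  show ?thesis
    using u unfolding C2_real_def
    by (intro conjI allI continuous_intros ch p has_partial_real_mult cc) (auto intro: S)
qed

lemma C2_real_const: "C2_real D (\<lambda>_. c) (\<lambda>_ _. 0) (\<lambda>_ _ _. 0)"
  by (auto simp: C2_real_def has_partial_real_def)

text \<open>Radial functions are obtained by composing with this polynomial instead of the norm,
  which is not differentiable at the centre. The constant \<open>a\<close> becomes the smoothing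
  parameter of the Newton kernel or minus the squared radius of a bump.\<close>

lemma C2_real_norm_sq:
  "C2_real UNIV (\<lambda>y. a + (norm (y - x))\<^sup>2) (\<lambda>i y. 2 * (y $ i - x $ i)) (\<lambda>i j y. if i = j then 2 else 0)"
proof -
  have 1: "has_partial_real UNIV i (\<lambda>y. a + (norm (y - x))\<^sup>2) (\<lambda>y. 2 * (y $ i - x $ i))" for i
    unfolding has_partial_real_def
  proof
    fix y
    have "(\<lambda>t. a + (norm (y + t *\<^sub>R axis i 1 - x))\<^sup>2) = (\<lambda>t. a + (norm (y - x))\<^sup>2 + 2 * t * (y $ i - x $ i) + t\<^sup>2)"
    proof
      fix t
      have "y + t *\<^sub>R axis i 1 - x = (y - x) + t *\<^sub>R axis i 1" by simp
      then show "a + (norm (y + t *\<^sub>R axis i 1 - x))\<^sup>2 = a + (norm (y - x))\<^sup>2 + 2 * t * (y $ i - x $ i) + t\<^sup>2"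
        by (simp only: power2_norm_eq_inner inner_add_left inner_add_right)
          (simp add: inner_axis inner_axis' power2_eq_square algebra_simps)
    qed
    then show "((\<lambda>t. a + (norm (y + t *\<^sub>R axis i 1 - x))\<^sup>2) has_real_derivative 2 * (y $ i - x $ i)) (at 0)"
      by (auto intro!: derivative_eq_intros)
  qed
  have 2: "has_partial_real UNIV j (\<lambda>y. 2 * (y $ i - x $ i)) (\<lambda>y. if i = j then 2 else 0)" for i j
    unfolding has_partial_real_def by (auto intro!: derivative_eq_intros simp: axis_def)
  show ?thesis unfolding C2_real_def
    by (intro conjI allI 1 2 continuous_intros)
qed

text \<open>\<open>D\<close> and the complement of \<open>K\<close> are open sets covering the
  space, and the extension is C^2 on each of them: on the second it is 0, since the derivatives of
  \<open>u\<close> vanish on the open set \<open>D - K\<close>.\<close>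

lemma C2_real_extend:
  assumes u: "C2_real D u v w" and D: "open D" and K: "compact K" "K \<subseteq> D"
    and z: "\<And>x. x \<in> D - K \<Longrightarrow> u x = 0"
  defines "e \<equiv> \<lambda>f x. if x \<in> D then f x else (0::real)"
  shows "C2_real UNIV (e u) (\<lambda>i. e (v i)) (\<lambda>i j. e (w i j))"
    and "\<And>x. x \<notin> K \<Longrightarrow> e u x = 0 \<and> (\<forall>i. e (v i) x = 0 \<and> (\<forall>j. e (w i j) x = 0))"
proof -
  have o: "open (D - K)" "open (- K)" using D K by (auto intro: open_Diff compact_imp_closed)
  have un: "D \<union> - K = UNIV" using K by auto
  have z0: "g x = 0" if "\<And>x. x \<in> D - K \<Longrightarrow> f x = 0" "has_partial_real D j f g" "x \<in> D - K" for f g j x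
  proof -
    have "has_partial_real (D - K) j f g" using that by (auto simp: has_partial_real_def)
    from has_partial_real_cong[OF o(1) _ _ this, of "\<lambda>_. 0" g] that
    have "has_partial_real (D - K) j (\<lambda>_. 0) g" by auto
    then have "((\<lambda>_. 0) has_real_derivative g x) (at 0)" using that by (auto simp: has_partial_real_def)
    then show ?thesis using DERIV_unique[OF _ DERIV_const] by blast
  qed
  have zv: "v i x = 0" if "x \<in> D - K" for i x
    using z0[of u, OF z] u that unfolding C2_real_def by blast
  have zw: "w i j x = 0" if "x \<in> D - K" for i j x
    using z0[of "v i" j "w i j", OF zv] u that unfolding C2_real_def by blast
  show van: "\<And>x. x \<notin> K \<Longrightarrow> e u x = 0 \<and> (\<forall>i. e (v i) x = 0 \<and> (\<forall>j. e (w i j) x = 0))"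
    using z zv zw by (auto simp: e_def)
  have c: "continuous_on UNIV (e f)" if "continuous_on D f" "\<And>x. x \<in> D - K \<Longrightarrow> f x = 0" for f
  proof -
    have "continuous_on D (e f)"
      using that(1) by (rule continuous_on_eq) (simp add: e_def)
    moreover have "continuous_on (- K) (e f)"
      by (rule continuous_on_eq[OF continuous_on_const[of _ 0]]) (use that in \<open>auto simp: e_def\<close>)
    ultimately show ?thesis using continuous_on_open_Un[OF D o(2)] un by metis
  qed
  have p: "has_partial_real UNIV j (e f) (e g)"
    if "has_partial_real D j f g" "\<And>x. x \<in> D - K \<Longrightarrow> f x = 0" for f g j
  proof -
    have "has_partial_real D j (e f) (e g)"
      by (rule has_partial_real_cong[OF D _ _ that(1)]) (auto simp: e_def)
    moreover have "has_partial_real (- K) j (e f) (e g)"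
      by (rule has_partial_real_cong[OF o(2), of "\<lambda>_. 0" _ "\<lambda>_. 0"])
        (use that z0[OF that(2,1)] in \<open>auto simp: e_def has_partial_real_def\<close>)
    ultimately show ?thesis using un unfolding has_partial_real_def by blast
  qed
  show "C2_real UNIV (e u) (\<lambda>i. e (v i)) (\<lambda>i j. e (w i j))"
    using u z zv zw unfolding C2_real_def by (intro conjI allI c p) blast+
qed

section \<open>Integration by parts with compact support\<close>

lemma integrable_compact_support:
  fixes f :: "'a::euclidean_space \<Rightarrow> real"
  assumes "compact K" "continuous_on K f" "\<And>x. x \<notin> K \<Longrightarrow> f x = 0"
  shows "integrable lborel f"
proof -
  have "(\<lambda>x. indicator K x *\<^sub>R f x) = f" using assms(3) by (auto simp: indicator_def fun_eq_iff)
  then show ?thesis using borel_integrable_compact[OF assms(1,2)] by simp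
qed

lemma integrable_indicator_compact:
  "compact (K :: 'a::euclidean_space set) \<Longrightarrow> integrable lborel (\<lambda>x. c * indicator K x :: real)"
  by (rule integrable_compact_support[of K]) 
    (auto intro!: continuous_on_eq[OF continuous_on_const[of K c]])

lemma bounded_compact_support:
  fixes f :: "'a::topological_space \<Rightarrow> real"
  assumes "compact K" "continuous_on K f" "\<And>x. x \<notin> K \<Longrightarrow> f x = 0"
  obtains B where "B > 0" "\<And>x. \<bar>f x\<bar> \<le> B"
proof -
  have "bounded (f ` K)" using assms by (intro compact_imp_bounded compact_continuous_image)
  then obtain B where B: "B > 0" "\<And>x. x \<in> K \<Longrightarrow> \<bar>f x\<bar> \<le> B" by (auto simp: bounded_pos)
  have "\<bar>f x\<bar> \<le> B" for x using B assms(3)[of x] by (cases "x \<in> K") auto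
  then show thesis using B that by blast
qed

lemma norm_axis_scaleR [simp]: "norm (t *\<^sub>R axis j (1::real)) = \<bar>t\<bar>"
  by simp

text \<open>The integral of \<open>F\<close> translated by \<open>t\<close> along the j-th axis does
  not depend on \<open>t\<close>; differentiating it under the integral sign gives 0. This takes the
  place of the divergence theorem.\<close>

lemma integral_partial_zero:
  fixes F :: "real ^ 'n \<Rightarrow> real"
  assumes p: "has_partial_real UNIV j F F'" and c: "continuous_on UNIV F" "continuous_on UNIV F'"
    and K: "compact K" and z: "\<And>x. x \<notin> K \<Longrightarrow> F x = 0" "\<And>x. x \<notin> K \<Longrightarrow> F' x = 0"
  shows "(\<integral>x. F' x \<partial>lborel) = 0"
proof -
  have cK: "continuous_on K F" "continuous_on K F'" using c by (auto intro: continuous_on_subset)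
  obtain B where B: "B > 0" "\<And>x. \<bar>F' x\<bar> \<le> B"
    using bounded_compact_support[OF K cK(2) z(2)] by metis
  obtain R where R: "K \<subseteq> cball 0 R"
    using compact_imp_bounded[OF K] by (auto simp: bounded_iff subset_eq)
  have i: "integrable lborel F" by (rule integrable_compact_support[OF K cK(1) z(1)])
  \<comment> \<open>For \<open>\<bar>t\<bar> < 1\<close> all translated supports lie in the ball of
    radius \<open>R + 1\<close>, which yields an integrable majorant.\<close>
  have "((\<lambda>t. \<integral>y. F (y + t *\<^sub>R axis j 1) \<partial>lborel) has_real_derivative (\<integral>y. F' (y + 0 *\<^sub>R axis j 1) \<partial>lborel)) (at 0)"
  proof (rule has_real_derivative_integral(2)[where \<delta>=1 and g="\<lambda>y. B * indicator (cball 0 (R + 1)) y"])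
    fix t :: real
    show "integrable lborel (\<lambda>y. F (y + t *\<^sub>R axis j 1))"
      using i lborel_integral_translate(2)[of F "t *\<^sub>R axis j 1"] by (simp add: add.commute)
    fix y assume t: "\<bar>t - 0\<bar> < 1"
    show "((\<lambda>t. F (y + t *\<^sub>R axis j 1)) has_real_derivative F' (y + t *\<^sub>R axis j 1)) (at t)"
      using has_partial_real_at[OF p] by simp
    show "\<bar>F' (y + t *\<^sub>R axis j 1)\<bar> \<le> B * indicator (cball 0 (R + 1)) y"
    proof (cases "y + t *\<^sub>R axis j 1 \<in> K")
      case True
      then have "norm (y + t *\<^sub>R axis j 1) \<le> R" using R by auto
      moreover have "norm y \<le> norm (y + t *\<^sub>R axis j 1) + norm (t *\<^sub>R axis j (1::real) :: real^'n)"
        using norm_triangle_ineq4[of "y + t *\<^sub>R axis j 1" "t *\<^sub>R axis j 1"] by simp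
      ultimately have "y \<in> cball 0 (R + 1)" using t by simp
      then show ?thesis using B by simp
    qed (use z B in auto)
  qed (simp, rule integrable_indicator_compact, simp)
  moreover have "(\<lambda>t. \<integral>y. F (y + t *\<^sub>R axis j 1) \<partial>lborel) = (\<lambda>t. \<integral>y. F y \<partial>lborel)"
    using lborel_integral_translate(1)[of F] by (subst add.commute) simp
  ultimately show ?thesis using DERIV_unique[OF _ DERIV_const] by fastforce
qed

text \<open>The vanishing of integrals of partial derivatives is applied to
  \<open>a * v i - \<phi> * va i\<close>; in its i-th derivative the products of first derivatives
  cancel. The function \<open>a\<close> is controlled on \<open>D\<close> only, and elsewhere its
  values are multiplied by 0.\<close>

lemma green_identity:
  fixes a \<phi> :: "real ^ 'n \<Rightarrow> real"
  assumes D: "open D" and K: "compact K" "K \<subseteq> D"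
    and a: "C2_real D a va wa" and p: "C2_real UNIV \<phi> v w"
    and z: "\<And>x. x \<notin> K \<Longrightarrow> \<phi> x = 0 \<and> (\<forall>i. v i x = 0 \<and> (\<forall>j. w i j x = 0))"
  shows "integrable lborel (\<lambda>x. a x * (\<Sum>i\<in>UNIV. w i i x))"
    and "integrable lborel (\<lambda>x. \<phi> x * (\<Sum>i\<in>UNIV. wa i i x))"
    and "(\<integral>x. a x * (\<Sum>i\<in>UNIV. w i i x) \<partial>lborel) = (\<integral>x. \<phi> x * (\<Sum>i\<in>UNIV. wa i i x) \<partial>lborel)"
proof -
  have ca: "continuous_on D a" "continuous_on D (va i)" "continuous_on D (wa i j)" for i j
    using a by (auto simp: C2_real_def)
  have cp: "continuous_on S \<phi>" "continuous_on S (v i)" "continuous_on S (w i j)" for i j S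
    using p by (auto simp: C2_real_def intro: continuous_on_subset)
  note caK = ca[THEN continuous_on_subset, OF K(2)]
  have i1: "integrable lborel (\<lambda>x. a x * w i j x)" for i j
    by (rule integrable_compact_support[OF K(1)]) (use z in \<open>auto intro!: continuous_intros caK cp\<close>)
  have i2: "integrable lborel (\<lambda>x. \<phi> x * wa i j x)" for i j
    by (rule integrable_compact_support[OF K(1)]) (use z in \<open>auto intro!: continuous_intros caK cp\<close>)
  show "integrable lborel (\<lambda>x. a x * (\<Sum>i\<in>UNIV. w i i x))"
    unfolding sum_distrib_left by (intro Bochner_Integration.integrable_sum i1)
  show "integrable lborel (\<lambda>x. \<phi> x * (\<Sum>i\<in>UNIV. wa i i x))"
    unfolding sum_distrib_left by (intro Bochner_Integration.integrable_sum i2)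
  have "(\<integral>x. a x * w i i x - \<phi> x * wa i i x \<partial>lborel) = 0" for i
  proof -
    have o: "open (- K)" "D \<union> - K = UNIV" using K by (auto intro: compact_imp_closed)
    define F where "F x = a x * v i x - \<phi> x * va i x" for x
    define F' where "F' x = a x * w i i x - \<phi> x * wa i i x" for x
    have zF: "F x = 0" "F' x = 0" if "x \<notin> K" for x using z[OF that] by (auto simp: F_def F'_def)
    have "continuous_on D F" "continuous_on D F'"
      unfolding F_def F'_def by (intro continuous_intros ca cp)+
    moreover have "continuous_on (-K) F" "continuous_on (-K) F'"
      by (rule continuous_on_eq[OF continuous_on_const[of _ 0]], use zF in auto)+
    ultimately have c: "continuous_on UNIV F" "continuous_on UNIV F'"
      using continuous_on_open_Un[OF D o(1)] o(2) by metis+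
    have "has_partial_real D i F F'" unfolding has_partial_real_def
    proof
      fix x assume x: "x \<in> D"
      have "((\<lambda>t. a (x + t *\<^sub>R axis i 1)) has_real_derivative va i x) (at 0)"
        "((\<lambda>t. va i (x + t *\<^sub>R axis i 1)) has_real_derivative wa i i x) (at 0)"
        "((\<lambda>t. \<phi> (x + t *\<^sub>R axis i 1)) has_real_derivative v i x) (at 0)"
        "((\<lambda>t. v i (x + t *\<^sub>R axis i 1)) has_real_derivative w i i x) (at 0)"
        using a p x by (auto simp: C2_real_def has_partial_real_def)
      from DERIV_diff[OF DERIV_mult[OF this(1,4)] DERIV_mult[OF this(3,2)]]
      show "((\<lambda>t. F (x + t *\<^sub>R axis i 1)) has_real_derivative F' x) (at 0)"
        by (simp add: F_def F'_def algebra_simps)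
    qed
    moreover have "has_partial_real (-K) i F F'"
      by (rule has_partial_real_cong[OF o(1), of "\<lambda>_. 0" _ "\<lambda>_. 0"]) (auto simp: zF has_partial_real_def)
    ultimately have "has_partial_real UNIV i F F'"
      using o(2) unfolding has_partial_real_def by blast
    from integral_partial_zero[OF this c K(1) zF] show ?thesis by (simp add: F'_def)
  qed
  then have "(\<integral>x. a x * w i i x \<partial>lborel) = (\<integral>x. \<phi> x * wa i i x \<partial>lborel)" for i
    using i1 i2 by (simp add: Bochner_Integration.integral_diff)
  then show "(\<integral>x. a x * (\<Sum>i\<in>UNIV. w i i x) \<partial>lborel) = (\<integral>x. \<phi> x * (\<Sum>i\<in>UNIV. wa i i x) \<partial>lborel)"
    using i1 i2 by (simp add: sum_distrib_left Bochner_Integration.integral_sum)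
qed

section \<open>The Newton kernel and the Newton potential\<close>

lemma unit_ball_vol_nonzero [simp]: "unit_ball_vol (real d) \<noteq> 0"
  using unit_ball_vol_pos[of "real d"] by linarith

text \<open>Polar coordinates for radial functions. The two measures on the line are compared on the
  half-lines \<open>{..a}\<close>, where the left one is the volume of a ball and the right one the
  integral of the derivative of that volume in the radius.\<close>

lemma distr_norm_lborel:
  "distr lborel borel (norm :: 'a::euclidean_space \<Rightarrow> real) =
   density lborel (\<lambda>r. ennreal (real DIM('a) * unit_ball_vol DIM('a) * r ^ (DIM('a) - 1)) * indicator {0..} r)"
  (is "?M = ?N")
proof (rule measure_eqI_generator_eq[where E="range atMost" and \<Omega>=UNIV and A="\<lambda>i. {..real i}"])
  show "Int_stable (range (atMost :: real \<Rightarrow> real set))"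
    by (auto simp: Int_stable_def)
  show "sets ?M = sigma_sets UNIV (range atMost)" "sets ?N = sigma_sets UNIV (range atMost)"
    by (simp_all add: borel_eq_atMost)
  have M: "emeasure ?M {..a} = ennreal (if a < 0 then 0 else unit_ball_vol DIM('a) * a ^ DIM('a))" for a
  proof -
    have "emeasure ?M {..a} = emeasure lborel (cball (0::'a) a)"
      by (subst emeasure_distr) (auto intro!: arg_cong[where f="emeasure lborel"])
    then show ?thesis by (auto simp: emeasure_cball)
  qed
  have N: "emeasure ?N {..a} = ennreal (if a < 0 then 0 else unit_ball_vol DIM('a) * a ^ DIM('a))" for a
  proof (cases "a < 0")
    case True
    have "emeasure ?N {..a} = (\<integral>\<^sup>+r. (ennreal (real DIM('a) * unit_ball_vol DIM('a) * r ^ (DIM('a) - 1)) *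
        indicator {0..} r) * indicator {..a} r \<partial>lborel)"
      by (rule emeasure_density) auto
    also have "\<dots> = (\<integral>\<^sup>+(r::real). 0 \<partial>lborel)"
      by (rule nn_integral_cong) (use True in \<open>auto simp: indicator_def\<close>)
    finally have "emeasure ?N {..a} = (\<integral>\<^sup>+(r::real). 0 \<partial>lborel)" .
    then show ?thesis using True by simp
  next
    case False
    have "emeasure ?N {..a} =
        (\<integral>\<^sup>+r. ennreal (real DIM('a) * unit_ball_vol DIM('a) * r ^ (DIM('a) - 1)) * indicator {0..a} r \<partial>lborel)"
      by (subst emeasure_density) (auto intro!: nn_integral_cong simp: indicator_def)
    also have "\<dots> = ennreal (unit_ball_vol DIM('a) * a ^ DIM('a) - unit_ball_vol DIM('a) * 0 ^ DIM('a))"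
      by (rule nn_integral_FTC_Icc) (use False in \<open>auto intro!: derivative_eq_intros\<close>)
    finally show ?thesis using False by simp
  qed
  show "emeasure ?M X = emeasure ?N X" if "X \<in> range atMost" for X
    using that M N by auto
  show "emeasure ?M {..real i} \<noteq> \<infinity>" for i unfolding M by simp
  show "(\<Union>i. {..real i}) = UNIV" using real_arch_simple by auto
qed auto

lemma nn_integral_radial:
  assumes [measurable]: "f \<in> borel_measurable borel"
  shows "(\<integral>\<^sup>+y. f (norm (y :: 'a::euclidean_space)) \<partial>lborel) =
    (\<integral>\<^sup>+r. ennreal (real DIM('a) * unit_ball_vol DIM('a) * r ^ (DIM('a) - 1)) * indicator {0..} r * f r \<partial>lborel)"
proof -
  have "(\<integral>\<^sup>+y. f (norm (y :: 'a)) \<partial>lborel) = (\<integral>\<^sup>+r. f r \<partial>distr lborel borel (norm :: 'a \<Rightarrow> real))"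
    by (subst nn_integral_distr) auto
  then show ?thesis unfolding distr_norm_lborel by (subst (asm) nn_integral_density) auto
qed

section \<open>The singularity of the Newton kernel\<close>

definition newton_radial :: "nat \<Rightarrow> real \<Rightarrow> real" where
  "newton_radial d r = (if d = 2 then - ln r / (2 * pi)
     else r powr (2 - real d) / (real d * (real d - 2) * unit_ball_vol d))"

lemma newton_kernel_radial: "newton_kernel (x :: real ^ 'n) = newton_radial CARD('n) (norm x)"
  by (auto simp: newton_kernel_def newton_radial_def Let_def)

lemma newton_radial_measurable [measurable]: "newton_radial d \<in> borel_measurable borel"
  unfolding newton_radial_def by measurable

lemma newton_kernel_measurable [measurable]: "newton_kernel \<in> borel_measurable borel"
  unfolding newton_kernel_radial by measurable

text \<open>In both branches of the definition the derivative is minus the reciprocal of the area of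
  the sphere of radius \<open>r\<close>, so computations with derivatives become uniform in the
  dimension.\<close>

lemma DERIV_newton_radial:
  assumes "d \<ge> 1" "r > 0"
  shows "(newton_radial d has_real_derivative - 1 / (real d * unit_ball_vol d * r ^ (d - 1))) (at r)"
proof (cases "d = 2")
  case True
  then show ?thesis using assms unfolding newton_radial_def
    by (auto intro!: derivative_eq_intros simp: unit_ball_vol_numeral field_simps)
next
  case False
  have w: "unit_ball_vol (real d) \<noteq> 0" using unit_ball_vol_pos[of "real d"] by linarith
  have "((\<lambda>r. r powr (2 - real d) / (real d * (real d - 2) * unit_ball_vol d)) has_real_derivative
      (2 - real d) * r powr (2 - real d - 1) / (real d * (real d - 2) * unit_ball_vol d)) (at r)"
    using DERIV_cdivide[OF has_real_derivative_powr[OF assms(2)]] by blast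
  moreover have "r powr (2 - real d - 1) = 1 / r ^ (d - 1)"
  proof -
    have "2 - real d - 1 = - real (d - 1)" using assms by simp
    then show ?thesis using assms by (simp only: powr_minus powr_realpow) (simp add: divide_inverse)
  qed
  moreover have "(2 - real d) * (1 / r ^ (d - 1)) / (real d * (real d - 2) * unit_ball_vol d) =
     - 1 / (real d * unit_ball_vol d * r ^ (d - 1))"
  proof -
    have "real d - 2 \<noteq> 0" "real d \<noteq> 0" "r ^ (d - 1) \<noteq> 0" "unit_ball_vol (real d) \<noteq> 0"
      using False assms w by auto
    then show ?thesis by (simp add: field_simps)
  qed
  ultimately show ?thesis using False unfolding newton_radial_def by simp
qed

lemma newton_radial_antimono:
  assumes "d \<ge> 1" "0 < r" "r \<le> s" shows "newton_radial d s \<le> newton_radial d r"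
  using assms(3)
proof (rule DERIV_nonpos_imp_nonincreasing)
  fix x assume "r \<le> x" "x \<le> s"
  then show "\<exists>y. (newton_radial d has_real_derivative y) (at x) \<and> y \<le> 0"
    using DERIV_newton_radial[of d x] assms
    by (intro exI[of _ "- 1 / (real d * unit_ball_vol d * x ^ (d - 1))"])
      (auto intro!: divide_nonneg_nonneg mult_nonneg_nonneg)
qed

text \<open>\<open>r ^ (d - 1)\<close> is the Jacobian of polar coordinates. The product is a
  multiple of \<open>r\<close>, or of \<open>r * \<bar>ln r\<bar>\<close> if \<open>d = 2\<close>,
  hence bounded near 0; this is what makes the kernel locally integrable.\<close>

lemma newton_radial_bound:
  assumes "d \<ge> 1" "R \<ge> 0"
  obtains C where "C \<ge> 0" "\<And>r. 0 \<le> r \<Longrightarrow> r \<le> R \<Longrightarrow> r ^ (d - 1) * \<bar>newton_radial d r\<bar> \<le> C"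
proof (cases "d = 2")
  case True
  have "r * \<bar>ln r\<bar> \<le> 1 + R\<^sup>2" if r: "0 \<le> r" "r \<le> R" for r
  proof (cases "r = 0")
    case False
    then have r0: "r > 0" using r by simp
    have "r * ln r \<le> r * r" using ln_le_minus_one[OF r0] r0 by (intro mult_left_mono) auto
    also have "\<dots> \<le> R\<^sup>2" using r unfolding power2_eq_square by (intro mult_mono) auto
    finally have 1: "r * ln r \<le> R\<^sup>2" .
    have "- ln r \<le> 1 / r - 1" using ln_le_minus_one[of "1 / r"] r0 by (simp add: ln_div)
    then have "r * (- ln r) \<le> r * (1 / r)" using r0 by (intro mult_left_mono) auto
    then have "- (r * ln r) \<le> 1" using r0 by simp
    moreover have "r * \<bar>ln r\<bar> = \<bar>r * ln r\<bar>" using r0 by (simp add: abs_mult)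
    ultimately show ?thesis using 1 zero_le_power2[of R] by linarith
  qed auto
  then have "r ^ (d - 1) * \<bar>newton_radial d r\<bar> \<le> (1 + R\<^sup>2) / (2 * pi)" if "0 \<le> r" "r \<le> R" for r
    using True that unfolding newton_radial_def by (auto simp: abs_divide abs_mult intro!: divide_right_mono)
  then show ?thesis using that[of "(1 + R\<^sup>2) / (2 * pi)"] by simp
next
  case False
  define c where "c = \<bar>real d * (real d - 2) * unit_ball_vol d\<bar>"
  have "r ^ (d - 1) * \<bar>newton_radial d r\<bar> \<le> R / c" if r: "0 \<le> r" "r \<le> R" for r
  proof (cases "r = 0")
    case True
    then show ?thesis using False assms by (simp add: newton_radial_def c_def)
  next
    case r0: False
    then have "r ^ (d - 1) = r powr (real d - 1)" using r assms
      by (subst powr_realpow[symmetric]) auto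
    then have "r ^ (d - 1) * r powr (2 - real d) = r"
      using r r0 by (simp add: powr_add[symmetric])
    then have "r ^ (d - 1) * \<bar>newton_radial d r\<bar> = r / c"
      using False r by (simp add: newton_radial_def c_def abs_divide)
    then show ?thesis using r by (simp add: c_def divide_right_mono)
  qed
  then show ?thesis using that[of "R / c"] assms by (simp add: c_def)
qed

lemma integrable_newton_ball:
  "integrable lborel (\<lambda>y :: real ^ 'n. indicator (cball 0 R) y * \<bar>newton_kernel y\<bar>)"
proof (cases "R \<ge> 0")
  case True
  let ?d = "CARD('n)"
  obtain C where C: "C \<ge> 0" "\<And>r. 0 \<le> r \<Longrightarrow> r \<le> R \<Longrightarrow> r ^ (?d - 1) * \<bar>newton_radial ?d r\<bar> \<le> C"
    using newton_radial_bound[of ?d R] True by (metis One_nat_def Suc_leI zero_less_card_finite)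
  have "(\<integral>\<^sup>+y. ennreal (norm (indicator (cball 0 R) y * \<bar>newton_kernel (y :: real ^ 'n)\<bar>)) \<partial>lborel) =
      (\<integral>\<^sup>+y. ennreal (indicator {..R} (norm (y :: real ^ 'n)) * \<bar>newton_radial ?d (norm y)\<bar>) \<partial>lborel)"
    by (intro nn_integral_cong) (auto simp: newton_kernel_radial indicator_def)
  also have "\<dots> = (\<integral>\<^sup>+r. ennreal (real ?d * unit_ball_vol ?d * r ^ (?d - 1)) * indicator {0..} r *
      ennreal (indicator {..R} r * \<bar>newton_radial ?d r\<bar>) \<partial>lborel)"
    by (subst nn_integral_radial[where f="\<lambda>r. ennreal (indicator {..R} r * \<bar>newton_radial ?d r\<bar>)"]) auto
  also have "\<dots> \<le> (\<integral>\<^sup>+r. ennreal (real ?d * unit_ball_vol ?d * C) * indicator {0..R} r \<partial>lborel)"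
  proof (intro nn_integral_mono)
    fix r :: real
    have "ennreal (real ?d * unit_ball_vol ?d * r ^ (?d - 1)) * ennreal \<bar>newton_radial ?d r\<bar>
        \<le> ennreal (real ?d * unit_ball_vol ?d * C)" if "0 \<le> r" "r \<le> R"
    proof -
      have "real ?d * unit_ball_vol ?d * r ^ (?d - 1) * \<bar>newton_radial ?d r\<bar> \<le> real ?d * unit_ball_vol ?d * C"
        using mult_left_mono[OF C(2)[OF that], of "real ?d * unit_ball_vol ?d"] by (simp add: mult.assoc)
      then show ?thesis using that by (subst ennreal_mult[symmetric]) (auto intro!: ennreal_leI)
    qed
    then show "ennreal (real ?d * unit_ball_vol ?d * r ^ (?d - 1)) * indicator {0..} r *
      ennreal (indicator {..R} r * \<bar>newton_radial ?d r\<bar>) \<le> ennreal (real ?d * unit_ball_vol ?d * C) * indicator {0..R} r"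
      by (auto simp: indicator_def)
  qed
  also have "\<dots> < \<infinity>"
    using True by (simp add: nn_integral_cmult_indicator ennreal_mult_less_top)
  finally show ?thesis
    by (intro integrableI_bounded borel_measurable_times borel_measurable_indicator borel_measurable_abs) auto
next
  case False
  then have "cball (0 :: real ^ 'n) R = {}" by simp
  then show ?thesis by simp
qed

section \<open>The Newton kernel as a fundamental solution\<close>

lemma lborel_integral_affine:
  fixes f :: "'a::euclidean_space \<Rightarrow> real"
  assumes [measurable]: "f \<in> borel_measurable borel" and "c > 0"
  shows "(\<integral>y. f y \<partial>lborel) = (\<integral>y. c ^ DIM('a) * f (t + c *\<^sub>R y) \<partial>lborel)"
proof -
  have "(\<integral>y. f y \<partial>lborel) = (\<integral>y. f y \<partial>(density (distr lborel borel (\<lambda>x. t + c *\<^sub>R x)) (\<lambda>_. \<bar>c\<bar>^DIM('a))))"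
    using lborel_affine[of c t] assms by simp
  also have "\<dots> = (\<integral>y. c ^ DIM('a) * f (t + c *\<^sub>R y) \<partial>lborel)"
    using assms by (simp add: integral_density integral_distr)
  finally show ?thesis .
qed

text \<open>The negative Laplacian of the Newton kernel with \<open>\<bar>y\<bar>\<close> smoothed to \<open>sqrt (\<bar>y\<bar>\<^sup>2 + e\<^sup>2)\<close>; the formula
  is the same in all dimensions.\<close>

definition newton_approx :: "real \<Rightarrow> real ^ 'n \<Rightarrow> real" where
  "newton_approx e y = e\<^sup>2 / (unit_ball_vol CARD('n) * sqrt ((norm y)\<^sup>2 + e\<^sup>2) ^ (CARD('n) + 2))"

lemma newton_approx_measurable [measurable]: "newton_approx e \<in> borel_measurable borel"
  unfolding newton_approx_def by measurable

lemma newton_approx_nonneg: "newton_approx e y \<ge> 0"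
  by (auto simp: newton_approx_def intro!: divide_nonneg_nonneg mult_nonneg_nonneg)

text \<open>With \<open>s = sqrt (r\<^sup>2 + 1)\<close> the radial integrand has the primitive
  \<open>(r / s) ^ d\<close>, which runs from 0 to 1. The factor \<open>unit_ball_vol\<close> in the
  kernel is exactly what makes the mass 1.\<close>

lemma newton_approx_mass:
  "integrable lborel (newton_approx 1 :: real ^ 'n \<Rightarrow> real)"
  "(\<integral>y. newton_approx 1 (y :: real ^ 'n) \<partial>lborel) = 1"
proof -
  let ?d = "CARD('n)"
  define s where "s r = sqrt (r\<^sup>2 + 1)" for r :: real
  have s: "s r > 0" "s r * s r = r\<^sup>2 + 1" for r
    using sum_power2_gt_zero_iff[of r 1] by (auto simp: s_def add_pos_nonneg)
  have ds: "(s has_real_derivative r / s r) (at r)" for r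
    unfolding s_def using s(1)[of r]
    by (auto intro!: derivative_eq_intros simp: s_def field_simps)
  have d1: "?d > 0" by simp
  have dF: "((\<lambda>r. (r / s r) ^ ?d) has_real_derivative real ?d * r ^ (?d - 1) / s r ^ (?d + 2)) (at r)" for r
  proof -
    have "((\<lambda>r. r / s r) has_real_derivative (1 * s r - r * (r / s r)) / (s r * s r)) (at r)"
      using s(1)[of r] by (intro DERIV_divide ds) auto
    moreover have "(1 * s r - r * (r / s r)) / (s r * s r) = 1 / s r ^ 3"
    proof -
      have "1 * s r - r * (r / s r) = (s r * s r - r * r) / s r" using s(1)[of r] by (simp add: field_simps)
      also have "\<dots> = 1 / s r" by (simp add: s(2) power2_eq_square)
      finally show ?thesis by (simp add: power3_eq_cube)
    qed
    ultimately have "((\<lambda>r. r / s r) has_real_derivative 1 / s r ^ 3) (at r)" by simp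
    from DERIV_power[OF this, of ?d]
    have "((\<lambda>r. (r / s r) ^ ?d) has_real_derivative real ?d * (1 / s r ^ 3 * (r / s r) ^ (?d - Suc 0))) (at r)" .
    moreover have "real ?d * (1 / s r ^ 3 * (r / s r) ^ (?d - Suc 0)) = real ?d * r ^ (?d - 1) / s r ^ (?d + 2)"
    proof -
      have "?d + 2 = 3 + (?d - 1)" using d1 by simp
      then have "s r ^ (?d + 2) = s r ^ 3 * s r ^ (?d - 1)" by (simp only: power_add)
      then show ?thesis by (simp add: power_divide)
    qed
    ultimately show ?thesis by simp
  qed
  have lim: "((\<lambda>r. (r / s r) ^ ?d) \<longlongrightarrow> 1) at_top"
  proof -
    have "((\<lambda>r. r / sqrt (r\<^sup>2 + 1)) \<longlongrightarrow> 1) at_top"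
    proof (rule tendsto_sandwich[where f="\<lambda>r. 1 - inverse r" and h="\<lambda>_. 1"])
      show "eventually (\<lambda>r. 1 - inverse r \<le> r / sqrt (r\<^sup>2 + 1)) at_top"
        using eventually_gt_at_top[of 1]
      proof eventually_elim
        case (elim r)
        have "sqrt (r\<^sup>2 + 1) \<le> r + 1" by (rule real_le_lsqrt) (use elim in \<open>auto simp: power2_eq_square algebra_simps\<close>)
        then have "(r - 1) * sqrt (r\<^sup>2 + 1) \<le> (r - 1) * (r + 1)" using elim by (intro mult_left_mono) auto
        also have "\<dots> \<le> r * r" by (simp add: algebra_simps)
        finally have "(r - 1) / r \<le> r / sqrt (r\<^sup>2 + 1)"
          using elim s(1)[of r] by (simp add: field_simps s_def)
        then show ?case using elim by (simp add: field_simps)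
      qed
      show "eventually (\<lambda>r. r / sqrt (r\<^sup>2 + 1) \<le> 1) at_top"
        using eventually_gt_at_top[of 0]
      proof eventually_elim
        case (elim r)
        have "r \<le> sqrt (r\<^sup>2 + 1)" by (rule real_le_rsqrt) simp
        then show ?case using elim s(1)[of r] by (simp add: s_def)
      qed
      have "((\<lambda>r::real. 1 - inverse r) \<longlongrightarrow> 1 - 0) at_top"
        by (intro tendsto_intros tendsto_inverse_0_at_top filterlim_ident)
      then show "((\<lambda>r::real. 1 - inverse r) \<longlongrightarrow> 1) at_top" by simp
    qed auto
    from tendsto_power[OF this, of ?d] show ?thesis by (simp add: s_def)
  qed
  let ?W = "unit_ball_vol (real ?d)"
  have W: "?W > 0" "?W \<noteq> 0" using unit_ball_vol_pos[of "real ?d"] by linarith+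
  have "(\<integral>\<^sup>+y. ennreal (newton_approx 1 (y :: real ^ 'n)) \<partial>lborel) =
      (\<integral>\<^sup>+y. ennreal (1 / (?W * s (norm (y :: real ^ 'n)) ^ (?d + 2))) \<partial>lborel)"
    by (simp add: newton_approx_def s_def)
  also have "\<dots> = (\<integral>\<^sup>+r. ennreal (real ?d * ?W * r ^ (?d - 1)) * indicator {0..} r *
      ennreal (1 / (?W * s r ^ (?d + 2))) \<partial>lborel)"
    by (subst nn_integral_radial[where f="\<lambda>r. ennreal (1 / (?W * s r ^ (?d + 2)))"]) (auto simp: s_def)
  also have "\<dots> = (\<integral>\<^sup>+r. ennreal (real ?d * r ^ (?d - 1) / s r ^ (?d + 2)) * indicator {0..} r \<partial>lborel)"
  proof (intro nn_integral_cong)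
    fix r :: real
    have "ennreal (real ?d * ?W * r ^ (?d - 1)) * ennreal (1 / (?W * s r ^ (?d + 2))) =
      ennreal (real ?d * r ^ (?d - 1) / s r ^ (?d + 2))" if "r \<ge> 0"
      using that s(1)[of r] W by (subst ennreal_mult[symmetric]) (auto simp: field_simps)
    then show "ennreal (real ?d * ?W * r ^ (?d - 1)) * indicator {0..} r * ennreal (1 / (?W * s r ^ (?d + 2)))
       = ennreal (real ?d * r ^ (?d - 1) / s r ^ (?d + 2)) * indicator {0..} r"
      by (auto simp: indicator_def)
  qed
  also have "\<dots> = ennreal (1 - (0 / s 0) ^ ?d)"
  proof (rule nn_integral_FTC_atLeast[OF _ dF _ lim])
    show "(\<lambda>r. real ?d * r ^ (?d - 1) / s r ^ (?d + 2)) \<in> borel_measurable borel"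
      unfolding s_def by measurable
    show "0 \<le> real ?d * r ^ (?d - 1) / s r ^ (?d + 2)" if "0 \<le> r" for r
      using that s(1)[of r] by (intro divide_nonneg_pos mult_nonneg_nonneg zero_less_power) auto
  qed
  also have "\<dots> = 1" by simp
  finally have *: "(\<integral>\<^sup>+y. ennreal (newton_approx 1 (y :: real ^ 'n)) \<partial>lborel) = ennreal 1" by simp
  show "integrable lborel (newton_approx 1 :: real ^ 'n \<Rightarrow> real)"
    by (rule integrableI_nonneg) (use * newton_approx_nonneg in auto)
  show "(\<integral>y. newton_approx 1 (y :: real ^ 'n) \<partial>lborel) = 1"
    using * newton_approx_nonneg by (subst integral_eq_nn_integral) auto
qed

text \<open>Substituting \<open>x + e n *\<^sub>R y\<close> turns \<open>newton_approx (e n)\<close>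
  into \<open>newton_approx 1\<close>, so these functions form an approximate identity; boundedness
  of \<phi> allows dominated convergence.\<close>

lemma newton_approx_tendsto:
  fixes \<phi> :: "real ^ 'n \<Rightarrow> real"
  assumes c: "continuous_on UNIV \<phi>" and B: "\<And>y. \<bar>\<phi> y\<bar> \<le> B" and e: "\<And>n. e n > 0" "e \<longlonglongrightarrow> 0"
  shows "(\<lambda>n. \<integral>y. newton_approx (e n) (y - x) * \<phi> y \<partial>lborel) \<longlonglongrightarrow> \<phi> x"
proof -
  have [measurable]: "\<phi> \<in> borel_measurable borel" using c by (rule borel_measurable_continuous_onI)
  have eq: "(\<integral>y. newton_approx (e n) (y - x) * \<phi> y \<partial>lborel) =
      (\<integral>y. newton_approx 1 y * \<phi> (x + e n *\<^sub>R y) \<partial>lborel)" for n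
  proof -
    have "e n ^ CARD('n) * newton_approx (e n) (e n *\<^sub>R y) = newton_approx 1 (y :: real ^ 'n)" for y
    proof -
      have "sqrt ((norm (e n *\<^sub>R y))\<^sup>2 + (e n)\<^sup>2) = sqrt ((e n)\<^sup>2 * ((norm y)\<^sup>2 + 1))"
        using e(1)[of n] by (simp add: power_mult_distrib algebra_simps)
      also have "\<dots> = e n * sqrt ((norm y)\<^sup>2 + 1)" using e(1)[of n] by (simp add: real_sqrt_mult)
      finally have s: "sqrt ((norm (e n *\<^sub>R y))\<^sup>2 + (e n)\<^sup>2) = e n * sqrt ((norm y)\<^sup>2 + 1)" .
      have "e n > 0" by (rule e)
      then show ?thesis unfolding newton_approx_def s
        by (simp add: power_mult_distrib power_add power2_eq_square)
    qed
    then show ?thesis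
      by (subst lborel_integral_affine[of _ "e n" x]) (auto simp: e mult.assoc[symmetric] simp del: integral_mult_right_zero)
  qed
  have "(\<lambda>n. \<integral>y. newton_approx 1 y * \<phi> (x + e n *\<^sub>R y) \<partial>lborel) \<longlonglongrightarrow> (\<integral>y. newton_approx 1 (y :: real ^ 'n) * \<phi> x \<partial>lborel)"
  proof (rule integral_dominated_convergence[where w="\<lambda>y. newton_approx 1 y * B"])
    show "AE y in lborel. (\<lambda>n. newton_approx 1 y * \<phi> (x + e n *\<^sub>R y)) \<longlonglongrightarrow> newton_approx 1 y * \<phi> x"
    proof (intro AE_I2 tendsto_mult tendsto_const)
      fix y :: "real ^ 'n"
      have "(\<lambda>n. x + e n *\<^sub>R y) \<longlonglongrightarrow> x + 0 *\<^sub>R y" by (intro tendsto_intros e)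
      then show "(\<lambda>n. \<phi> (x + e n *\<^sub>R y)) \<longlonglongrightarrow> \<phi> x"
        by (intro continuous_on_tendsto_compose[OF c]) auto
    qed
    show "AE y in lborel. norm (newton_approx 1 y * \<phi> (x + e n *\<^sub>R y)) \<le> newton_approx 1 y * B" for n
      using B newton_approx_nonneg by (intro AE_I2) (auto simp: abs_mult abs_of_nonneg[OF newton_approx_nonneg] intro!: mult_left_mono)
  qed (auto simp: newton_approx_mass)
  then show ?thesis by (simp add: eq newton_approx_mass)
qed

text \<open>For a function \<psi> of \<open>q = e\<^sup>2 + \<bar>y - x\<bar>\<^sup>2\<close> the
  Laplacian is \<open>4 \<bar>y - x\<bar>\<^sup>2 \<psi>''(q) + 2 d \<psi>'(q)\<close>. For the
  Newton profile this is a positive multiple of \<open>\<bar>y - x\<bar>\<^sup>2 - q\<close>, that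
  is, of \<open>- e\<^sup>2\<close>.\<close>

lemma newton_radial_shift_C2:
  fixes x :: "real ^ 'n"
  assumes e: "e > 0"
  shows "\<exists>v w. C2_real UNIV (\<lambda>y. newton_radial CARD('n) (sqrt (e\<^sup>2 + (norm (y - x))\<^sup>2))) v w \<and>
    (\<forall>y. (\<Sum>i\<in>UNIV. w i i y) = - newton_approx e (y - x))"
proof -
  let ?d = "CARD('n)" and ?W = "unit_ball_vol (real CARD('n))"
  have W: "?W \<noteq> 0" "?W > 0" using unit_ball_vol_pos[of "real ?d"] by linarith+
  have d: "?d \<ge> 1" "real ?d \<noteq> 0" using zero_less_card_finite[where 'a='n] by linarith+
  have pw: "a ^ ?d = a * a ^ (?d - 1)" for a :: real
    using d by (subst power_eq_if) simp
  define \<psi> where "\<psi> q = newton_radial ?d (sqrt q)" for q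
  define \<psi>' where "\<psi>' q = - 1 / (2 * real ?d * ?W * sqrt q ^ ?d)" for q
  define \<psi>'' where "\<psi>'' q = 1 / (4 * ?W * sqrt q ^ (?d + 2))" for q
  have 1: "(\<psi> has_real_derivative \<psi>' q) (at q)" if q: "q \<in> {0<..}" for q
  proof -
    have q0: "q > 0" "sqrt q > 0" using q by auto
    have "((\<lambda>q. newton_radial ?d (sqrt q)) has_real_derivative
       - 1 / (real ?d * ?W * sqrt q ^ (?d - 1)) * (inverse (sqrt q) / 2)) (at q)"
      by (rule DERIV_chain2[OF DERIV_newton_radial[OF d(1) q0(2)] DERIV_real_sqrt[OF q0(1)]])
    moreover have "- 1 / (real ?d * ?W * sqrt q ^ (?d - 1)) * (inverse (sqrt q) / 2) = \<psi>' q"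
    proof -
      have "a / (b * A) * (inverse t / 2) = a / (2 * b * (t * A))" for a b t A :: real
        by (simp only: divide_inverse inverse_mult_distrib mult_ac)
      note eq = this
      show ?thesis unfolding \<psi>'_def pw[of "sqrt q"] eq by (simp only: mult_ac)
    qed
    ultimately show ?thesis unfolding \<psi>_def by simp
  qed
  have 2: "(\<psi>' has_real_derivative \<psi>'' q) (at q)" if q: "q \<in> {0<..}" for q
  proof -
    have q0: "q > 0" "sqrt q > 0" using q by auto
    have "((\<lambda>q. sqrt q ^ ?d) has_real_derivative real ?d * (inverse (sqrt q) / 2 * sqrt q ^ (?d - Suc 0))) (at q)"
      by (rule DERIV_power[OF DERIV_real_sqrt[OF q0(1)]])
    from DERIV_cmult[OF DERIV_inverse'[OF this], of "- 1 / (2 * real ?d * ?W)"] q0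
    have "(\<psi>' has_real_derivative - 1 / (2 * real ?d * ?W) *
       - (inverse (sqrt q ^ ?d) * (real ?d * (inverse (sqrt q) / 2 * sqrt q ^ (?d - Suc 0))) * inverse (sqrt q ^ ?d))) (at q)"
      unfolding \<psi>'_def by (simp add: field_simps)
    moreover have "- 1 / (2 * real ?d * ?W) *
       - (inverse (sqrt q ^ ?d) * (real ?d * (inverse (sqrt q) / 2 * sqrt q ^ (?d - Suc 0))) * inverse (sqrt q ^ ?d)) = \<psi>'' q"
    proof -
      have "- 1 / (2 * n * W) * - (inverse (t * A) * (n * (inverse t / 2 * A)) * inverse (t * A)) =
          1 / (4 * W * (t * A * (t * t)))" if "n \<noteq> 0" "W \<noteq> 0" "t \<noteq> 0" "A \<noteq> 0" for n W t A :: real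
        using that by (simp add: field_simps)
      from this[of "real ?d" ?W "sqrt q" "sqrt q ^ (?d - Suc 0)"] q0 W d
      show ?thesis using pw[of "sqrt q"] unfolding \<psi>''_def power_add power2_eq_square by simp
    qed
    ultimately show ?thesis by simp
  qed
  have c: "continuous_on {0<..} \<psi>''"
    unfolding \<psi>''_def using W by (intro continuous_intros) auto
  have pos: "e\<^sup>2 + (norm (y - x))\<^sup>2 \<in> {0<..}" for y using e by (simp add: add_pos_nonneg)
  note C = C2_real_compose[OF C2_real_norm_sq pos 1 2 c]
  let ?w = "\<lambda>i j y. \<psi>'' (e\<^sup>2 + (norm (y - x))\<^sup>2) * (2 * (y $ j - x $ j)) * (2 * (y $ i - x $ i)) +
        \<psi>' (e\<^sup>2 + (norm (y - x))\<^sup>2) * (if i = j then 2 else 0)"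
  have "(\<Sum>i\<in>UNIV. ?w i i y) = - newton_approx e (y - x)" for y
  proof -
    define s where "s = sqrt (e\<^sup>2 + (norm (y - x))\<^sup>2)"
    have s: "s > 0" "s * s = e\<^sup>2 + (norm (y - x))\<^sup>2"
      using pos[of y] by (auto simp: s_def)
    have n: "(norm (y - x))\<^sup>2 = (\<Sum>i\<in>UNIV. (y $ i - x $ i) * (y $ i - x $ i))"
      by (simp add: power2_norm_eq_inner inner_vec_def)
    have "(\<Sum>i\<in>UNIV. A * (2 * (y $ i - x $ i)) * (2 * (y $ i - x $ i)) + B * 2) =
        4 * A * (norm (y - x))\<^sup>2 + 2 * real ?d * B" for A B
      unfolding n sum.distrib sum_distrib_left by (simp add: algebra_simps)
    then have "(\<Sum>i\<in>UNIV. ?w i i y) = 4 * \<psi>'' (e\<^sup>2 + (norm (y - x))\<^sup>2) * (norm (y - x))\<^sup>2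
       + 2 * real ?d * \<psi>' (e\<^sup>2 + (norm (y - x))\<^sup>2)"
      by simp
    also have "\<dots> = (norm (y - x))\<^sup>2 / (?W * s ^ (?d + 2)) - 1 / (?W * s ^ ?d)"
      unfolding \<psi>''_def \<psi>'_def s_def[symmetric] using d by simp
    also have "1 / (?W * s ^ ?d) = (s * s) / (?W * s ^ (?d + 2))"
      using s(1) W by (simp add: power_add power2_eq_square)
    also have "(norm (y - x))\<^sup>2 / (?W * s ^ (?d + 2)) - (s * s) / (?W * s ^ (?d + 2)) = - (e\<^sup>2 / (?W * s ^ (?d + 2)))"
      unfolding s(2) by (simp add: add_divide_distrib)
    finally show ?thesis unfolding newton_approx_def s_def by (simp add: add.commute)
  qed
  with C show ?thesis unfolding \<psi>_def by blast
qed

text \<open>The distributional statement that minus the Laplacian of the kernel is the Dirac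
  measure, tested on C^2 functions. For the smoothed kernel \<open>green_identity\<close> moves the
  Laplacian onto the kernel, where it becomes an approximate identity; then the smoothing is removed
  on both sides.\<close>

lemma newton_identity:
  fixes \<phi> :: "real ^ 'n \<Rightarrow> real"
  assumes p: "C2_real UNIV \<phi> v w" and K: "compact K"
    and z: "\<And>x. x \<notin> K \<Longrightarrow> \<phi> x = 0 \<and> (\<forall>i. v i x = 0 \<and> (\<forall>j. w i j x = 0))"
  shows "integrable lborel (\<lambda>y. newton_kernel (y - x) * (\<Sum>i\<in>UNIV. w i i y))"
    and "(\<integral>y. newton_kernel (y - x) * (\<Sum>i\<in>UNIV. w i i y) \<partial>lborel) = - \<phi> x"
proof -
  let ?d = "CARD('n)"
  let ?L = "\<lambda>y. \<Sum>i\<in>UNIV. w i i y"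
  have d: "?d \<ge> 1" using zero_less_card_finite[where 'a='n] by linarith
  have cL: "continuous_on S ?L" for S
    using p by (intro continuous_on_sum) (auto simp: C2_real_def intro: continuous_on_subset)
  have c\<phi>: "continuous_on S \<phi>" for S using p by (auto simp: C2_real_def intro: continuous_on_subset)
  have [measurable]: "?L \<in> borel_measurable borel" using cL by (rule borel_measurable_continuous_onI)
  have zL: "?L y = 0" and z\<phi>: "\<phi> y = 0" if "y \<notin> K" for y using z[OF that] by auto
  obtain B where B: "B > 0" "\<And>y. \<bar>?L y\<bar> \<le> B"
    using bounded_compact_support[OF K cL zL] by metis
  obtain B' where B': "\<And>y. \<bar>\<phi> y\<bar> \<le> B'"
    using bounded_compact_support[OF K c\<phi> z\<phi>] by metis
  obtain R0 where R0: "K \<subseteq> cball 0 R0"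
    using compact_imp_bounded[OF K] by (auto simp: bounded_iff subset_eq)
  define R where "R = \<bar>R0\<bar> + norm x"
  have R: "norm (y - x) \<le> R" if "y \<in> K" for y
    using R0 that norm_triangle_ineq4[of y x] by (auto simp: R_def subset_eq)
  have R_nonneg: "R \<ge> 0" by (simp add: R_def)
  define e where "e n = inverse (real (Suc n))" for n
  have e: "e n > 0" "e n \<le> 1" for n by (auto simp: e_def inverse_le_1_iff)
  have el: "e \<longlonglongrightarrow> 0" unfolding e_def by (rule LIMSEQ_inverse_real_of_nat)
  define P where "P n y = newton_radial ?d (sqrt ((e n)\<^sup>2 + (norm (y - x))\<^sup>2))" for n y
  have [measurable]: "P n \<in> borel_measurable borel" for n unfolding P_def by measurable
  have eq: "(\<integral>y. P n y * ?L y \<partial>lborel) = - (\<integral>y. newton_approx (e n) (y - x) * \<phi> y \<partial>lborel)" for n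
  proof -
    obtain pv pw where pc: "C2_real UNIV (P n) pv pw" "\<And>y. (\<Sum>i\<in>UNIV. pw i i y) = - newton_approx (e n) (y - x)"
      using newton_radial_shift_C2[OF e(1)[of n], of x, folded P_def] by blast
    from green_identity(3)[OF open_UNIV K subset_UNIV pc(1) p z]
    show ?thesis by (simp add: pc(2) mult.commute)
  qed
  have lim1: "(\<lambda>n. \<integral>y. P n y * ?L y \<partial>lborel) \<longlonglongrightarrow> - \<phi> x"
    unfolding eq by (intro tendsto_minus newton_approx_tendsto[OF c\<phi> B' e(1) el])
  \<comment> \<open>The radial profile is decreasing, so the smoothed kernel lies between its value
    at the largest radius in play, whose modulus is \<open>C\<close>, and the kernel itself. This
    gives a majorant independent of \<open>n\<close>.\<close>
  define C where "C = \<bar>newton_radial ?d (sqrt (1 + R\<^sup>2))\<bar>"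
  define g where "g y = B * (indicator (cball 0 R) (y - x) * \<bar>newton_kernel (y - x)\<bar> + C * indicator (cball 0 R) (y - x))" for y
  have gi: "integrable lborel g"
  proof -
    have "integrable lborel (\<lambda>y::real^'n. indicator (cball 0 R) y * \<bar>newton_kernel y\<bar> + C * indicator (cball 0 R) y)"
      by (intro Bochner_Integration.integrable_add integrable_newton_ball integrable_indicator_compact compact_cball)
    then have "integrable lborel (\<lambda>y::real^'n. indicator (cball 0 R) (- x + y) * \<bar>newton_kernel (- x + y)\<bar> + C * indicator (cball 0 R) (- x + y))"
      by (subst lborel_integral_translate(2))
    then show ?thesis unfolding g_def by (intro integrable_mult_right) simp
  qed
  have bd: "\<bar>P n y * ?L y\<bar> \<le> g y" if y: "y \<noteq> x" for n y
  proof (cases "y \<in> K")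
    case False
    then have "?L y = 0" using z by simp
    then show ?thesis using B R_nonneg by (simp add: g_def C_def)
  next
    case True
    let ?r = "norm (y - x)" and ?s = "sqrt ((e n)\<^sup>2 + (norm (y - x))\<^sup>2)"
    have r: "0 < ?r" using y by simp
    have rs: "?r \<le> ?s" by (rule real_le_rsqrt) simp
    have "(e n)\<^sup>2 \<le> 1" using e[of n] by (simp add: power_le_one)
    moreover have "?r\<^sup>2 \<le> R\<^sup>2" using R[OF True] by (intro power_mono) auto
    ultimately have sR: "?s \<le> sqrt (1 + R\<^sup>2)" by simp
    have "newton_radial ?d ?s \<le> newton_radial ?d ?r" "newton_radial ?d (sqrt (1 + R\<^sup>2)) \<le> newton_radial ?d ?s"
      by (rule newton_radial_antimono[OF d r rs], rule newton_radial_antimono[OF d less_le_trans[OF r rs] sR])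
    then have "\<bar>P n y\<bar> \<le> \<bar>newton_kernel (y - x)\<bar> + C"
      unfolding P_def C_def newton_kernel_radial by linarith
    then have "\<bar>P n y * ?L y\<bar> \<le> (\<bar>newton_kernel (y - x)\<bar> + C) * B"
      unfolding abs_mult using B by (intro mult_mono) auto
    then show ?thesis using R[OF True] by (simp add: g_def algebra_simps)
  qed
  have aex: "AE y in lborel. y \<noteq> x" by (rule AE_lborel_singleton)
  have lim: "(\<lambda>n. P n y * ?L y) \<longlonglongrightarrow> newton_kernel (y - x) * ?L y" if y: "y \<noteq> x" for y
  proof -
    have "isCont (newton_radial ?d) (norm (y - x))"
      using y DERIV_newton_radial[OF d, of "norm (y - x)"] by (auto intro: DERIV_isCont)
    moreover have "(\<lambda>n. sqrt ((e n)\<^sup>2 + (norm (y - x))\<^sup>2)) \<longlonglongrightarrow> sqrt (0\<^sup>2 + (norm (y - x))\<^sup>2)"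
      by (intro tendsto_intros el)
    ultimately have "(\<lambda>n. P n y) \<longlonglongrightarrow> newton_radial ?d (norm (y - x))"
      unfolding P_def by (intro isCont_tendsto_compose[where g="newton_radial ?d"]) auto
    then show ?thesis unfolding newton_kernel_radial by (intro tendsto_mult tendsto_const)
  qed
  show int: "integrable lborel (\<lambda>y. newton_kernel (y - x) * ?L y)"
  proof (rule Bochner_Integration.integrable_bound[OF gi])
    show "AE y in lborel. norm (newton_kernel (y - x) * ?L y) \<le> norm (g y)"
      using aex
    proof eventually_elim
      case (elim y)
      have "(\<lambda>n. \<bar>P n y * ?L y\<bar>) \<longlonglongrightarrow> \<bar>newton_kernel (y - x) * ?L y\<bar>"
        by (intro tendsto_intros lim elim)
      then have "\<bar>newton_kernel (y - x) * ?L y\<bar> \<le> g y"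
        by (rule tendsto_upperbound) (use bd[OF elim] in auto)
      then show ?case by simp
    qed
  qed measurable
  have "(\<lambda>n. \<integral>y. P n y * ?L y \<partial>lborel) \<longlonglongrightarrow> (\<integral>y. newton_kernel (y - x) * ?L y \<partial>lborel)"
  proof (rule integral_dominated_convergence[OF _ _ gi])
    show "AE y in lborel. (\<lambda>n. P n y * ?L y) \<longlonglongrightarrow> newton_kernel (y - x) * ?L y"
      using aex by eventually_elim (rule lim)
    show "AE y in lborel. norm (P n y * ?L y) \<le> g y" for n
      using aex by eventually_elim (use bd in auto)
  qed measurable
  with lim1 show "(\<integral>y. newton_kernel (y - x) * ?L y \<partial>lborel) = - \<phi> x"
    by (rule LIMSEQ_unique[rotated])
qed

section \<open>Newton potentials of C^2 densities\<close>

text \<open>The translation is put on \<open>g\<close>: derivatives and limits in \<open>x\<close>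
  then fall on \<open>g\<close>, and the singular kernel stays fixed as a locally integrable
  weight.\<close>

definition newton_potential :: "(real ^ 'n \<Rightarrow> real) \<Rightarrow> real ^ 'n \<Rightarrow> real" where
  "newton_potential g x = (\<integral>y. newton_kernel y * g (x + y) \<partial>lborel)"

text \<open>The majorant is common to all \<open>x\<close> in the ball of radius \<rho>, as
  differentiation under the integral requires. The last part bounds the potential by the supremum of
  \<open>g\<close> alone, with a factor that depends on the radii; this is the source of the bounds
  uniform in the basis index.\<close>

lemma newton_potential_bound:
  fixes g :: "real ^ 'n \<Rightarrow> real"
  assumes [measurable]: "g \<in> borel_measurable borel"
    and B: "\<And>x. \<bar>g x\<bar> \<le> B" and z: "\<And>x. x \<notin> cball 0 r \<Longrightarrow> g x = 0" and x: "norm x \<le> \<rho>"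
  shows "\<bar>newton_kernel y * g (x + y)\<bar> \<le> B * (indicator (cball 0 (r + \<rho>)) y * \<bar>newton_kernel y\<bar>)"
    and "integrable lborel (\<lambda>y. newton_kernel y * g (x + y))"
    and "\<bar>newton_potential g x\<bar> \<le> B * (\<integral>y. indicator (cball 0 (r + \<rho>)) (y :: real ^ 'n) * \<bar>newton_kernel y\<bar> \<partial>lborel)"
proof -
  have B0: "B \<ge> 0" using B[of 0] abs_ge_zero order_trans by blast
  show *: "\<bar>newton_kernel y * g (x + y)\<bar> \<le> B * (indicator (cball 0 (r + \<rho>)) y * \<bar>newton_kernel y\<bar>)" for y
  proof (cases "x + y \<in> cball 0 r")
    case True
    then have "norm y \<le> r + \<rho>" using norm_triangle_ineq4[of "x + y" x] x by auto
    then show ?thesis using mult_right_mono[OF B[of "x + y"], of "\<bar>newton_kernel y\<bar>"] by (simp add: abs_mult mult.commute)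
  qed (use z B0 in auto)
  have i: "integrable lborel (\<lambda>y. B * (indicator (cball 0 (r + \<rho>)) (y :: real ^ 'n) * \<bar>newton_kernel y\<bar>))"
    by (intro integrable_mult_right integrable_newton_ball)
  show i2: "integrable lborel (\<lambda>y. newton_kernel y * g (x + y))"
  proof (rule Bochner_Integration.integrable_bound[OF i])
    show "AE y in lborel. norm (newton_kernel y * g (x + y)) \<le> norm (B * (indicator (cball 0 (r + \<rho>)) y * \<bar>newton_kernel y\<bar>))"
      using * by (intro AE_I2) (auto intro: order_trans[OF _ abs_ge_self])
  qed measurable
  have "\<bar>newton_potential g x\<bar> \<le> (\<integral>y. \<bar>newton_kernel y * g (x + y)\<bar> \<partial>lborel)"
    unfolding newton_potential_def by (rule integral_abs_bound)
  also have "\<dots> \<le> (\<integral>y. B * (indicator (cball 0 (r + \<rho>)) (y :: real ^ 'n) * \<bar>newton_kernel y\<bar>) \<partial>lborel)"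
    using i2 i * by (intro integral_mono) auto
  finally show "\<bar>newton_potential g x\<bar> \<le> B * (\<integral>y. indicator (cball 0 (r + \<rho>)) (y :: real ^ 'n) * \<bar>newton_kernel y\<bar> \<partial>lborel)"
    by simp
qed

lemma newton_potential_partial:
  fixes g :: "real ^ 'n \<Rightarrow> real"
  assumes p: "has_partial_real UNIV j g g'" and c: "continuous_on UNIV g" "continuous_on UNIV g'"
    and z: "\<And>x. x \<notin> cball 0 r \<Longrightarrow> g x = 0" "\<And>x. x \<notin> cball 0 r \<Longrightarrow> g' x = 0"
  shows "has_partial_real UNIV j (newton_potential g) (newton_potential g')"
  unfolding has_partial_real_def
proof
  fix x :: "real ^ 'n"
  have m: "g \<in> borel_measurable borel" "g' \<in> borel_measurable borel"
    using c by (auto intro: borel_measurable_continuous_onI)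
  have cK: "continuous_on (cball 0 r) g" "continuous_on (cball 0 r) g'"
    using c by (auto intro: continuous_on_subset)
  obtain B B' where B: "\<And>x. \<bar>g x\<bar> \<le> B" "\<And>x. \<bar>g' x\<bar> \<le> B'"
    using bounded_compact_support[OF compact_cball cK(1) z(1)] bounded_compact_support[OF compact_cball cK(2) z(2)]
    by metis
  have nt: "norm (x + t *\<^sub>R axis j 1) \<le> norm x + 1" if "\<bar>t - 0\<bar> < 1" for t :: real
    using norm_triangle_ineq[of x "t *\<^sub>R axis j 1"] that by simp
  have "((\<lambda>t. \<integral>y. newton_kernel y * g (x + t *\<^sub>R axis j 1 + y) \<partial>lborel) has_real_derivative
      (\<integral>y. newton_kernel y * g' (x + 0 *\<^sub>R axis j 1 + y) \<partial>lborel)) (at 0)"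
  proof (rule has_real_derivative_integral(2)[where \<delta>=1 and
        g="\<lambda>y. B' * (indicator (cball 0 (r + (norm x + 1))) y * \<bar>newton_kernel y\<bar>)"])
    fix t :: real assume t: "\<bar>t - 0\<bar> < 1"
    show "integrable lborel (\<lambda>y. newton_kernel y * g (x + t *\<^sub>R axis j 1 + y))"
      by (rule newton_potential_bound(2)[OF m(1) B(1) z(1) nt[OF t]])
    fix y :: "real ^ 'n"
    show "\<bar>newton_kernel y * g' (x + t *\<^sub>R axis j 1 + y)\<bar> \<le> B' * (indicator (cball 0 (r + (norm x + 1))) y * \<bar>newton_kernel y\<bar>)"
      by (rule newton_potential_bound(1)[OF m(2) B(2) z(2) nt[OF t]])
    have "((\<lambda>t. g ((x + y) + t *\<^sub>R axis j 1)) has_real_derivative g' ((x + y) + t *\<^sub>R axis j 1)) (at t)"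
      using has_partial_real_at[OF p] by simp
    then have "((\<lambda>t. g (x + t *\<^sub>R axis j 1 + y)) has_real_derivative g' (x + t *\<^sub>R axis j 1 + y)) (at t)"
      by (simp add: algebra_simps)
    then show "((\<lambda>t. newton_kernel y * g (x + t *\<^sub>R axis j 1 + y)) has_real_derivative newton_kernel y * g' (x + t *\<^sub>R axis j 1 + y)) (at t)"
      by (rule DERIV_cmult)
  qed (auto intro: integrable_mult_right integrable_newton_ball simp del: integrable_mult_right_iff)
  then show "((\<lambda>t. newton_potential g (x + t *\<^sub>R axis j 1)) has_real_derivative newton_potential g' x) (at 0)"
    by (simp add: newton_potential_def)
qed

lemma newton_potential_continuous:
  fixes g :: "real ^ 'n \<Rightarrow> real"
  assumes c: "continuous_on UNIV g" and z: "\<And>x. x \<notin> cball 0 r \<Longrightarrow> g x = 0"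
  shows "continuous_on UNIV (newton_potential g)"
  unfolding continuous_on_sequentially
proof (intro allI ballI impI)
  fix X :: "nat \<Rightarrow> real ^ 'n" and a assume X: "(\<forall>n. X n \<in> UNIV) \<and> X \<longlonglongrightarrow> a"
  have m [measurable]: "g \<in> borel_measurable borel"
    using c by (auto intro: borel_measurable_continuous_onI)
  have cK: "continuous_on (cball 0 r) g" using c by (auto intro: continuous_on_subset)
  obtain B where B: "\<And>x. \<bar>g x\<bar> \<le> B"
    using bounded_compact_support[OF compact_cball cK z] by metis
  obtain \<rho> where \<rho>: "\<And>n. norm (X n) \<le> \<rho>"
    using convergent_imp_Bseq[of X] X by (auto simp: convergent_def Bseq_def)
  have "(\<lambda>n. \<integral>y. newton_kernel y * g (X n + y) \<partial>lborel) \<longlonglongrightarrow> (\<integral>y. newton_kernel y * g (a + y) \<partial>lborel)"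
  proof (rule integral_dominated_convergence[where w="\<lambda>y. B * (indicator (cball 0 (r + \<rho>)) y * \<bar>newton_kernel y\<bar>)"])
    show "AE y in lborel. norm (newton_kernel y * g (X n + y)) \<le> B * (indicator (cball 0 (r + \<rho>)) y * \<bar>newton_kernel y\<bar>)" for n
      using newton_potential_bound(1)[OF m B z \<rho>] by (intro AE_I2) simp
    show "AE y in lborel. (\<lambda>n. newton_kernel y * g (X n + y)) \<longlonglongrightarrow> newton_kernel y * g (a + y)"
      using X by (intro AE_I2 tendsto_mult tendsto_const continuous_on_tendsto_compose[OF c] tendsto_intros) auto
    show "integrable lborel (\<lambda>y::real^'n. B * (indicator (cball 0 (r + \<rho>)) y * \<bar>newton_kernel y\<bar>))"
      by (intro integrable_mult_right integrable_newton_ball)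
  qed measurable
  then show "(newton_potential g \<circ> X) \<longlonglongrightarrow> newton_potential g a"
    by (simp add: newton_potential_def o_def)
qed

text \<open>For a compactly supported C^2 density all derivatives can be put on the density; the
  Laplacian is then evaluated by \<open>newton_identity\<close> after a translation.\<close>

lemma newton_potential_C2:
  assumes p: "C2_real UNIV g v w"
    and z: "\<And>x. x \<notin> cball 0 r \<Longrightarrow> g x = 0 \<and> (\<forall>i. v i x = 0 \<and> (\<forall>j. w i j x = 0))"
  shows "C2_real UNIV (newton_potential g) (\<lambda>i. newton_potential (v i)) (\<lambda>i j. newton_potential (w i j))"
    and "(\<Sum>i\<in>UNIV. newton_potential (w i i) x) = - g x"
proof -
  have c: "continuous_on UNIV g" "continuous_on UNIV (v i)" "continuous_on UNIV (w i j)" for i j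
    using p by (auto simp: C2_real_def)
  have d: "has_partial_real UNIV i g (v i)" "has_partial_real UNIV j (v i) (w i j)" for i j
    using p by (auto simp: C2_real_def)
  show "C2_real UNIV (newton_potential g) (\<lambda>i. newton_potential (v i)) (\<lambda>i j. newton_potential (w i j))"
    unfolding C2_real_def
    by (intro conjI allI newton_potential_continuous[where r=r] newton_potential_partial[where r=r] c d) (use z in auto)
  have int: "integrable lborel (\<lambda>y. newton_kernel y * w i i (x + y))" for i
  proof -
    have m: "w i i \<in> borel_measurable borel" using c by (auto intro: borel_measurable_continuous_onI)
    have cK: "continuous_on (cball 0 r) (w i i)" using c by (auto intro: continuous_on_subset)
    have zw: "w i i x = 0" if "x \<notin> cball 0 r" for x using z[OF that] by auto
    obtain B where B: "\<And>x. \<bar>w i i x\<bar> \<le> B"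
      using bounded_compact_support[OF compact_cball cK zw] by metis
    show ?thesis by (rule newton_potential_bound(2)[OF m B, of r x "norm x"]) (use z in auto)
  qed
  have "(\<Sum>i\<in>UNIV. newton_potential (w i i) x) = (\<integral>y. newton_kernel y * (\<Sum>i\<in>UNIV. w i i (x + y)) \<partial>lborel)"
    unfolding newton_potential_def sum_distrib_left
    using int by (simp add: Bochner_Integration.integral_sum)
  also have "\<dots> = (\<integral>y. newton_kernel (y - x) * (\<Sum>i\<in>UNIV. w i i y) \<partial>lborel)"
    using lborel_integral_translate(1)[of "\<lambda>y. newton_kernel (y - x) * (\<Sum>i\<in>UNIV. w i i y)" x] by simp
  also have "\<dots> = - g x"
    by (rule newton_identity(2)[OF p compact_cball z])
  finally show "(\<Sum>i\<in>UNIV. newton_potential (w i i) x) = - g x" .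
qed

section \<open>Harmonic functions\<close>

text \<open>If \<open>c > 0\<close>, the derivative \<open>g'\<close> is positive just to the right
  of 0, and the mean value theorem makes \<open>g\<close> exceed \<open>g 0\<close> there.\<close>

lemma second_derivative_local_max:
  fixes g :: "real \<Rightarrow> real"
  assumes \<delta>: "\<delta> > 0" and g: "\<And>t. \<bar>t\<bar> < \<delta> \<Longrightarrow> (g has_real_derivative g' t) (at t)"
    and g': "(g' has_real_derivative c) (at 0)" and mx: "\<And>t. \<bar>t\<bar> < \<delta> \<Longrightarrow> g t \<le> g 0"
  shows "c \<le> 0"
proof (rule ccontr)
  assume "\<not> c \<le> 0"
  then have c: "c > 0" by simp
  have "g' 0 = 0"
    by (rule DERIV_local_max[OF g[of 0] \<delta>]) (use \<delta> mx in auto)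
  then obtain e where e: "e > 0" "\<And>h. 0 < h \<Longrightarrow> h < e \<Longrightarrow> g' h > 0"
    using DERIV_pos_inc_right[OF g' c] by auto
  define t where "t = min e \<delta> / 2"
  have t: "0 < t" "t < e" "t < \<delta>" using e \<delta> by (auto simp: t_def)
  obtain z where z: "0 < z" "z < t" "g t - g 0 = (t - 0) * g' z"
    using MVT2[of 0 t g g'] t g by auto
  then have "g t - g 0 > 0" using e(2)[of z] t by auto
  then show False using mx[of t] t by auto
qed

text \<open>Adding a small multiple of the squared norm makes the Laplacian strictly positive, so by
  the one-dimensional test along the axes the perturbed function has no maximum inside
  \<open>D\<close>.\<close>

lemma max_principle:
  fixes f :: "real ^ 'n \<Rightarrow> real"
  assumes D: "open D" "bounded D" and c: "continuous_on (closure D) f"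
    and p: "\<And>j. has_partial_real D j f (v j)" "\<And>j. has_partial_real D j (v j) (w j)"
    and s: "\<And>x. x \<in> D \<Longrightarrow> (\<Sum>j\<in>UNIV. w j x) \<ge> 0"
    and M: "\<And>x. x \<in> frontier D \<Longrightarrow> f x \<le> M" and x: "x \<in> closure D"
  shows "f x \<le> M"
proof (rule ccontr)
  assume "\<not> f x \<le> M"
  then have fx: "f x > M" by simp
  have K: "compact (closure D)" using D by simp
  obtain R where R: "\<And>y. y \<in> closure D \<Longrightarrow> norm y \<le> R"
    using compact_imp_bounded[OF K] by (auto simp: bounded_iff)
  have R0: "R \<ge> 0" using R[OF x] norm_ge_zero order_trans by blast
  \<comment> \<open>With this size \<open>e * R\<^sup>2\<close> is less than half of the gap
    \<open>f x - M\<close>, so the perturbed function is smaller on the frontier than at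
    \<open>x\<close>.\<close>
  define e where "e = (f x - M) / (2 * (R\<^sup>2 + 1))"
  have R1: "R\<^sup>2 + 1 > 0" by (simp add: add_nonneg_pos)
  have e: "e > 0" using fx R1 by (simp add: e_def)
  have e2: "e * R\<^sup>2 < f x - M"
  proof -
    have "R\<^sup>2 < R\<^sup>2 + (R\<^sup>2 + 2)" by (simp add: add_nonneg_pos)
    then have "R\<^sup>2 < 2 * (R\<^sup>2 + 1)" by simp
    then have "e * R\<^sup>2 < e * (2 * (R\<^sup>2 + 1))" using e by (rule mult_strict_left_mono)
    also have "\<dots> = f x - M" using R1 by (simp add: e_def)
    finally show ?thesis .
  qed
  define F where "F y = f y + e * (0 + (norm (y - 0))\<^sup>2)" for y :: "real ^ 'n"
  have cF: "continuous_on (closure D) F" unfolding F_def by (intro continuous_intros c)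
  have ne: "closure D \<noteq> {}" using x by (metis empty_iff)
  obtain z where z: "z \<in> closure D" "\<And>y. y \<in> closure D \<Longrightarrow> F y \<le> F z"
    using continuous_attains_sup[OF K ne cF] by auto
  have "z \<notin> frontier D"
  proof
    assume "z \<in> frontier D"
    moreover have "(norm z)\<^sup>2 \<le> R\<^sup>2" using R[OF z(1)] by (intro power_mono) auto
    then have "e * (norm z)\<^sup>2 \<le> e * R\<^sup>2" using e by (intro mult_left_mono) auto
    ultimately have "F z < f x" using M[of z] e2 by (simp add: F_def)
    moreover have "f x \<le> F x" using e by (simp add: F_def)
    ultimately show False using z(2)[OF x] by simp
  qed
  then have zD: "z \<in> D" using z(1) D(1) by (auto simp: frontier_def interior_open)
  obtain r where r: "r > 0" "ball z r \<subseteq> D" using D(1) zD by (meson open_contains_ball)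
  have "w j z + e * 2 \<le> 0" for j
  proof (rule second_derivative_local_max[OF r(1)])
    have in_D: "z + t *\<^sub>R axis j 1 \<in> D" if "\<bar>t\<bar> < r" for t
      using r(2) that by (auto simp: subset_eq dist_norm)
    show "((\<lambda>t. v j (z + t *\<^sub>R axis j 1) + e * (2 * ((z + t *\<^sub>R axis j 1) $ j - 0 $ j)))
        has_real_derivative w j z + e * 2) (at 0)"
      using p(2)[of j] zD unfolding has_partial_real_def
      by (auto intro!: DERIV_add derivative_eq_intros simp: axis_def)
    fix t assume t: "\<bar>t\<bar> < r"
    have n: "has_partial_real UNIV j (\<lambda>y. 0 + (norm (y - 0))\<^sup>2) (\<lambda>y. 2 * (y $ j - 0 $ j))"
      using C2_real_norm_sq[of 0 "0 :: real ^ 'n"] unfolding C2_real_def by blast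
    show "((\<lambda>t. F (z + t *\<^sub>R axis j 1)) has_real_derivative
        v j (z + t *\<^sub>R axis j 1) + e * (2 * ((z + t *\<^sub>R axis j 1) $ j - 0 $ j))) (at t)"
      unfolding F_def
      by (intro DERIV_add DERIV_cmult has_partial_real_at[OF p(1)] has_partial_real_at[OF n] in_D t) auto
    show "F (z + t *\<^sub>R axis j 1) \<le> F (z + 0 *\<^sub>R axis j 1)"
      using z(2) in_D[OF t] closure_subset by auto
  qed
  then have "(\<Sum>j\<in>UNIV. w j z + e * 2) \<le> 0" by (intro sum_nonpos) auto
  then have "(\<Sum>j\<in>UNIV. w j z) + real CARD('n) * (e * 2) \<le> 0" by (simp add: sum.distrib)
  moreover have "real CARD('n) * (e * 2) > 0" using e by simp
  ultimately show False using s[OF zD] by linarith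
qed

section \<open>The mean value property with a bump weight\<close>

text \<open>Powers of the positive part are the building blocks of all cut-offs. At the kink the
  difference quotient is at most \<open>\<bar>h\<bar>\<close> for small \<open>h\<close>.\<close>

lemma DERIV_pos_part_power:
  assumes "n \<ge> 2"
  shows "((\<lambda>s::real. max 0 s ^ n) has_real_derivative real n * max 0 s ^ (n - 1)) (at s)"
proof -
  consider "s > 0" | "s < 0" | "s = 0" by linarith
  then show ?thesis
  proof cases
    case 1
    have "((\<lambda>s::real. s ^ n) has_real_derivative real n * s ^ (n - 1)) (at s)"
      by (auto intro!: derivative_eq_intros)
    moreover have "eventually (\<lambda>s::real. s ^ n = max 0 s ^ n) (nhds s)"
      using eventually_nhds_in_open[of "{0<..}" s] 1 by (auto elim!: eventually_mono)
    ultimately show ?thesis using 1 by (subst (asm) DERIV_cong_ev) auto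
  next
    case 2
    have "((\<lambda>s::real. 0) has_real_derivative 0) (at s)" by simp
    moreover have "eventually (\<lambda>s::real. 0 = max 0 s ^ n) (nhds s)"
      using eventually_nhds_in_open[of "{..<0}" s] 2 assms by (auto elim!: eventually_mono)
    ultimately show ?thesis using 2 assms by (subst (asm) DERIV_cong_ev) auto
  next
    case 3
    have "(\<lambda>h::real. (max 0 h ^ n) / h) \<midarrow>0\<rightarrow> 0"
    proof (rule Lim_null_comparison)
      show "eventually (\<lambda>h::real. norm (max 0 h ^ n / h) \<le> \<bar>h\<bar>) (at 0)"
        unfolding eventually_at
      proof (intro exI[of _ 1] conjI ballI impI)
        fix h :: real assume h: "h \<noteq> 0 \<and> dist h 0 < 1"
        have "max 0 h ^ n \<le> \<bar>h\<bar> ^ n" by (intro power_mono) auto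
        also have "\<dots> \<le> \<bar>h\<bar> ^ 2" using h assms by (intro power_decreasing) auto
        finally have "max 0 h ^ n \<le> \<bar>h\<bar> * \<bar>h\<bar>" by (simp add: power2_eq_square)
        then show "norm (max 0 h ^ n / h) \<le> \<bar>h\<bar>" using h by (simp add: abs_divide divide_le_eq)
      qed simp
      show "(\<lambda>h::real. \<bar>h\<bar>) \<midarrow>0\<rightarrow> 0" using tendsto_rabs_zero[OF tendsto_ident_at] .
    qed
    then show ?thesis using 3 assms by (simp add: DERIV_def power_0_left)
  qed
qed

text \<open>An averaging weight on the ball of radius \<open>sqrt \<rho>\<close>, not normalised.
  The parameter is the squared radius, which makes the weight a C^1 function of \<rho>.\<close>

definition bump :: "real \<Rightarrow> real ^ 'n \<Rightarrow> real" where
  "bump \<rho> z = (max 0 (\<rho> - (norm z)\<^sup>2))\<^sup>2"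

lemma bump_continuous: "continuous_on S (bump \<rho>)"
  unfolding bump_def by (intro continuous_intros)

lemma bump_zero:
  assumes "norm z \<ge> sqrt \<rho>" shows "max 0 (\<rho> - (norm z)\<^sup>2) = 0" "bump \<rho> z = 0"
proof -
  have "\<rho> \<le> (norm z)\<^sup>2" using assms by (rule sqrt_le_D)
  then show "max 0 (\<rho> - (norm z)\<^sup>2) = 0" "bump \<rho> z = 0" by (auto simp: bump_def)
qed

lemma bump_nonneg: "bump \<rho> z \<ge> 0" by (simp add: bump_def)

lemma integrable_bump_mult:
  assumes "continuous_on (cball x (sqrt \<rho>)) u"
  shows "integrable lborel (\<lambda>z. bump \<rho> z * u (x + z))"
proof (rule integrable_compact_support[of "cball 0 (sqrt \<rho>)"])
  show "continuous_on (cball 0 (sqrt \<rho>)) (\<lambda>z. bump \<rho> z * u (x + z))"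
    by (intro continuous_intros bump_continuous continuous_on_compose2[OF assms]) (auto simp: dist_norm)
qed (auto simp: bump_zero)

lemma integrable_bump: "integrable lborel (bump \<rho> :: real ^ 'n \<Rightarrow> real)"
  using integrable_bump_mult[of 0 \<rho> "\<lambda>_. 1"] by simp

lemma integrable_indicator_cball [simp]:
  "integrable lborel (indicator (cball (a :: 'a::euclidean_space) r) :: 'a \<Rightarrow> real)"
  using integrable_indicator_compact[of "cball a r" 1] by simp

lemma bump_mass_pos:
  assumes "\<rho> > 0"
  shows "(\<integral>z. bump \<rho> (z :: real ^ 'n) \<partial>lborel) > 0"
proof -
  let ?s = "sqrt (\<rho> / 2)"
  have "(\<integral>z. (\<rho> / 2)\<^sup>2 * indicator (cball 0 ?s) (z :: real ^ 'n) \<partial>lborel) \<le> (\<integral>z. bump \<rho> (z :: real ^ 'n) \<partial>lborel)"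
  proof (rule integral_mono[OF integrable_indicator_compact integrable_bump])
    show "(\<rho> / 2)\<^sup>2 * indicator (cball 0 ?s) z \<le> bump \<rho> z" for z :: "real ^ 'n"
    proof (cases "z \<in> cball 0 ?s")
      case True
      then have "(norm z)\<^sup>2 \<le> ?s\<^sup>2" by (intro power_mono) auto
      moreover have "?s\<^sup>2 = \<rho> / 2" using assms by (intro real_sqrt_pow2) simp
      ultimately have "\<rho> / 2 \<le> \<rho> - (norm z)\<^sup>2" by linarith
      then have "\<rho> / 2 \<le> max 0 (\<rho> - (norm z)\<^sup>2)" by (rule max.coboundedI2)
      then have "(\<rho> / 2)\<^sup>2 \<le> bump \<rho> z" unfolding bump_def by (rule power_mono) (use assms in auto)
      then show ?thesis using True by (simp add: indicator_def)
    qed (auto simp: bump_nonneg)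
  qed simp
  moreover have "(\<integral>z. (\<rho> / 2)\<^sup>2 * indicator (cball 0 ?s) (z :: real ^ 'n) \<partial>lborel) = (\<rho> / 2)\<^sup>2 * measure lborel (cball (0 :: real ^ 'n) ?s)"
    by simp
  moreover have "measure lborel (cball (0 :: real ^ 'n) ?s) > 0"
    using assms by (simp add: content_cball)
  ultimately show ?thesis using assms by (smt (verit) zero_less_power mult_pos_pos half_gt_zero)
qed

text \<open>The derivative of the bump in \<open>\<rho>\<close> is \<open>(d / 2 + 2) / \<rho>\<close> times the bump, up to a multiple of the
  Laplacian of \<open>max 0 (\<rho> - \<bar>z\<bar>\<^sup>2) ^ 3\<close>, which integrates to 0 against a harmonic function.\<close>

lemma bump_derivative_identity:
  fixes u :: "real ^ 'n \<Rightarrow> real"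
  assumes D: "open D" and u: "C2_real D u v w" and h: "\<And>y. y \<in> D \<Longrightarrow> (\<Sum>i\<in>UNIV. w i i y) = 0"
    and B: "ball x r \<subseteq> D" "r > 0" and \<rho>: "0 < \<rho>" "\<rho> < r\<^sup>2"
  shows "((\<lambda>\<rho>. \<integral>z. bump \<rho> z * u (x + z) \<partial>lborel) has_real_derivative
     (real CARD('n) / 2 + 2) / \<rho> * (\<integral>z. bump \<rho> z * u (x + z) \<partial>lborel)) (at \<rho>)"
proof -
  let ?m = "\<lambda>\<rho> z. max 0 (\<rho> - (norm (z :: real ^ 'n))\<^sup>2)"
  have sub: "cball x (sqrt t) \<subseteq> D" if "t < r\<^sup>2" for t
  proof -
    have "sqrt t < r" using that B(2) by (metis real_sqrt_less_iff real_sqrt_unique less_imp_le)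
    then have "cball x (sqrt t) \<subseteq> ball x r" by (auto simp: subset_eq)
    then show ?thesis using B(1) by blast
  qed
  have cu: "continuous_on D u" using u by (simp add: C2_real_def)
  \<comment> \<open>Half of the room up to \<open>r\<^sup>2\<close>, so that the balls for all
    parameters within \<delta> of \<rho> stay inside \<open>D\<close>.\<close>
  define \<delta> where "\<delta> = (r\<^sup>2 - \<rho>) / 2"
  define \<rho>1 where "\<rho>1 = \<rho> + \<delta>"
  have d: "\<delta> > 0" "\<rho>1 < r\<^sup>2" "\<rho>1 > 0" using \<rho> by (auto simp: \<delta>_def \<rho>1_def field_simps)
  have "bounded (u ` cball x (sqrt \<rho>1))"
    using sub[OF d(2)] cu by (intro compact_imp_bounded compact_continuous_image) (auto intro: continuous_on_subset)
  then obtain C where "\<forall>y\<in>cball x (sqrt \<rho>1). \<bar>u y\<bar> \<le> C" unfolding bounded_iff by auto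
  then have C: "\<And>y. y \<in> cball x (sqrt \<rho>1) \<Longrightarrow> \<bar>u y\<bar> \<le> C" by blast
  have C0: "C \<ge> 0" using C[of x] d(3) by fastforce
  have der: "((\<lambda>\<rho>. \<integral>z. bump \<rho> z * u (x + z) \<partial>lborel) has_real_derivative
      (\<integral>z. 2 * ?m \<rho> z * u (x + z) \<partial>lborel)) (at \<rho>)"
  proof (rule has_real_derivative_integral(2)[OF d(1), where g="\<lambda>z. (2 * \<rho>1 * C) * indicator (cball 0 (sqrt \<rho>1)) z"])
    fix t assume t: "\<bar>t - \<rho>\<bar> < \<delta>"
    then have t1: "t < \<rho>1" by (auto simp: \<rho>1_def)
    then show "integrable lborel (\<lambda>z. bump t z * u (x + z))"
      using d(2) by (intro integrable_bump_mult continuous_on_subset[OF cu sub]) auto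
    fix z :: "real ^ 'n"
    have "((\<lambda>t. (max 0 (t - (norm z)\<^sup>2))\<^sup>2) has_real_derivative real 2 * ?m t z ^ (2 - 1) * 1) (at t)"
      by (rule DERIV_chain2[OF DERIV_pos_part_power]) (auto intro!: derivative_eq_intros)
    from DERIV_mult[OF this DERIV_const[of "u (x + z)"]]
    show "((\<lambda>t. bump t z * u (x + z)) has_real_derivative 2 * ?m t z * u (x + z)) (at t)"
      by (simp add: bump_def)
    show "\<bar>2 * ?m t z * u (x + z)\<bar> \<le> (2 * \<rho>1 * C) * indicator (cball 0 (sqrt \<rho>1)) z"
    proof (cases "norm z \<le> sqrt \<rho>1")
      case True
      then have "\<bar>u (x + z)\<bar> \<le> C" by (intro C) (auto simp: dist_norm)
      moreover have "?m t z \<le> \<rho>1" using t1 d(3) zero_le_power2[of "norm z"] by (intro max.boundedI) linarith+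
      then have "\<bar>2 * ?m t z\<bar> \<le> 2 * \<rho>1" by simp
      ultimately have "\<bar>2 * ?m t z\<bar> * \<bar>u (x + z)\<bar> \<le> (2 * \<rho>1) * C" by (intro mult_mono) auto
      then show ?thesis using True by (simp add: abs_mult)
    next
      case False
      then have "sqrt t \<le> norm z" using t1 real_sqrt_le_mono[of t \<rho>1] by linarith
      then show ?thesis using bump_zero[of t z] C0 d(3) by simp
    qed
  qed (auto intro: integrable_indicator_compact)
  let ?q = "\<lambda>y. - \<rho> + (norm (y - x))\<^sup>2"
  have p1: "((\<lambda>s. max 0 (- s) ^ 3) has_real_derivative - 3 * (max 0 (- s))\<^sup>2) (at s)" for s :: real
  proof -
    have "((\<lambda>s. max 0 (- s) ^ 3) has_real_derivative (real 3 * max 0 (- s) ^ (3 - 1)) * (- 1)) (at s)"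
      by (rule DERIV_chain2[OF DERIV_pos_part_power]) (auto intro!: derivative_eq_intros)
    then show ?thesis by simp
  qed
  have p2: "((\<lambda>s. - 3 * (max 0 (- s))\<^sup>2) has_real_derivative 6 * max 0 (- s)) (at s)" for s :: real
  proof -
    have "((\<lambda>s. (max 0 (- s))\<^sup>2) has_real_derivative (real 2 * max 0 (- s) ^ (2 - 1)) * (- 1)) (at s)"
      by (rule DERIV_chain2[OF DERIV_pos_part_power]) (auto intro!: derivative_eq_intros)
    from DERIV_cmult[OF this, of "- 3"] show ?thesis by simp
  qed
  have p3: "continuous_on UNIV (\<lambda>s::real. 6 * max 0 (- s))" by (intro continuous_intros)
  let ?\<phi> = "\<lambda>y. max 0 (- ?q y) ^ 3"
  let ?v = "\<lambda>i y. - 3 * (max 0 (- ?q y))\<^sup>2 * (2 * (y $ i - x $ i))"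
  let ?w = "\<lambda>i j y. 6 * max 0 (- ?q y) * (2 * (y $ j - x $ j)) * (2 * (y $ i - x $ i)) +
    - 3 * (max 0 (- ?q y))\<^sup>2 * (if i = j then 2 else 0)"
  have C2: "C2_real UNIV ?\<phi> ?v ?w"
    by (rule C2_real_compose[OF C2_real_norm_sq _ p1 p2 p3]) auto
  have zero: "max 0 (- ?q y) = 0" if "y \<notin> cball x (sqrt \<rho>)" for y
    using bump_zero(1)[of \<rho> "y - x"] that by (simp add: dist_norm norm_minus_commute)
  have lap: "(\<Sum>i\<in>UNIV. ?w i i y) = 24 * \<rho> * ?m \<rho> (y - x) - (6 * real CARD('n) + 24) * bump \<rho> (y - x)" for y
  proof -
    have n: "(norm (y - x))\<^sup>2 = (\<Sum>i\<in>UNIV. (y $ i - x $ i) * (y $ i - x $ i))"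
      by (simp add: power2_norm_eq_inner inner_vec_def)
    have "(\<Sum>i\<in>UNIV. A * (2 * (y $ i - x $ i)) * (2 * (y $ i - x $ i)) + B * 2) =
        4 * A * (norm (y - x))\<^sup>2 + 2 * real CARD('n) * B" for A B
      unfolding n sum.distrib sum_distrib_left by (simp add: algebra_simps)
    from this[of "6 * max 0 (- ?q y)" "- 3 * (max 0 (- ?q y))\<^sup>2"]
    have "(\<Sum>i\<in>UNIV. ?w i i y) = 4 * (6 * max 0 (- ?q y)) * (norm (y - x))\<^sup>2 +
        2 * real CARD('n) * (- 3 * (max 0 (- ?q y))\<^sup>2)" by (simp only: refl if_True simp_thms)
    also have "max 0 (- ?q y) = ?m \<rho> (y - x)" by simp
    \<comment> \<open>With \<open>m\<close> for the positive part,
      \<open>\<bar>y - x\<bar>\<^sup>2 = \<rho> - m\<close> on the support, hence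
      \<open>m \<bar>y - x\<bar>\<^sup>2 = \<rho> m - m\<^sup>2\<close>. This ties
      \<open>2 m\<close>, the derivative of the bump in \<rho>, to the bump \<open>m\<^sup>2\<close>
      itself.\<close>
    also have "4 * (6 * ?m \<rho> (y - x)) * (norm (y - x))\<^sup>2 = 24 * \<rho> * ?m \<rho> (y - x) - 24 * bump \<rho> (y - x)"
      by (cases "\<rho> - (norm (y - x))\<^sup>2 \<ge> 0") (simp_all add: bump_def power2_eq_square algebra_simps max_def)
    finally show ?thesis by (simp add: bump_def algebra_simps)
  qed
  have "(\<integral>y. u y * (\<Sum>i\<in>UNIV. ?w i i y) \<partial>lborel) = (\<integral>y. ?\<phi> y * (\<Sum>i\<in>UNIV. w i i y) \<partial>lborel)"
  proof (rule green_identity(3)[OF D compact_cball sub[OF \<rho>(2)] u C2])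
    fix y assume "y \<notin> cball x (sqrt \<rho>)"
    note z0 = zero[OF this]
    show "?\<phi> y = 0 \<and> (\<forall>i. ?v i y = 0 \<and> (\<forall>j. ?w i j y = 0))" unfolding z0 by simp
  qed
  also have "\<dots> = (\<integral>(y :: real ^ 'n). 0 \<partial>lborel)"
  proof (rule Bochner_Integration.integral_cong[OF refl])
    fix y
    show "?\<phi> y * (\<Sum>i\<in>UNIV. w i i y) = 0"
    proof (cases "y \<in> D")
      case False
      then have "y \<notin> cball x (sqrt \<rho>)" using sub[OF \<rho>(2)] by blast
      then show ?thesis using zero by simp
    qed (simp add: h)
  qed
  finally have "(\<integral>y. u y * (24 * \<rho> * ?m \<rho> (y - x) - (6 * real CARD('n) + 24) * bump \<rho> (y - x)) \<partial>lborel) = 0"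
    unfolding lap by simp
  then have "(\<integral>z. u (x + z) * (24 * \<rho> * ?m \<rho> z - (6 * real CARD('n) + 24) * bump \<rho> z) \<partial>lborel) = 0"
    using lborel_integral_translate(1)[of "\<lambda>y. u y * (24 * \<rho> * ?m \<rho> (y - x) - (6 * real CARD('n) + 24) * bump \<rho> (y - x))" x]
    by simp
  moreover have "integrable lborel (\<lambda>z. bump \<rho> z * u (x + z))"
    using \<rho>(2) by (intro integrable_bump_mult continuous_on_subset[OF cu sub])
  moreover have i1: "integrable lborel (\<lambda>z. ?m \<rho> z * u (x + z))"
  proof (rule integrable_compact_support[of "cball 0 (sqrt \<rho>)"])
    show "continuous_on (cball 0 (sqrt \<rho>)) (\<lambda>z. ?m \<rho> z * u (x + z))"
      using sub[OF \<rho>(2)] by (intro continuous_intros continuous_on_compose2[OF cu]) (auto simp: dist_norm subset_eq)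
  qed (auto simp: bump_zero)
  ultimately have "24 * \<rho> * (\<integral>z. ?m \<rho> z * u (x + z) \<partial>lborel) = (6 * real CARD('n) + 24) * (\<integral>z. bump \<rho> z * u (x + z) \<partial>lborel)"
  proof -
    assume 0: "(\<integral>z. u (x + z) * (24 * \<rho> * ?m \<rho> z - (6 * real CARD('n) + 24) * bump \<rho> z) \<partial>lborel) = 0"
      and i2: "integrable lborel (\<lambda>z. bump \<rho> z * u (x + z))"
    have "(\<lambda>z. u (x + z) * (24 * \<rho> * ?m \<rho> z - (6 * real CARD('n) + 24) * bump \<rho> z)) =
        (\<lambda>z. 24 * \<rho> * (?m \<rho> z * u (x + z)) - (6 * real CARD('n) + 24) * (bump \<rho> z * u (x + z)))"
      by (auto simp: algebra_simps)
    with 0 have "(\<integral>z. 24 * \<rho> * (?m \<rho> z * u (x + z)) - (6 * real CARD('n) + 24) * (bump \<rho> z * u (x + z)) \<partial>lborel) = 0"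
      by simp
    then show ?thesis using i1 i2
      by (subst (asm) Bochner_Integration.integral_diff) (simp_all del: integral_mult_right_zero add: integral_mult_right_zero)
  qed
  moreover have "(\<integral>z. 2 * ?m \<rho> z * u (x + z) \<partial>lborel) = 2 * (\<integral>z. ?m \<rho> z * u (x + z) \<partial>lborel)"
    by (simp add: mult.assoc)
  ultimately have "(\<integral>z. 2 * ?m \<rho> z * u (x + z) \<partial>lborel) =
      (real CARD('n) / 2 + 2) / \<rho> * (\<integral>z. bump \<rho> z * u (x + z) \<partial>lborel)"
    using \<rho>(1) by (simp add: field_simps)
  then show ?thesis using der by simp
qed

text \<open>The weighted integral of \<open>u\<close> and the mass of the weight solve the same
  linear equation \<open>I' = (k / \<rho>) I\<close>, so their quotient is constant in \<rho>. As
  \<rho> tends to 0 it approaches \<open>u x\<close> by continuity.\<close>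

lemma mean_value_bump:
  fixes u :: "real ^ 'n \<Rightarrow> real"
  assumes D: "open D" and u: "C2_real D u v w" and h: "\<And>y. y \<in> D \<Longrightarrow> (\<Sum>i\<in>UNIV. w i i y) = 0"
    and B: "ball x r \<subseteq> D" "r > 0" and \<rho>: "0 < \<rho>" "\<rho> < r\<^sup>2"
  shows "(\<integral>z. bump \<rho> z * u (x + z) \<partial>lborel) = u x * (\<integral>z. bump \<rho> (z :: real ^ 'n) \<partial>lborel)"
proof -
  define I where "I \<rho> = (\<integral>z. bump \<rho> z * u (x + z) \<partial>lborel)" for \<rho>
  define c where "c \<rho> = (\<integral>z. bump \<rho> (z :: real ^ 'n) \<partial>lborel)" for \<rho>
  define k where "k = real CARD('n) / 2 + 2"
  have dI: "(I has_real_derivative k / t * I t) (at t)" if "0 < t" "t < r\<^sup>2" for t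
    unfolding I_def k_def by (rule bump_derivative_identity[OF D u h B that])
  \<comment> \<open>The mass is the weighted integral of the harmonic function 1, so the same
    identity applies to it.\<close>
  have dc: "(c has_real_derivative k / t * c t) (at t)" if "0 < t" "t < r\<^sup>2" for t
  proof -
    have "((\<lambda>\<rho>. \<integral>z. bump \<rho> (z :: real ^ 'n) * (\<lambda>_. 1) (x + z) \<partial>lborel) has_real_derivative
        k / t * (\<integral>z. bump t (z :: real ^ 'n) * (\<lambda>_. 1) (x + z) \<partial>lborel)) (at t)"
      unfolding k_def by (rule bump_derivative_identity[OF open_UNIV C2_real_const _ subset_UNIV B(2) that]) simp
    then show ?thesis unfolding c_def by simp
  qed
  have cp: "c t > 0" if "0 < t" for t unfolding c_def by (rule bump_mass_pos[OF that])
  have const: "I s / c s = I \<rho> / c \<rho>" if "0 < s" "s < \<rho>" for s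
  proof (rule DERIV_isconst3[where a=0 and b="r\<^sup>2" and f="\<lambda>t. I t / c t"])
    fix t assume t: "t \<in> {0<..<r\<^sup>2}"
    have "((\<lambda>t. I t / c t) has_real_derivative (k / t * I t * c t - I t * (k / t * c t)) / (c t * c t)) (at t)"
      using t cp[of t] by (intro DERIV_divide dI dc) auto
    then show "((\<lambda>t. I t / c t) has_real_derivative 0) (at t)" by simp
  qed (use that \<rho> B in auto)
  have cu: "continuous_on D u" using u by (simp add: C2_real_def)
  have xD: "x \<in> D" using B by auto
  have "\<bar>I \<rho> / c \<rho> - u x\<bar> \<le> e" if e: "e > 0" for e
  proof -
    have "isCont u x" using cu D xD by (simp add: continuous_on_eq_continuous_at)
    then obtain d where d: "d > 0" "\<And>y. dist y x < d \<Longrightarrow> \<bar>u y - u x\<bar> < e"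
      using e unfolding continuous_at_eps_delta dist_real_def by blast
    define s where "s = min \<rho> (d\<^sup>2) / 2"
    have "d\<^sup>2 > 0" using d by simp
    then have s: "0 < s" "s < \<rho>" "s < d\<^sup>2" using \<rho> by (auto simp: s_def min_def)
    have sd: "sqrt s < d" using s(3) d(1) by (metis real_sqrt_less_iff real_sqrt_unique less_imp_le)
    have sr: "sqrt s < r" using s(2) \<rho>(2) B(2) by (metis real_sqrt_less_iff real_sqrt_unique less_imp_le less_trans)
    have sub: "cball x (sqrt s) \<subseteq> D" using sr B(1) by (auto simp: subset_eq)
    have int: "integrable lborel (\<lambda>z. bump s z * u (x + z))"
      by (rule integrable_bump_mult[OF continuous_on_subset[OF cu sub]])
    have "I s - u x * c s = (\<integral>z. bump s z * u (x + z) - u x * bump s z \<partial>lborel)"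
      unfolding I_def c_def by (subst Bochner_Integration.integral_diff) (simp_all add: int integrable_bump)
    also have "\<bar>\<dots>\<bar> \<le> (\<integral>z. e * bump s (z :: real ^ 'n) \<partial>lborel)"
    proof (rule integral_abs_bound_integral)
      show "integrable lborel (\<lambda>z. bump s z * u (x + z) - u x * bump s z)"
        by (intro Bochner_Integration.integrable_diff integrable_mult_right int integrable_bump)
      show "\<bar>bump s z * u (x + z) - u x * bump s z\<bar> \<le> e * bump s z" for z
      proof (cases "norm z < sqrt s")
        case True
        then have "\<bar>u (x + z) - u x\<bar> \<le> e" using d(2)[of "x + z"] sd by (simp add: dist_norm)
        then have "bump s z * \<bar>u (x + z) - u x\<bar> \<le> bump s z * e" by (intro mult_left_mono bump_nonneg)
        moreover have "bump s z * u (x + z) - u x * bump s z = bump s z * (u (x + z) - u x)" by (simp add: algebra_simps)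
        ultimately show ?thesis using bump_nonneg[of s z] by (simp add: abs_mult mult.commute)
      qed (simp add: bump_zero)
    qed (use int integrable_bump in auto)
    also have "\<dots> = e * c s" by (simp add: c_def)
    finally have "\<bar>I s / c s - u x\<bar> \<le> e"
      using cp[OF s(1)] by (simp add: abs_le_iff field_simps)
    then show ?thesis using const[OF s(1,2)] by simp
  qed
  then have "\<bar>I \<rho> / c \<rho> - u x\<bar> \<le> 0" by (rule field_le_epsilon) simp
  then show ?thesis using cp[OF \<rho>(1)] by (simp add: I_def c_def field_simps)
qed

section \<open>Interior estimates for harmonic functions\<close>

text \<open>In terms of the clipped norm \<open>m\<close>, which is 1-Lipschitz, the bump is
  \<open>(\<rho> - m\<^sup>2)\<^sup>2\<close>. A difference of two such values contains the factor
  \<open>m b - m a\<close>, and the remaining factors are at most \<open>2 * sqrt \<rho>\<close> and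
  \<open>2 * \<rho>\<close>.\<close>

lemma bump_lipschitz:
  fixes a b :: "real ^ 'n"
  assumes "\<rho> > 0"
  shows "\<bar>bump \<rho> a - bump \<rho> b\<bar> \<le> 4 * \<rho> * sqrt \<rho> * norm (a - b)"
proof -
  define m where "m z = min (norm z) (sqrt \<rho>)" for z :: "real ^ 'n"
  have eq: "bump \<rho> z = (\<rho> - (m z)\<^sup>2)\<^sup>2" for z :: "real ^ 'n"
  proof (cases "norm z \<le> sqrt \<rho>")
    case True
    then have "(norm z)\<^sup>2 \<le> (sqrt \<rho>)\<^sup>2" by (intro power_mono) auto
    then show ?thesis using True assms by (simp add: bump_def m_def max_def)
  next
    case False
    then show ?thesis using bump_zero(2)[of \<rho> z] assms by (simp add: m_def)
  qed
  have m: "0 \<le> m z" "m z \<le> sqrt \<rho>" "(m z)\<^sup>2 \<le> \<rho>" for z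
  proof -
    show "0 \<le> m z" "m z \<le> sqrt \<rho>" using assms by (auto simp: m_def)
    then have "(m z)\<^sup>2 \<le> (sqrt \<rho>)\<^sup>2" by (intro power_mono)
    then show "(m z)\<^sup>2 \<le> \<rho>" using assms by simp
  qed
  have "bump \<rho> a - bump \<rho> b = (m b - m a) * ((m b + m a) * (2 * \<rho> - (m a)\<^sup>2 - (m b)\<^sup>2))"
    unfolding eq by (simp add: power2_eq_square algebra_simps)
  also have "\<bar>\<dots>\<bar> \<le> norm (a - b) * ((2 * sqrt \<rho>) * (2 * \<rho>))"
    unfolding abs_mult
  proof (intro mult_mono)
    show "\<bar>m b - m a\<bar> \<le> norm (a - b)"
      using norm_triangle_ineq3[of a b] by (simp add: m_def min_def abs_if split: if_splits)
    show "\<bar>m b + m a\<bar> \<le> 2 * sqrt \<rho>" using m[of a] m[of b] by simp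
    show "\<bar>2 * \<rho> - (m a)\<^sup>2 - (m b)\<^sup>2\<bar> \<le> 2 * \<rho>"
      using m(3)[of a] m(3)[of b] zero_le_power2[of "m a"] zero_le_power2[of "m b"] by linarith
  qed (use assms in auto)
  finally show ?thesis by (simp add: mult_ac)
qed

text \<open>Moving the centre moves the weight and not the function, so a bounded function with the
  mean value property is Lipschitz. It is phrased for any such \<open>f\<close> in order to cover a
  harmonic function and its partial derivatives alike; \<open>L\<close> is chosen before
  \<open>f\<close>, \<open>B\<close> and the points.\<close>

lemma bump_average_lipschitz:
  assumes \<rho>: "\<rho> > 0"
  obtains L where "L \<ge> 0"
    "\<And>(f :: real ^ 'n \<Rightarrow> real) B x x'.
      \<lbrakk>continuous_on (cball x (sqrt \<rho>)) f; continuous_on (cball x' (sqrt \<rho>)) f;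
       \<And>y. y \<in> cball x (sqrt \<rho>) \<union> cball x' (sqrt \<rho>) \<Longrightarrow> \<bar>f y\<bar> \<le> B;
       (\<integral>z. bump \<rho> z * f (x + z) \<partial>lborel) = f x * (\<integral>z. bump \<rho> (z :: real ^ 'n) \<partial>lborel);
       (\<integral>z. bump \<rho> z * f (x' + z) \<partial>lborel) = f x' * (\<integral>z. bump \<rho> (z :: real ^ 'n) \<partial>lborel)\<rbrakk>
      \<Longrightarrow> \<bar>f x - f x'\<bar> \<le> L * B * norm (x - x')"
proof -
  let ?s = "sqrt \<rho>"
  define c where "c = (\<integral>z. bump \<rho> (z :: real ^ 'n) \<partial>lborel)"
  define V where "V = measure lborel (cball (0 :: real ^ 'n) ?s)"
  have c: "c > 0" unfolding c_def by (rule bump_mass_pos[OF \<rho>])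
  define L where "L = 4 * \<rho> * ?s * (2 * V) / c"
  have L0: "L \<ge> 0" using \<rho> c by (simp add: L_def V_def)
  have main: "\<bar>f x - f x'\<bar> \<le> L * B * norm (x - x')"
    if cont: "continuous_on (cball x ?s) f" "continuous_on (cball x' ?s) f"
      and B: "\<And>y. y \<in> cball x ?s \<union> cball x' ?s \<Longrightarrow> \<bar>f y\<bar> \<le> B"
      and mv: "(\<integral>z. bump \<rho> z * f (x + z) \<partial>lborel) = f x * c" "(\<integral>z. bump \<rho> z * f (x' + z) \<partial>lborel) = f x' * c"
    for f :: "real ^ 'n \<Rightarrow> real" and B x x'
  proof -
    have "0 \<le> \<bar>f x\<bar>" by simp
    also have "\<dots> \<le> B" by (rule B) (use \<rho> in auto)
    finally have B0: "B \<ge> 0" .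
    have tr: "(\<integral>y. bump \<rho> (y - a) * f y \<partial>lborel) = (\<integral>z. bump \<rho> z * f (a + z) \<partial>lborel)"
      "integrable lborel (\<lambda>y. bump \<rho> (y - a) * f y) = integrable lborel (\<lambda>z. bump \<rho> z * f (a + z))" for a
      using lborel_integral_translate[of "\<lambda>y. bump \<rho> (y - a) * f y" a] by simp_all
    have i: "integrable lborel (\<lambda>y. bump \<rho> (y - x) * f y)" "integrable lborel (\<lambda>y. bump \<rho> (y - x') * f y)"
      unfolding tr by (intro integrable_bump_mult cont)+
    define K where "K = 4 * \<rho> * ?s * norm (x - x') * B"
    have K0: "K \<ge> 0" using \<rho> B0 by (simp add: K_def)
    have "c * (f x - f x') = (\<integral>y. bump \<rho> (y - x) * f y - bump \<rho> (y - x') * f y \<partial>lborel)"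
      unfolding Bochner_Integration.integral_diff[OF i] tr(1) mv by (simp add: algebra_simps)
    also have "\<bar>\<dots>\<bar> \<le> (\<integral>y. K * indicator (cball x ?s) y + K * indicator (cball x' ?s) y \<partial>lborel)"
    proof (rule integral_abs_bound_integral)
      show "\<bar>bump \<rho> (y - x) * f y - bump \<rho> (y - x') * f y\<bar> \<le> K * indicator (cball x ?s) y + K * indicator (cball x' ?s) y" for y
      proof (cases "y \<in> cball x ?s \<union> cball x' ?s")
        case True
        have "\<bar>bump \<rho> (y - x) - bump \<rho> (y - x')\<bar> \<le> 4 * \<rho> * ?s * norm (x - x')"
          using bump_lipschitz[OF \<rho>, of "y - x" "y - x'"] by (simp add: norm_minus_commute)
        then have "\<bar>bump \<rho> (y - x) - bump \<rho> (y - x')\<bar> * \<bar>f y\<bar> \<le> K"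
          unfolding K_def using B[OF True] \<rho> by (intro mult_mono) auto
        then have "\<bar>bump \<rho> (y - x) * f y - bump \<rho> (y - x') * f y\<bar> \<le> K"
          by (simp add: left_diff_distrib[symmetric] abs_mult)
        then show ?thesis using True K0 by (auto simp: indicator_def)
      next
        case False
        then have "bump \<rho> (y - x) = 0" "bump \<rho> (y - x') = 0"
          by (auto intro!: bump_zero simp: dist_norm norm_minus_commute)
        then show ?thesis using K0 by (simp add: indicator_def)
      qed
      show "integrable lborel (\<lambda>y. K * indicator (cball x ?s) y + K * indicator (cball x' ?s) y)"
        by (intro Bochner_Integration.integrable_add integrable_indicator_compact compact_cball)
    qed (use i in auto)
    also have "\<dots> = K * (2 * V)"
    proof -
      have "measure lborel (cball a ?s) = V" for a :: "real ^ 'n"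
        unfolding V_def using \<rho> by (simp add: content_cball)
      then show ?thesis
        by (subst Bochner_Integration.integral_add)
          (simp_all add: integrable_indicator_compact)
    qed
    finally have "c * \<bar>f x - f x'\<bar> \<le> K * (2 * V)" using c by (simp add: abs_mult)
    then show ?thesis using c by (simp add: L_def K_def field_simps)
  qed
  show thesis by (rule that[OF L0]) (rule main, auto simp: c_def)
qed

text \<open>The partial derivative \<open>v i\<close> is only known to be C^1, so its own Laplacian
  is not at hand. Instead the mean value identity for \<open>u\<close> is differentiated in the
  centre.\<close>

lemma mean_value_bump_partial:
  fixes u :: "real ^ 'n \<Rightarrow> real"
  assumes D: "open D" and u: "C2_real D u v w" and h: "\<And>y. y \<in> D \<Longrightarrow> (\<Sum>i\<in>UNIV. w i i y) = 0"
    and B: "ball x r \<subseteq> D" "r > 0" and \<rho>: "0 < \<rho>" "\<rho> < r\<^sup>2"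
  shows "(\<integral>z. bump \<rho> z * v i (x + z) \<partial>lborel) = v i x * (\<integral>z. bump \<rho> (z :: real ^ 'n) \<partial>lborel)"
proof -
  let ?s = "sqrt \<rho>" and ?c = "\<integral>z. bump \<rho> (z :: real ^ 'n) \<partial>lborel"
  have sr: "?s < r" using \<rho>(2) B(2) by (metis real_sqrt_less_iff real_sqrt_unique less_imp_le)
  \<comment> \<open>Half of the room between the averaging radius and \<open>r\<close>: the centre
    can move by less than \<delta> while the averaging ball stays in \<open>D\<close>.\<close>
  define \<delta> where "\<delta> = (r - ?s) / 2"
  have d: "\<delta> > 0" "?s + \<delta> < r" using sr by (auto simp: \<delta>_def field_simps)
  have cu: "continuous_on D u" "continuous_on D (v i)" and p: "has_partial_real D i u (v i)"
    using u by (auto simp: C2_real_def)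
  have sub: "cball x (?s + \<delta>) \<subseteq> D" using d(2) B(1) by (auto simp: subset_eq)
  have "bounded (v i ` cball x (?s + \<delta>))"
    using sub cu by (intro compact_imp_bounded compact_continuous_image) (auto intro: continuous_on_subset)
  then obtain C where "\<forall>y\<in>cball x (?s + \<delta>). \<bar>v i y\<bar> \<le> C" unfolding bounded_iff by auto
  then have C: "\<And>y. y \<in> cball x (?s + \<delta>) \<Longrightarrow> \<bar>v i y\<bar> \<le> C" by blast
  have in_cb: "x + t *\<^sub>R axis i 1 + z \<in> cball x (?s + \<delta>)" if "\<bar>t - 0\<bar> < \<delta>" "norm z \<le> ?s" for t z
  proof -
    have "norm (t *\<^sub>R axis i 1 + z) \<le> \<bar>t\<bar> + norm z" using norm_triangle_ineq[of "t *\<^sub>R axis i 1" z] by simp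
    moreover have "dist x (x + t *\<^sub>R axis i 1 + z) = norm (t *\<^sub>R axis i 1 + z)"
      using norm_minus_cancel[of "t *\<^sub>R axis i 1 + z"] by (simp add: dist_norm algebra_simps)
    ultimately show ?thesis using that by simp
  qed
  have der: "((\<lambda>t. \<integral>z. bump \<rho> z * u (x + t *\<^sub>R axis i 1 + z) \<partial>lborel) has_real_derivative
      (\<integral>z. bump \<rho> z * v i (x + 0 *\<^sub>R axis i 1 + z) \<partial>lborel)) (at 0)"
  proof (rule has_real_derivative_integral(2)[OF d(1), where g="\<lambda>z. C * bump \<rho> z"])
    fix t :: real assume t: "\<bar>t - 0\<bar> < \<delta>"
    show "integrable lborel (\<lambda>z. bump \<rho> z * u (x + t *\<^sub>R axis i 1 + z))"
    proof (rule integrable_bump_mult[OF continuous_on_subset[OF cu(1)]], rule subsetI)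
      fix y assume "y \<in> cball (x + t *\<^sub>R axis i 1) ?s"
      then show "y \<in> D" using in_cb[OF t, of "y - (x + t *\<^sub>R axis i 1)"] sub by (auto simp: dist_norm norm_minus_commute)
    qed
    fix z :: "real ^ 'n"
    show "((\<lambda>t. bump \<rho> z * u (x + t *\<^sub>R axis i 1 + z)) has_real_derivative bump \<rho> z * v i (x + t *\<^sub>R axis i 1 + z)) (at t)"
    proof (cases "norm z \<le> ?s")
      case True
      then have "(x + z) + t *\<^sub>R axis i 1 \<in> D" using in_cb[OF t True] sub by (auto simp: algebra_simps)
      from DERIV_cmult[OF has_partial_real_at[OF p this], of "bump \<rho> z"] show ?thesis by (simp add: algebra_simps)
    next
      case False
      then show ?thesis using bump_zero(2)[of \<rho> z] by simp
    qed
    show "\<bar>bump \<rho> z * v i (x + t *\<^sub>R axis i 1 + z)\<bar> \<le> C * bump \<rho> z"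
    proof (cases "norm z \<le> ?s")
      case True
      then have "\<bar>v i (x + t *\<^sub>R axis i 1 + z)\<bar> \<le> C" by (intro C in_cb t)
      from mult_right_mono[OF this bump_nonneg[of \<rho> z]] show ?thesis
        using bump_nonneg[of \<rho> z] by (simp add: abs_mult mult.commute)
    next
      case False
      then show ?thesis using bump_zero(2)[of \<rho> z] by simp
    qed
  qed (use integrable_bump in auto)
  have eq: "(\<integral>z. bump \<rho> z * u (x + t *\<^sub>R axis i 1 + z) \<partial>lborel) = u (x + t *\<^sub>R axis i 1) * ?c" if t: "\<bar>t\<bar> < \<delta>" for t
  proof (rule mean_value_bump[OF D u h, where r="r - \<bar>t\<bar>"])
    show "ball (x + t *\<^sub>R axis i 1) (r - \<bar>t\<bar>) \<subseteq> D"
    proof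
      fix y assume "y \<in> ball (x + t *\<^sub>R axis i 1) (r - \<bar>t\<bar>)"
      then have "dist (x + t *\<^sub>R axis i 1) y < r - \<bar>t\<bar>" by simp
      moreover have "dist x y \<le> dist x (x + t *\<^sub>R axis i 1) + dist (x + t *\<^sub>R axis i 1) y" by (rule dist_triangle)
      moreover have "dist x (x + t *\<^sub>R axis i 1) = \<bar>t\<bar>" by (simp add: dist_norm)
      ultimately have "y \<in> ball x r" by simp
      then show "y \<in> D" using B by blast
    qed
    have "?s < r - \<bar>t\<bar>" using t d by linarith
    then have "?s\<^sup>2 < (r - \<bar>t\<bar>)\<^sup>2" using \<rho> by (intro power_strict_mono) auto
    then show "\<rho> < (r - \<bar>t\<bar>)\<^sup>2" using \<rho> by simp
    show "0 < r - \<bar>t\<bar>" using t d \<rho> real_sqrt_gt_zero[OF \<rho>(1)] by linarith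
  qed (use \<rho> in auto)
  have "((\<lambda>t. u (x + t *\<^sub>R axis i 1) * ?c) has_real_derivative v i x * ?c) (at 0)"
    using p B by (intro DERIV_cmult_right) (auto simp: has_partial_real_def subset_eq)
  moreover have "eventually (\<lambda>t. u (x + t *\<^sub>R axis i 1) * ?c = (\<integral>z. bump \<rho> z * u (x + t *\<^sub>R axis i 1 + z) \<partial>lborel)) (nhds 0)"
    using eventually_nhds_in_open[of "{-\<delta><..<\<delta>}" 0] d(1) by (auto elim!: eventually_mono simp: eq)
  ultimately have "((\<lambda>t. \<integral>z. bump \<rho> z * u (x + t *\<^sub>R axis i 1 + z) \<partial>lborel) has_real_derivative v i x * ?c) (at 0)"
    by (subst (asm) DERIV_cong_ev) auto
  from DERIV_unique[OF der this] show ?thesis by simp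
qed

lemma partial_bound_lipschitz:
  assumes S: "open S" "x \<in> S" and p: "has_partial_real S j f g"
    and L: "\<And>y. y \<in> S \<Longrightarrow> \<bar>f y - f x\<bar> \<le> K * norm (y - x)"
  shows "\<bar>g x\<bar> \<le> K"
proof -
  have "(\<lambda>t. (f (x + t *\<^sub>R axis j 1) - f x) / t) \<midarrow>0\<rightarrow> g x"
    using p S unfolding has_partial_real_def DERIV_def by auto
  then have "((\<lambda>t. \<bar>(f (x + t *\<^sub>R axis j 1) - f x) / t\<bar>) \<longlongrightarrow> \<bar>g x\<bar>) (at 0)" by (rule tendsto_rabs)
  moreover have "eventually (\<lambda>t. \<bar>(f (x + t *\<^sub>R axis j 1) - f x) / t\<bar> \<le> K) (at 0)"
  proof (rule eventually_at_filter[THEN iffD2, OF eventually_mono[OF eventually_axis_in_open[OF S, of j]]], intro impI)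
    fix t :: real assume t: "x + t *\<^sub>R axis j 1 \<in> S" "t \<noteq> 0"
    then show "\<bar>(f (x + t *\<^sub>R axis j 1) - f x) / t\<bar> \<le> K"
      using L[OF t(1)] by (simp add: abs_divide divide_le_eq)
  qed
  ultimately show ?thesis by (intro tendsto_upperbound) auto
qed

text \<open>The constant is fixed before \<open>u\<close>, so it serves a whole family at once. The
  Lipschitz bound for averages is used twice: for \<open>u\<close>, which bounds \<open>v\<close>,
  and then for \<open>v\<close> on a smaller ball, which bounds \<open>w\<close>.\<close>

lemma harmonic_interior_bounds:
  fixes D :: "(real ^ 'n) set"
  assumes D: "open D" and r: "r > 0" "ball x0 r \<subseteq> D"
  obtains C where "C \<ge> 0"
    "\<And>u v w B x i j. \<lbrakk>C2_real D u v w; \<And>y. y \<in> D \<Longrightarrow> (\<Sum>i\<in>UNIV. w i i y) = 0;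
       \<And>y. y \<in> D \<Longrightarrow> \<bar>u y\<bar> \<le> B; x \<in> ball x0 (r / 2)\<rbrakk> \<Longrightarrow> \<bar>v i x\<bar> \<le> C * B \<and> \<bar>w i j x\<bar> \<le> C * B"
proof -
  \<comment> \<open>The nested balls have radii \<open>4 * s = r\<close>, \<open>3 * s\<close> and
    \<open>2 * s = r / 2\<close>. Averages are taken over the radius
    \<open>sqrt \<rho> = s / 2\<close>, so an average around a point of one ball stays inside the
    next larger one.\<close>
  define s where "s = r / 4"
  define \<rho> where "\<rho> = (s / 2)\<^sup>2"
  have s: "s > 0" using r by (simp add: s_def)
  have "sqrt \<rho> = \<bar>s / 2\<bar>" unfolding \<rho>_def by (rule real_sqrt_abs)
  then have \<rho>: "0 < \<rho>" "\<rho> < s\<^sup>2" "sqrt \<rho> = s / 2"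
    using s by (auto simp: \<rho>_def power_divide)
  have sub: "ball x s \<subseteq> D" if "x \<in> ball x0 (3 * s)" for x
  proof
    fix y assume "y \<in> ball x s"
    then have "dist x0 y < r" using that dist_triangle[of x0 y x] by (simp add: s_def)
    then show "y \<in> D" using r by auto
  qed
  have sub2: "cball x (s / 2) \<subseteq> ball x0 (3 * s)" if "x \<in> ball x0 (2 * s)" for x
  proof
    fix y assume "y \<in> cball x (s / 2)"
    then show "y \<in> ball x0 (3 * s)" using that dist_triangle[of x0 y x] s by simp
  qed
  obtain L where L0: "L \<ge> 0" and L: "\<And>(f :: real ^ 'n \<Rightarrow> real) B x x'.
      \<lbrakk>continuous_on (cball x (sqrt \<rho>)) f; continuous_on (cball x' (sqrt \<rho>)) f;
       \<And>y. y \<in> cball x (sqrt \<rho>) \<union> cball x' (sqrt \<rho>) \<Longrightarrow> \<bar>f y\<bar> \<le> B;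
       (\<integral>z. bump \<rho> z * f (x + z) \<partial>lborel) = f x * (\<integral>z. bump \<rho> (z :: real ^ 'n) \<partial>lborel);
       (\<integral>z. bump \<rho> z * f (x' + z) \<partial>lborel) = f x' * (\<integral>z. bump \<rho> (z :: real ^ 'n) \<partial>lborel)\<rbrakk>
      \<Longrightarrow> \<bar>f x - f x'\<bar> \<le> L * B * norm (x - x')"
    by (rule bump_average_lipschitz[OF \<rho>(1), where 'n='n]) blast
  have main: "\<bar>v i x\<bar> \<le> (L + L * L) * B \<and> \<bar>w i j x\<bar> \<le> (L + L * L) * B"
    if u: "C2_real D u v w" and h: "\<And>y. y \<in> D \<Longrightarrow> (\<Sum>i\<in>UNIV. w i i y) = 0"
      and B: "\<And>y. y \<in> D \<Longrightarrow> \<bar>u y\<bar> \<le> B" and x: "x \<in> ball x0 (r / 2)" for u v w B x i j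
  proof -
    have x2: "x \<in> ball x0 (2 * s)" and x3: "x \<in> ball x0 (3 * s)" using x r by (auto simp: s_def)
    have "x0 \<in> D" using r by auto
    then have B0: "B \<ge> 0" using B abs_ge_zero order_trans by blast
    have cb: "cball y (s / 2) \<subseteq> D" if "y \<in> ball x0 (3 * s)" for y
    proof -
      have "cball y (s / 2) \<subseteq> ball y s" using s by (auto simp: subset_eq)
      then show ?thesis using sub[OF that] by blast
    qed
    have cu: "continuous_on D u" "continuous_on D (v i)"
      and p: "has_partial_real D i u (v i)" "has_partial_real D j (v i) (w i j)"
      using u by (auto simp: C2_real_def)
    have D3: "ball x0 (3 * s) \<subseteq> D" using r by (auto simp: s_def subset_eq)
    have D2: "ball x0 (2 * s) \<subseteq> D" using r by (auto simp: s_def subset_eq)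
    have lip1: "\<bar>u y - u y'\<bar> \<le> L * B * norm (y - y')" if y: "y \<in> ball x0 (3 * s)" "y' \<in> ball x0 (3 * s)" for y y'
    proof (rule L)
      show "continuous_on (cball y (sqrt \<rho>)) u" "continuous_on (cball y' (sqrt \<rho>)) u"
        unfolding \<rho>(3) using cb y by (auto intro: continuous_on_subset[OF cu(1)])
      show "\<bar>u z\<bar> \<le> B" if "z \<in> cball y (sqrt \<rho>) \<union> cball y' (sqrt \<rho>)" for z
        using that cb y unfolding \<rho>(3) by (intro B) blast
    qed (rule mean_value_bump[OF D u h sub s \<rho>(1,2)], use y in auto)+
    have v1: "\<bar>v i y\<bar> \<le> L * B" if y: "y \<in> ball x0 (3 * s)" for y
    proof (rule partial_bound_lipschitz[OF open_ball y])
      show "has_partial_real (ball x0 (3 * s)) i u (v i)" using p D3 unfolding has_partial_real_def by blast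
    qed (rule lip1, use y in auto)
    have lip2: "\<bar>v i y - v i y'\<bar> \<le> L * (L * B) * norm (y - y')" if y: "y \<in> ball x0 (2 * s)" "y' \<in> ball x0 (2 * s)" for y y'
    proof (rule L)
      have y3: "y \<in> ball x0 (3 * s)" "y' \<in> ball x0 (3 * s)" using y s by auto
      show "continuous_on (cball y (sqrt \<rho>)) (v i)" "continuous_on (cball y' (sqrt \<rho>)) (v i)"
        unfolding \<rho>(3) using cb y3 by (auto intro: continuous_on_subset[OF cu(2)])
      show "\<bar>v i z\<bar> \<le> L * B" if "z \<in> cball y (sqrt \<rho>) \<union> cball y' (sqrt \<rho>)" for z
        using that sub2 y unfolding \<rho>(3) by (intro v1) blast
    qed (rule mean_value_bump_partial[OF D u h sub s \<rho>(1,2)], use y s in auto)+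
    have w1: "\<bar>w i j x\<bar> \<le> L * (L * B)"
    proof (rule partial_bound_lipschitz[OF open_ball x2])
      show "has_partial_real (ball x0 (2 * s)) j (v i) (w i j)" using p D2 unfolding has_partial_real_def by blast
    qed (rule lip2, use x2 in auto)
    have "L * B \<le> (L + L * L) * B" "L * (L * B) \<le> (L + L * L) * B"
      using L0 B0 by (auto simp: algebra_simps)
    then show ?thesis using v1[OF x3] w1 by linarith
  qed
  show thesis by (rule that[of "L + L * L"]) (use L0 main in auto)
qed

section \<open>The Green representation\<close>

lemma solves_dirichletD:
  assumes "solves_dirichlet D g u"
  obtains v w where "continuous_on (closure D) u" "C2_real D u v w"
    "\<And>x. x \<in> D \<Longrightarrow> (\<Sum>i\<in>UNIV. w i i x) = 0" "\<And>x. x \<in> frontier D \<Longrightarrow> u x = g x"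
  using assms unfolding solves_dirichlet_def harmonic_fun_C2_real by blast

lemma green_slice:
  fixes D :: "(real ^ 'n) set"
  assumes G: "green_function D G" and D: "open D" "bounded D" and x: "x \<in> D"
  obtains u v w where "continuous_on (closure D) u" "C2_real D u v w"
    "\<And>y. y \<in> D \<Longrightarrow> (\<Sum>i\<in>UNIV. w i i y) = 0" "\<And>y. y \<in> frontier D \<Longrightarrow> u y = newton_kernel (y - x)"
    "\<And>y. y \<in> D \<Longrightarrow> y \<noteq> x \<Longrightarrow> G x y = newton_kernel (y - x) - u y"
proof -
  obtain u where u: "solves_dirichlet D (\<lambda>y. newton_kernel (y - x)) u"
    and g: "\<forall>y\<in>D - {x}. G x y = newton_kernel (y - x) - u y"
    using G x unfolding green_function_def by blast
  show thesis
    by (rule solves_dirichletD[OF u]) (rule that, use g in auto)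
qed

lemma green_measurable:
  fixes D :: "(real ^ 'n) set"
  assumes G: "green_function D G" and D: "open D" "bounded D"
  shows "G x \<in> borel_measurable borel"
proof (cases "x \<in> D")
  case False
  then have "G x = (\<lambda>y. 0)" using G by (auto simp: green_function_def)
  then show ?thesis by simp
next
  case True
  obtain u v w where u: "C2_real D u v w" and g: "\<And>y. y \<in> D \<Longrightarrow> y \<noteq> x \<Longrightarrow> G x y = newton_kernel (y - x) - u y"
    by (rule green_slice[OF G D True]) blast
  have cu: "continuous_on D u" using u by (simp add: C2_real_def)
  have [measurable]: "(\<lambda>y. indicator D y *\<^sub>R u y) \<in> borel_measurable borel"
    using D by (intro borel_measurable_continuous_on_indicator cu) auto
  have [measurable]: "D \<in> sets borel" using D by simp
  have "G x = (\<lambda>y. if y \<in> {x} then G x x else indicator D y * newton_kernel (y - x) - indicator D y *\<^sub>R u y)"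
    using g G by (auto simp: green_function_def fun_eq_iff indicator_def)
  then show ?thesis by (rule ssubst) measurable
qed

lemma green_integrable:
  fixes D :: "(real ^ 'n) set"
  assumes G: "green_function D G" and D: "open D" "bounded D"
  shows "integrable lborel (G x)"
proof (cases "x \<in> D")
  case False
  then have "G x = (\<lambda>y. 0)" using G by (auto simp: green_function_def)
  then show ?thesis by simp
next
  case True
  obtain u v w where u: "continuous_on (closure D) u" and g: "\<And>y. y \<in> D \<Longrightarrow> y \<noteq> x \<Longrightarrow> G x y = newton_kernel (y - x) - u y"
    by (rule green_slice[OF G D True]) blast
  have K: "compact (closure D)" using D by simp
  have "bounded (u ` closure D)" using K u by (intro compact_imp_bounded compact_continuous_image)
  then obtain B where "\<forall>y\<in>closure D. \<bar>u y\<bar> \<le> B" unfolding bounded_iff by auto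
  then have B: "\<And>y. y \<in> D \<Longrightarrow> \<bar>u y\<bar> \<le> B" using closure_subset by blast
  have B0: "B \<ge> 0" using B[OF True] abs_ge_zero order_trans by blast
  have "bounded ((\<lambda>y. y - x) ` D)" using D(2) by (rule bounded_translation_minus)
  then obtain R where R: "\<And>y. y \<in> D \<Longrightarrow> norm (y - x) \<le> R" unfolding bounded_iff by auto
  let ?g = "\<lambda>y. indicator (cball 0 R) (- x + y) * \<bar>newton_kernel (- x + y)\<bar> + B * indicator (cball 0 R) (- x + y)"
  have gi: "integrable lborel ?g"
    by (subst lborel_integral_translate(2)[of "\<lambda>y. indicator (cball 0 R) y * \<bar>newton_kernel y\<bar> + B * indicator (cball 0 R) y"])
      (intro Bochner_Integration.integrable_add integrable_newton_ball integrable_indicator_compact compact_cball)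
  show ?thesis
  proof (rule Bochner_Integration.integrable_bound[OF gi])
    show "G x \<in> borel_measurable lborel" using green_measurable[OF G D] by simp
    show "AE y in lborel. norm (G x y) \<le> norm (?g y)"
      using AE_lborel_singleton[of x]
    proof eventually_elim
      case (elim y)
      show ?case
      proof (cases "y \<in> D")
        case True
        have "\<bar>G x y\<bar> \<le> \<bar>newton_kernel (y - x)\<bar> + B" using g[OF True elim] B[OF True] by linarith
        then show ?thesis using R[OF True] B0 by simp
      next
        case False
        then have "G x y = 0" using G by (auto simp: green_function_def)
        then show ?thesis by simp
      qed
    qed
  qed
qed

text \<open>The Newton kernel contributes \<open>- \<phi> x\<close>. The harmonic correction
  contributes 0, because the Laplacian can be moved from \<phi> onto it.\<close>

lemma green_test_function:
  fixes D :: "(real ^ 'n) set"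
  assumes G: "green_function D G" and D: "open D" "bounded D" and x: "x \<in> D"
    and K: "compact K" "K \<subseteq> D" and p: "C2_real UNIV \<phi> v w"
    and z: "\<And>x. x \<notin> K \<Longrightarrow> \<phi> x = 0 \<and> (\<forall>i. v i x = 0 \<and> (\<forall>j. w i j x = 0))"
  shows "integrable lborel (\<lambda>y. G x y * (\<Sum>i\<in>UNIV. w i i y))"
    and "(\<integral>y. G x y * (\<Sum>i\<in>UNIV. w i i y) \<partial>lborel) = - \<phi> x"
proof -
  obtain u uv uw where u: "C2_real D u uv uw" "\<And>y. y \<in> D \<Longrightarrow> (\<Sum>i\<in>UNIV. uw i i y) = 0"
    and g: "\<And>y. y \<in> D \<Longrightarrow> y \<noteq> x \<Longrightarrow> G x y = newton_kernel (y - x) - u y"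
    by (rule green_slice[OF G D x]) blast
  let ?L = "\<lambda>y. \<Sum>i\<in>UNIV. w i i y"
  note n = newton_identity[OF p K(1) z, where x=x]
  note gr = green_identity[OF D(1) K u(1) p z]
  have "(\<integral>y. \<phi> y * (\<Sum>i\<in>UNIV. uw i i y) \<partial>lborel) = (\<integral>(y :: real ^ 'n). 0 \<partial>lborel)"
  proof (rule Bochner_Integration.integral_cong[OF refl])
    fix y show "\<phi> y * (\<Sum>i\<in>UNIV. uw i i y) = 0"
      using u(2)[of y] z[of y] K(2) by (cases "y \<in> D") auto
  qed
  then have 0: "(\<integral>y. u y * ?L y \<partial>lborel) = 0" using gr(3) by simp
  have ae: "AE y in lborel. G x y * ?L y = newton_kernel (y - x) * ?L y - u y * ?L y"
    using AE_lborel_singleton[of x]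
  proof eventually_elim
    case (elim y)
    show ?case
    proof (cases "y \<in> K")
      case True
      then have "y \<in> D" using K(2) by blast
      then show ?thesis using g[OF _ elim] by (simp add: left_diff_distrib)
    qed (simp add: z)
  qed
  have cL: "continuous_on UNIV ?L" using p by (intro continuous_on_sum) (auto simp: C2_real_def)
  have [measurable]: "?L \<in> borel_measurable borel" using cL by (rule borel_measurable_continuous_onI)
  have [measurable]: "G x \<in> borel_measurable borel" by (rule green_measurable[OF G D])
  have d: "integrable lborel (\<lambda>y. newton_kernel (y - x) * ?L y - u y * ?L y)"
    by (rule Bochner_Integration.integrable_diff[OF n(1) gr(1)])
  have m: "(\<lambda>y. G x y * ?L y) \<in> borel_measurable lborel" by measurable
  show "integrable lborel (\<lambda>y. G x y * ?L y)"
    by (rule integrable_cong_AE_imp[OF d m]) (use ae in \<open>auto elim: eventually_mono\<close>)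
  have "(\<integral>y. G x y * ?L y \<partial>lborel) = (\<integral>y. newton_kernel (y - x) * ?L y - u y * ?L y \<partial>lborel)"
    by (rule integral_cong_AE[OF m borel_measurable_integrable[OF d] ae])
  also have "\<dots> = (\<integral>y. newton_kernel (y - x) * ?L y \<partial>lborel) - (\<integral>y. u y * ?L y \<partial>lborel)"
    by (rule Bochner_Integration.integral_diff[OF n(1) gr(1)])
  also have "\<dots> = - \<phi> x - 0" by (intro arg_cong2[where f=minus] n(2) 0)
  also have "\<dots> = - \<phi> x" by simp
  finally show "(\<integral>y. G x y * ?L y \<partial>lborel) = - \<phi> x" .
qed

text \<open>The antiderivatives of the hat function on \<open>[0, 2]\<close>. Applied to \<open>v / e - 1\<close>, where \<open>v > 0\<close> in \<open>D\<close>
  vanishes on the boundary, the first one cuts \<open>v\<close> off near the boundary without destroying \<open>C\<^sup>2\<close>.\<close>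

definition spline :: "real \<Rightarrow> real" where
  "spline s = (max 0 s ^ 3 - 2 * max 0 (s - 1) ^ 3 + max 0 (s - 2) ^ 3) / 6"

definition spline' :: "real \<Rightarrow> real" where
  "spline' s = ((max 0 s)\<^sup>2 - 2 * (max 0 (s - 1))\<^sup>2 + (max 0 (s - 2))\<^sup>2) / 2"

definition spline'' :: "real \<Rightarrow> real" where
  "spline'' s = max 0 s - 2 * max 0 (s - 1) + max 0 (s - 2)"

lemma DERIV_pos_part_shift:
  assumes "n \<ge> 2"
  shows "((\<lambda>s::real. max 0 (s - c) ^ n) has_real_derivative real n * max 0 (s - c) ^ (n - 1)) (at s)"
proof -
  have "((\<lambda>s::real. max 0 (s - c) ^ n) has_real_derivative real n * max 0 (s - c) ^ (n - 1) * 1) (at s)"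
    by (rule DERIV_chain2[OF DERIV_pos_part_power[OF assms]]) (auto intro!: derivative_eq_intros)
  then show ?thesis by simp
qed

lemma DERIV_spline: "(spline has_real_derivative spline' s) (at s)"
proof -
  note d = DERIV_pos_part_shift[of 3 _ s]
  have "((\<lambda>s. (max 0 (s - 0) ^ 3 - 2 * max 0 (s - 1) ^ 3 + max 0 (s - 2) ^ 3) / 6) has_real_derivative
     (real 3 * max 0 (s - 0) ^ (3 - 1) - 2 * (real 3 * max 0 (s - 1) ^ (3 - 1)) + real 3 * max 0 (s - 2) ^ (3 - 1)) / 6) (at s)"
    by (intro DERIV_cdivide DERIV_add DERIV_diff DERIV_cmult d) auto
  moreover have "(real 3 * max 0 (s - 0) ^ (3 - 1) - 2 * (real 3 * max 0 (s - 1) ^ (3 - 1)) + real 3 * max 0 (s - 2) ^ (3 - 1)) / 6 = spline' s"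
    by (simp add: spline'_def)
  ultimately show ?thesis unfolding spline_def[abs_def] by simp
qed

lemma DERIV_spline': "(spline' has_real_derivative spline'' s) (at s)"
proof -
  note d = DERIV_pos_part_shift[of 2 _ s]
  have "((\<lambda>s. ((max 0 (s - 0))\<^sup>2 - 2 * (max 0 (s - 1))\<^sup>2 + (max 0 (s - 2))\<^sup>2) / 2) has_real_derivative
     (real 2 * max 0 (s - 0) ^ (2 - 1) - 2 * (real 2 * max 0 (s - 1) ^ (2 - 1)) + real 2 * max 0 (s - 2) ^ (2 - 1)) / 2) (at s)"
    by (intro DERIV_cdivide DERIV_add DERIV_diff DERIV_cmult d) auto
  moreover have "(real 2 * max 0 (s - 0) ^ (2 - 1) - 2 * (real 2 * max 0 (s - 1) ^ (2 - 1)) + real 2 * max 0 (s - 2) ^ (2 - 1)) / 2 = spline'' s"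
    by (simp add: spline''_def)
  ultimately show ?thesis unfolding spline'_def[abs_def] by simp
qed

lemma spline''_continuous: "continuous_on S spline''"
  unfolding spline''_def[abs_def] by (intro continuous_intros)

lemma spline_zero: "s \<le> 0 \<Longrightarrow> spline s = 0" by (simp add: spline_def)

lemma spline_large: "s \<ge> 2 \<Longrightarrow> spline s = s - 1"
  by (simp add: spline_def max_def) (simp add: power3_eq_cube field_simps)

lemma spline'_large: "s \<ge> 2 \<Longrightarrow> spline' s = 1"
  by (simp add: spline'_def max_def power2_eq_square algebra_simps)

lemma spline''_nonneg: "spline'' s \<ge> 0"
  by (auto simp: spline''_def max_def)

lemma spline''_zero: "s \<le> 0 \<or> s \<ge> 2 \<Longrightarrow> spline'' s = 0"
  by (auto simp: spline''_def max_def)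

lemma spline'_bounds: "0 \<le> spline' s" "spline' s \<le> 1"
proof -
  have mono: "spline' a \<le> spline' b" if "a \<le> b" for a b
    using that DERIV_spline' spline''_nonneg by (intro DERIV_nonneg_imp_nondecreasing[of a b spline']) blast+
  have "spline' (min s 0) = 0" by (simp add: spline'_def)
  then show "0 \<le> spline' s" using mono[of "min s 0" s] by simp
  show "spline' s \<le> 1" using mono[of s "max s 2"] spline'_large[of "max s 2"] by simp
qed

section \<open>The representation of a positive solution\<close>

text \<open>Away from the pole the Green function extends continuously to the closure, with boundary
  values 0. Hence a ball around \<open>x\<close> and the points outside it where the modulus is at
  least \<delta> form a compact subset \<open>S\<close> of \<open>D\<close>, and \<open>m\<close> is
  the minimum of \<open>v\<close> over \<open>S\<close>.\<close>

lemma green_small_near_boundary: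
  fixes D :: "(real ^ 'n) set"
  assumes G: "green_function D G" and D: "open D" "bounded D" and x: "x \<in> D"
    and v: "continuous_on (closure D) v" "\<And>y. y \<in> D \<Longrightarrow> v y > 0" and \<delta>: "\<delta> > 0"
  obtains m :: real where "m > 0" "\<And>y. y \<in> D \<Longrightarrow> v y < m \<Longrightarrow> y \<noteq> x \<and> \<bar>G x y\<bar> \<le> \<delta>"
proof -
  obtain u uv uw where u: "continuous_on (closure D) u" "\<And>y. y \<in> frontier D \<Longrightarrow> u y = newton_kernel (y - x)"
    and g: "\<And>y. y \<in> D \<Longrightarrow> y \<noteq> x \<Longrightarrow> G x y = newton_kernel (y - x) - u y"
    by (rule green_slice[OF G D x]) blast
  obtain r where r: "r > 0" "cball x r \<subseteq> D" using D(1) x by (meson open_contains_cball)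
  define \<Gamma> where "\<Gamma> y = newton_kernel (y - x) - u y" for y
  let ?E = "closure D - ball x r"
  have E: "compact ?E" using D by (intro compact_diff) auto
  have c: "continuous_on ?E \<Gamma>"
  proof -
    have "continuous_on {0<..} (newton_radial CARD('n))"
      using DERIV_newton_radial[of "CARD('n)"] zero_less_card_finite[where 'a='n]
      by (intro continuous_at_imp_continuous_on) (auto intro!: DERIV_isCont Suc_leI)
    then have "continuous_on ?E (\<lambda>y. newton_radial CARD('n) (norm (y - x)))"
      by (rule continuous_on_compose2) (use r in \<open>auto intro!: continuous_intros\<close>)
    then show ?thesis unfolding \<Gamma>_def newton_kernel_radial
      by (intro continuous_on_diff continuous_on_subset[OF u(1)]) auto
  qed
  define S where "S = cball x r \<union> {y\<in>?E. \<delta> \<le> \<bar>\<Gamma> y\<bar>}"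
  have "compact {y\<in>?E. \<delta> \<le> \<bar>\<Gamma> y\<bar>}"
  proof -
    have "closed (?E \<inter> (\<lambda>y. \<bar>\<Gamma> y\<bar>) -` {\<delta>..})"
      using E c by (intro continuous_closed_preimage continuous_intros) (auto intro: compact_imp_closed)
    moreover have "?E \<inter> (\<lambda>y. \<bar>\<Gamma> y\<bar>) -` {\<delta>..} = {y\<in>?E. \<delta> \<le> \<bar>\<Gamma> y\<bar>}" by auto
    ultimately have cl: "closed {y\<in>?E. \<delta> \<le> \<bar>\<Gamma> y\<bar>}" by simp
    have "?E \<inter> {y\<in>?E. \<delta> \<le> \<bar>\<Gamma> y\<bar>} = {y\<in>?E. \<delta> \<le> \<bar>\<Gamma> y\<bar>}" by blast
    then show ?thesis using compact_Int_closed[OF E cl] by metis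
  qed
  then have S: "compact S" unfolding S_def by (intro compact_Un compact_cball)
  have SD: "S \<subseteq> D"
  proof
    fix y assume y: "y \<in> S"
    show "y \<in> D"
    proof (rule ccontr)
      assume nD: "y \<notin> D"
      then have yE: "y \<in> ?E" "\<delta> \<le> \<bar>\<Gamma> y\<bar>" using y r(2) unfolding S_def by blast+
      then have "y \<in> frontier D" using nD D(1) by (simp add: frontier_def interior_open)
      then show False using u(2) yE(2) \<delta> by (simp add: \<Gamma>_def)
    qed
  qed
  have "continuous_on S v" using v(1) SD closure_subset by (meson continuous_on_subset)
  moreover have "S \<noteq> {}" using r(1) by (auto simp: S_def)
  ultimately obtain y0 where y0: "y0 \<in> S" "\<forall>y\<in>S. v y0 \<le> v y"
    using continuous_attains_inf[OF S] by metis
  show thesis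
  proof (rule that[of "v y0"])
    show "v y0 > 0" using v(2) y0(1) SD by blast
    fix y assume y: "y \<in> D" "v y < v y0"
    then have "y \<notin> S" using y0(2) by (auto simp: not_le[symmetric])
    then have yy: "y \<notin> cball x r" "\<not> (y \<in> ?E \<and> \<delta> \<le> \<bar>\<Gamma> y\<bar>)" by (auto simp: S_def)
    then have "y \<noteq> x" using r(1) by auto
    moreover have "y \<in> ?E" using y(1) yy(1) closure_subset by auto
    ultimately show "y \<noteq> x \<and> \<bar>G x y\<bar> \<le> \<delta>" using yy(2) g[OF y(1)] by (auto simp: \<Gamma>_def)
  qed
qed

lemma integrable_bounded_on:
  fixes f :: "'a::euclidean_space \<Rightarrow> real"
  assumes D: "open D" "bounded D" and f: "continuous_on D f" "\<And>y. y \<in> D \<Longrightarrow> \<bar>f y\<bar> \<le> M"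
    and g: "integrable lborel g" "\<And>y. y \<notin> D \<Longrightarrow> g y = 0"
  shows "integrable lborel (\<lambda>y. if y \<in> D then f y else 0)"
    and "integrable lborel (\<lambda>y. g y * f y)"
    and "(\<lambda>y. if y \<in> D then f y else 0) \<in> borel_measurable borel"
proof -
  have eq: "(\<lambda>y. if y \<in> D then f y else 0) = (\<lambda>y. indicator D y *\<^sub>R f y)" by (auto simp: indicator_def)
  show m [measurable]: "(\<lambda>y. if y \<in> D then f y else 0) \<in> borel_measurable borel"
    unfolding eq using D by (intro borel_measurable_continuous_on_indicator f) auto
  have "integrable lborel (indicator D :: 'a \<Rightarrow> real)"
    using D emeasure_bounded_finite[OF D(2)] by (intro integrable_real_indicator) auto
  then have i: "integrable lborel (\<lambda>y. M * indicator D y)" by (rule integrable_mult_right)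
  show "integrable lborel (\<lambda>y. if y \<in> D then f y else 0)"
    by (rule Bochner_Integration.integrable_bound[OF i])
      (use f(2) in \<open>auto intro!: AE_I2 simp: abs_mult intro: order_trans[OF _ abs_ge_self]\<close>)
  have eq2: "(\<lambda>y. g y * f y) = (\<lambda>y. g y * (if y \<in> D then f y else 0))" using g(2) by auto
  show "integrable lborel (\<lambda>y. g y * f y)" unfolding eq2
  proof (rule Bochner_Integration.integrable_bound[OF integrable_mult_right[OF g(1), of M]])
    show "(\<lambda>y. g y * (if y \<in> D then f y else 0)) \<in> borel_measurable lborel"
      using g(1) by measurable
    have "\<bar>g y * (if y \<in> D then f y else 0)\<bar> \<le> \<bar>M * g y\<bar>" for y
    proof (cases "y \<in> D")
      case True
      then have "\<bar>f y\<bar> \<le> \<bar>M\<bar>" using f(2)[of y] by linarith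
      then show ?thesis using True by (simp add: abs_mult mult.commute mult_right_mono)
    qed simp
    then show "AE y in lborel. norm (g y * (if y \<in> D then f y else 0)) \<le> norm (M * g y)" by simp
  qed
qed

text \<open>Let \<open>\<phi> = \<psi>(v)\<close> be the cut-off of \<open>v\<close>. Then \<open>\<Delta>\<phi> = \<psi>''(v) \<bar>\<nabla>v\<bar>\<^sup>2 - \<psi>'(v) f\<close>, and since \<open>\<Delta>\<phi>\<close> has integral 0
  the nonnegative gradient term has integral at most \<open>M \<bar>D\<bar>\<close>. It lives where \<open>v\<close>, hence also the Green
  function, is small, so it drops out of the representation of \<open>\<phi>\<close> in the limit.\<close>

lemma green_representation_pos:
  fixes D :: "(real ^ 'n) set"
  assumes G: "green_function D G" and D: "open D" "bounded D" and x: "x \<in> D"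
    and v: "continuous_on (closure D) v" "\<And>y. y \<in> frontier D \<Longrightarrow> v y = 0" "\<And>y. y \<in> D \<Longrightarrow> v y > 0"
    and C: "C2_real D v vv vw" and f: "\<And>y. y \<in> D \<Longrightarrow> f y = - (\<Sum>i\<in>UNIV. vw i i y)"
    and M: "\<And>y. y \<in> D \<Longrightarrow> \<bar>f y\<bar> \<le> M"
  shows "v x = (\<integral>y. G x y * f y \<partial>lborel)"
proof -
  define E where "E = M * measure lborel D"
  have M0: "M \<ge> 0" using M[OF x] abs_ge_zero order_trans by blast
  have E0: "E \<ge> 0" using M0 by (simp add: E_def)
  have Gi: "integrable lborel (G x)" by (rule green_integrable[OF G D])
  have G0: "\<And>y. y \<notin> D \<Longrightarrow> G x y = 0" using G by (auto simp: green_function_def)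
  have cD: "continuous_on D v" "continuous_on D (vv i)" "continuous_on D (vw i j)" for i j
    using C by (auto simp: C2_real_def)
  have cf: "continuous_on D f"
    by (rule continuous_on_eq[of _ "\<lambda>y. - (\<Sum>i\<in>UNIV. vw i i y)"]) (auto intro!: continuous_intros cD simp: f)
  \<comment> \<open>The cut-off \<open>e * spline (v / e - 1)\<close> vanishes for
    \<open>v \<le> e\<close> and has slope 1 in \<open>v\<close> for \<open>v \<ge> 3 * e\<close>.
    So the gradient term is confined to \<open>v < 3 * e\<close>, where \<open>G\<close> is at most
    \<delta> in modulus.\<close>
  have key: "\<bar>e * spline (v x / e - 1) - (\<integral>y. G x y * (spline' (v y / e - 1) * f y) \<partial>lborel)\<bar> \<le> \<delta> * E"
    if \<delta>: "\<delta> > 0" and e: "e > 0" and sm: "\<And>y. y \<in> D \<Longrightarrow> v y < 3 * e \<Longrightarrow> \<bar>G x y\<bar> \<le> \<delta>" for \<delta> e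
  proof -
    define K where "K = {y\<in>closure D. e \<le> v y}"
    have K: "compact K"
    proof -
      have "closed (closure D \<inter> v -` {e..})" by (intro continuous_closed_preimage v) auto
      moreover have "closure D \<inter> v -` {e..} = K" by (auto simp: K_def)
      moreover have "K \<subseteq> closure D" by (auto simp: K_def)
      ultimately show ?thesis using D by (metis compact_eq_bounded_closed bounded_closure bounded_subset)
    qed
    have KD: "K \<subseteq> D"
    proof
      fix y assume y: "y \<in> K"
      show "y \<in> D"
      proof (rule ccontr)
        assume "y \<notin> D"
        then have "y \<in> frontier D" using y D(1) by (simp add: K_def frontier_def interior_open)
        then show False using v(2)[of y] y e by (simp add: K_def)
      qed
    qed
    define \<psi> where "\<psi> t = e * spline (t / e - 1)" for t
    define \<psi>' where "\<psi>' t = spline' (t / e - 1)" for t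
    define \<psi>'' where "\<psi>'' t = spline'' (t / e - 1) / e" for t
    have aff: "((\<lambda>t. t / e - 1) has_real_derivative 1 / e) (at t)" for t
      using e by (auto intro!: derivative_eq_intros)
    have d1: "(\<psi> has_real_derivative \<psi>' t) (at t)" for t
      using DERIV_cmult[OF DERIV_chain2[where f=spline, OF DERIV_spline aff], of e t] e unfolding \<psi>_def[abs_def] \<psi>'_def by simp
    have d2: "(\<psi>' has_real_derivative \<psi>'' t) (at t)" for t
      using DERIV_chain2[where f=spline', OF DERIV_spline' aff, of t] unfolding \<psi>'_def[abs_def] \<psi>''_def by simp
    have d3: "continuous_on UNIV \<psi>''"
      unfolding \<psi>''_def
      by (intro continuous_intros continuous_on_compose2[OF spline''_continuous[of UNIV]]) (use e in auto)
    note C1 = C2_real_compose[OF C, of UNIV, OF UNIV_I d1 d2 d3]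
    have vK: "\<psi> (v y) = 0" if "y \<in> D - K" for y
    proof -
      have "v y < e" using that closure_subset by (force simp: K_def)
      then show ?thesis using e by (simp add: \<psi>_def spline_zero)
    qed
    define ext where "ext h y = (if y \<in> D then h y else (0::real))" for h y
    let ?w = "\<lambda>i j y. \<psi>'' (v y) * vv j y * vv i y + \<psi>' (v y) * vw i j y"
    let ?u = "ext (\<lambda>y. \<psi> (v y))" and ?v = "\<lambda>i. ext (\<lambda>y. \<psi>' (v y) * vv i y)" and ?W = "\<lambda>i j. ext (?w i j)"
    have C3: "C2_real UNIV ?u ?v ?W"
      unfolding ext_def by (rule C2_real_extend(1)[OF C1 D(1) K KD vK])
    have Z: "?u y = 0 \<and> (\<forall>i. ?v i y = 0 \<and> (\<forall>j. ?W i j y = 0))" if "y \<notin> K" for y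
      unfolding ext_def by (rule C2_real_extend(2)[OF C1 D(1) K KD vK that])
    \<comment> \<open>The Laplacian of the cut-off function is \<open>A - B\<close>, with
      \<open>A\<close> the gradient term and \<open>B\<close> the damped source, both extended by
      0.\<close>
    define A where "A = ext (\<lambda>y. \<psi>'' (v y) * (\<Sum>i\<in>UNIV. vv i y * vv i y))"
    define B where "B = ext (\<lambda>y. \<psi>' (v y) * f y)"
    have L: "(\<Sum>i\<in>UNIV. ?W i i y) = A y - B y" for y
      by (auto simp: ext_def A_def B_def f sum.distrib sum_distrib_left mult.assoc sum_negf)
    note gt = green_test_function[OF G D x K KD C3 Z, unfolded L]
    note gi = green_identity[OF open_UNIV K subset_UNIV C2_real_const[of UNIV 1] C3 Z, unfolded L]
    have gz: "integrable lborel (\<lambda>y. A y - B y)" "(\<integral>y. A y - B y \<partial>lborel) = 0"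
      using gi(1,3) by simp_all
    have B_le: "\<bar>\<psi>' (v y) * f y\<bar> \<le> M" if "y \<in> D" for y
    proof -
      have "\<bar>\<psi>' (v y)\<bar> * \<bar>f y\<bar> \<le> 1 * M"
        using spline'_bounds[of "v y / e - 1"] M[OF that] by (intro mult_mono) (auto simp: \<psi>'_def)
      then show ?thesis by (simp add: abs_mult)
    qed
    have cB: "continuous_on D (\<lambda>y. \<psi>' (v y) * f y)"
      using d2 by (intro continuous_intros cf continuous_on_compose2[OF _ cD(1), of UNIV \<psi>'])
        (auto intro!: continuous_at_imp_continuous_on DERIV_isCont)
    note iB = integrable_bounded_on[OF D cB B_le Gi G0]
    have iBB: "integrable lborel B" using iB(1) unfolding B_def ext_def .
    have GB: "(\<lambda>y. G x y * B y) = (\<lambda>y. G x y * (\<psi>' (v y) * f y))" using G0 by (auto simp: B_def ext_def)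
    have iGB: "integrable lborel (\<lambda>y. G x y * B y)" unfolding GB by (rule iB(2))
    have iA: "integrable lborel A" using Bochner_Integration.integrable_add[OF gz(1) iBB] by simp
    have iGA: "integrable lborel (\<lambda>y. G x y * A y)"
      using Bochner_Integration.integrable_add[OF gt(1) iGB] by (simp add: algebra_simps)
    have "0 \<le> (\<Sum>i\<in>UNIV. vv i y * vv i y)" for y by (intro sum_nonneg) simp
    then have A0: "A y \<ge> 0" for y
      using spline''_nonneg e by (auto simp: A_def ext_def \<psi>''_def intro!: mult_nonneg_nonneg divide_nonneg_pos)
    have AE: "(\<integral>y. A y \<partial>lborel) \<le> E"
    proof -
      have "(\<integral>y. A y - B y \<partial>lborel) = 0" using gz(2) by simp
      then have "(\<integral>y. A y \<partial>lborel) = (\<integral>y. B y \<partial>lborel)"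
        using Bochner_Integration.integral_diff[OF iA iBB] by simp
      also have "\<dots> \<le> (\<integral>y. M * indicator D y \<partial>lborel)"
      proof (rule integral_mono[OF iBB])
        have "integrable lborel (indicator D :: real ^ 'n \<Rightarrow> real)"
          using D emeasure_bounded_finite[OF D(2)] by (intro integrable_real_indicator) auto
        then show "integrable lborel (\<lambda>y. M * indicator D y)" by (rule integrable_mult_right)
        show "B y \<le> M * indicator D y" for y
          using B_le[of y] by (auto simp: B_def ext_def abs_le_iff)
      qed
      also have "\<dots> = E" using D by (simp add: E_def)
      finally show ?thesis .
    qed
    have "\<bar>\<integral>y. G x y * A y \<partial>lborel\<bar> \<le> (\<integral>y. \<delta> * A y \<partial>lborel)"
    proof (rule integral_abs_bound_integral[OF iGA])
      show "integrable lborel (\<lambda>y. \<delta> * A y)" using iA by simp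
      show "\<bar>G x y * A y\<bar> \<le> \<delta> * A y" for y
      proof (cases "A y = 0")
        case False
        then have y: "y \<in> D" "spline'' (v y / e - 1) \<noteq> 0" by (auto simp: A_def ext_def \<psi>''_def split: if_splits)
        then have "v y / e - 1 < 2" using spline''_zero[of "v y / e - 1"] by (meson not_le)
        then have "v y < 3 * e" using e by (simp add: field_simps)
        then have "\<bar>G x y\<bar> \<le> \<delta>" using sm y by blast
        then show ?thesis using A0[of y] by (simp add: abs_mult mult_right_mono)
      qed simp
    qed
    also have "\<dots> = \<delta> * (\<integral>y. A y \<partial>lborel)" by simp
    also have "\<dots> \<le> \<delta> * E" using \<delta> AE by (intro mult_left_mono) auto
    finally have a: "\<bar>\<integral>y. G x y * A y \<partial>lborel\<bar> \<le> \<delta> * E" .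
    have "(\<integral>y. G x y * (A y - B y) \<partial>lborel) = (\<integral>y. G x y * A y \<partial>lborel) - (\<integral>y. G x y * B y \<partial>lborel)"
      using Bochner_Integration.integral_diff[OF iGA iGB] by (simp add: right_diff_distrib)
    then have "\<psi> (v x) - (\<integral>y. G x y * B y \<partial>lborel) = - (\<integral>y. G x y * A y \<partial>lborel)"
      using gt(2) x by (simp add: ext_def)
    then show ?thesis using a unfolding GB by (simp add: \<psi>_def \<psi>'_def)
  qed
  have "\<bar>v x - (\<integral>y. G x y * f y \<partial>lborel)\<bar> \<le> \<delta> * E" if \<delta>: "\<delta> > 0" for \<delta>
  proof -
    obtain m where m: "m > 0" "\<And>y. y \<in> D \<Longrightarrow> v y < m \<Longrightarrow> y \<noteq> x \<and> \<bar>G x y\<bar> \<le> \<delta>"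
      using green_small_near_boundary[OF G D x v(1) v(3) \<delta>] by metis
    \<comment> \<open>The factor \<open>m / 3\<close> ensures \<open>3 * e n \<le> m\<close>, the
      level below which the Green function is at most \<delta>.\<close>
    define e where "e n = m / 3 * inverse (real (Suc n))" for n
    have e0: "e n > 0" for n using m(1) by (simp add: e_def)
    have em: "3 * e n \<le> m" for n
    proof -
      have "m * inverse (real (Suc n)) \<le> m * 1" using m(1) by (intro mult_left_mono) (auto simp: inverse_le_1_iff)
      then show ?thesis by (simp add: e_def)
    qed
    have el: "e \<longlonglongrightarrow> 0"
      unfolding e_def using tendsto_mult_right_zero[OF LIMSEQ_inverse_real_of_nat] by blast
    have vx: "v y \<ge> 3 * e n \<Longrightarrow> v y / e n - 1 \<ge> 2" for y n using e0[of n] by (simp add: field_simps)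
    have ev: "eventually (\<lambda>n. v y \<ge> 3 * e n) sequentially" if "y \<in> D" for y
    proof -
      have "(\<lambda>n. 3 * e n) \<longlonglongrightarrow> 3 * 0" by (intro tendsto_intros el)
      from order_tendstoD(2)[OF this, of "v y"] v(3)[OF that] show ?thesis
        by (auto elim: eventually_mono)
    qed
    \<comment> \<open>Once \<open>3 * e n \<le> v x\<close>, the value of the cut-off is exactly
      \<open>v x - 2 * e n\<close>.\<close>
    have l1: "(\<lambda>n. e n * spline (v x / e n - 1)) \<longlonglongrightarrow> v x"
    proof (rule Lim_transform_eventually)
      have "(\<lambda>n. v x - 2 * e n) \<longlonglongrightarrow> v x - 2 * 0" by (intro tendsto_intros el)
      then show "(\<lambda>n. v x - 2 * e n) \<longlonglongrightarrow> v x" by simp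
      show "eventually (\<lambda>n. v x - 2 * e n = e n * spline (v x / e n - 1)) sequentially"
        using ev[OF x]
      proof eventually_elim
        case (elim n)
        have "e n * spline (v x / e n - 1) = e n * (v x / e n - 1 - 1)"
          by (simp only: spline_large[OF vx[OF elim]])
        then show ?case using e0[of n] by (simp add: right_diff_distrib)
      qed
    qed
    have l2: "(\<lambda>n. \<integral>y. G x y * (spline' (v y / e n - 1) * f y) \<partial>lborel) \<longlonglongrightarrow> (\<integral>y. G x y * f y \<partial>lborel)"
    proof (rule integral_dominated_convergence[where w="\<lambda>y. M * \<bar>G x y\<bar>"])
      have cs: "continuous_on D (\<lambda>y. spline' (v y / e n - 1) * f y)" for n
      proof (intro continuous_on_mult cf)
        have "continuous_on UNIV spline'"
          using DERIV_spline' by (auto intro!: continuous_at_imp_continuous_on DERIV_isCont)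
        then show "continuous_on D (\<lambda>y. spline' (v y / e n - 1))"
          by (rule continuous_on_compose2) (use e0[of n] in \<open>auto intro!: continuous_intros cD(1)\<close>)
      qed
      have sb: "\<bar>spline' (v y / e n - 1) * f y\<bar> \<le> M" if "y \<in> D" for y n
      proof -
        have "\<bar>spline' (v y / e n - 1)\<bar> * \<bar>f y\<bar> \<le> 1 * M"
          using spline'_bounds[of "v y / e n - 1"] M[OF that] by (intro mult_mono) auto
        then show ?thesis by (simp add: abs_mult)
      qed
      show "(\<lambda>y. G x y * f y) \<in> borel_measurable lborel"
        using integrable_bounded_on(2)[OF D cf M Gi G0] by (rule borel_measurable_integrable)
      show "(\<lambda>y. G x y * (spline' (v y / e n - 1) * f y)) \<in> borel_measurable lborel" for n
        using integrable_bounded_on(2)[OF D cs sb Gi G0] by (rule borel_measurable_integrable)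
      show "integrable lborel (\<lambda>y. M * \<bar>G x y\<bar>)" using Gi by simp
      show "AE y in lborel. (\<lambda>n. G x y * (spline' (v y / e n - 1) * f y)) \<longlonglongrightarrow> G x y * f y"
      proof (intro AE_I2)
        fix y
        show "(\<lambda>n. G x y * (spline' (v y / e n - 1) * f y)) \<longlonglongrightarrow> G x y * f y"
        proof (cases "y \<in> D")
          case True
          show ?thesis
          proof (rule tendsto_eventually)
            show "eventually (\<lambda>n. G x y * (spline' (v y / e n - 1) * f y) = G x y * f y) sequentially"
              using ev[OF True] by eventually_elim (use vx spline'_large in auto)
          qed
        qed (simp add: G0)
      qed
      show "AE y in lborel. norm (G x y * (spline' (v y / e n - 1) * f y)) \<le> M * \<bar>G x y\<bar>" for n
      proof (intro AE_I2)
        fix y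
        show "norm (G x y * (spline' (v y / e n - 1) * f y)) \<le> M * \<bar>G x y\<bar>"
        proof (cases "y \<in> D")
          case True
          then show ?thesis using mult_left_mono[OF sb[OF True, of n], of "\<bar>G x y\<bar>"]
            by (simp add: abs_mult mult_ac)
        qed (simp add: G0)
      qed
    qed
    have "(\<lambda>n. \<bar>e n * spline (v x / e n - 1) - (\<integral>y. G x y * (spline' (v y / e n - 1) * f y) \<partial>lborel)\<bar>) \<longlonglongrightarrow>
        \<bar>v x - (\<integral>y. G x y * f y \<partial>lborel)\<bar>"
      by (intro tendsto_intros l1 l2)
    then show ?thesis
    proof (rule LIMSEQ_le_const2)
      have "\<bar>G x y\<bar> \<le> \<delta>" if "y \<in> D" "v y < 3 * e n" for y n
        using m(2)[OF that(1)] that(2) em[of n] by auto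
      then show "\<exists>N. \<forall>n\<ge>N. \<bar>e n * spline (v x / e n - 1) - (\<integral>y. G x y * (spline' (v y / e n - 1) * f y) \<partial>lborel)\<bar> \<le> \<delta> * E"
        using key[OF \<delta> e0] by blast
    qed
  qed
  note bound = this
  have "\<bar>v x - (\<integral>y. G x y * f y \<partial>lborel)\<bar> \<le> 0"
  proof (rule field_le_epsilon)
    fix \<epsilon> :: real assume \<epsilon>: "\<epsilon> > 0"
    have "\<epsilon> / (E + 1) * E \<le> \<epsilon>" using \<epsilon> E0 by (simp add: field_simps)
    moreover have "\<epsilon> / (E + 1) > 0" using \<epsilon> E0 by simp
    ultimately show "\<bar>v x - (\<integral>y. G x y * f y \<partial>lborel)\<bar> \<le> 0 + \<epsilon>" using bound[of "\<epsilon> / (E + 1)"] by linarith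
  qed
  then show ?thesis by simp
qed

section \<open>Reduction to positive solutions\<close>

text \<open>Nonnegativity is the maximum principle for \<open>- v\<close>. A zero inside
  \<open>D\<close> would be a minimum, where all pure second derivatives are nonnegative, against
  the strict sign of the Laplacian.\<close>

lemma superharmonic_pos:
  fixes D :: "(real ^ 'n) set"
  assumes D: "open D" "bounded D"
    and v: "continuous_on (closure D) v" "\<And>y. y \<in> frontier D \<Longrightarrow> v y = 0"
    and C: "C2_real D v vv vw" and f: "\<And>y. y \<in> D \<Longrightarrow> (\<Sum>i\<in>UNIV. vw i i y) < 0" and x: "x \<in> D"
  shows "v x > 0"
proof -
  have C': "C2_real D (\<lambda>y. (-1) * v y) (\<lambda>i y. (-1) * vv i y) (\<lambda>i j y. (-1) * vw i j y)"
    by (rule C2_real_cmult[OF C])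
  have p: "has_partial_real D j (\<lambda>y. (-1) * v y) (\<lambda>y. (-1) * vv j y)"
    "has_partial_real D j (\<lambda>y. (-1) * vv j y) (\<lambda>y. (-1) * vw j j y)" for j
    using C' unfolding C2_real_def by blast+
  have nonneg: "v y \<ge> 0" if "y \<in> D" for y
  proof -
    have "(-1) * v y \<le> 0"
    proof (rule max_principle[OF D _ p])
      show "continuous_on (closure D) (\<lambda>y. (-1) * v y)" by (intro continuous_intros v)
      show "0 \<le> (\<Sum>j\<in>UNIV. (-1) * vw j j y)" if "y \<in> D" for y
        using f[OF that] by (simp add: sum_negf)
      show "y \<in> closure D" using that closure_subset by blast
    qed (simp add: v)
    then show ?thesis by simp
  qed
  show ?thesis
  proof (rule ccontr)
    assume "\<not> v x > 0"
    then have v0: "v x = 0" using nonneg[OF x] by simp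
    obtain r where r: "r > 0" "ball x r \<subseteq> D" using D(1) x by (meson open_contains_ball)
    have "(-1) * vw j j x \<le> 0" for j
    proof (rule second_derivative_local_max[OF r(1)])
      show "((\<lambda>t. (-1) * vv j (x + t *\<^sub>R axis j 1)) has_real_derivative (-1) * vw j j x) (at 0)"
        using p(2) x unfolding has_partial_real_def by blast
      fix t assume t: "\<bar>t\<bar> < r"
      then have in_D: "x + t *\<^sub>R axis j 1 \<in> D" using r(2) by (auto simp: subset_eq dist_norm)
      show "((\<lambda>t. (-1) * v (x + t *\<^sub>R axis j 1)) has_real_derivative (-1) * vv j (x + t *\<^sub>R axis j 1)) (at t)"
        by (rule has_partial_real_at[OF p(1) in_D])
      show "(-1) * v (x + t *\<^sub>R axis j 1) \<le> (-1) * v (x + 0 *\<^sub>R axis j 1)"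
        using nonneg[OF in_D] v0 by simp
    qed
    then have "(\<Sum>j\<in>UNIV. vw j j x) \<ge> 0" by (intro sum_nonneg) simp
    then show False using f[OF x] by simp
  qed
qed

text \<open>The polynomial \<open>- \<bar>y\<bar>\<^sup>2 / (2 d)\<close> has Laplacian -1, and
  regularity of the boundary supplies the harmonic function that removes its boundary
  values.\<close>

lemma torsion_function:
  fixes D :: "(real ^ 'n) set"
  assumes "regular_boundary D"
  obtains v vv vw where "continuous_on (closure D) v" "\<And>y. y \<in> frontier D \<Longrightarrow> v y = 0"
    "C2_real D v vv vw" "\<And>y. y \<in> D \<Longrightarrow> (\<Sum>i\<in>UNIV. vw i i y) = - 1"
proof -
  let ?c = "- 1 / (2 * real CARD('n))"
  let ?q = "\<lambda>y :: real ^ 'n. 0 + (norm (y - 0))\<^sup>2"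
  have "continuous_on (frontier D) (\<lambda>y. - (?c * ?q y))" by (intro continuous_intros)
  then obtain u where u: "solves_dirichlet D (\<lambda>y. - (?c * ?q y)) u"
    using assms unfolding regular_boundary_def by blast
  obtain uv uw where uu: "continuous_on (closure D) u" "C2_real D u uv uw"
    "\<And>x. x \<in> D \<Longrightarrow> (\<Sum>i\<in>UNIV. uw i i x) = 0" "\<And>x. x \<in> frontier D \<Longrightarrow> u x = - (?c * ?q x)"
    by (rule solves_dirichletD[OF u]) blast
  note q = C2_real_cmult[OF C2_real_subset[OF C2_real_norm_sq[of 0 0] subset_UNIV], of D ?c]
  note C = C2_real_add[OF uu(2) q]
  show thesis
  proof (rule that[OF _ _ C])
    show "continuous_on (closure D) (\<lambda>y. u y + ?c * ?q y)" by (intro continuous_intros uu(1))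
    show "u y + ?c * ?q y = 0" if "y \<in> frontier D" for y using uu(4)[OF that] by simp
    show "(\<Sum>i\<in>UNIV. uw i i y + ?c * (if i = i then 2 else 0)) = - 1" if "y \<in> D" for y
      using uu(3)[OF that] by (simp add: sum_subtractf)
  qed
qed

text \<open>\<open>v\<close> and \<open>f\<close> may change sign, but \<open>v + (M + 1) t\<close>,
  with the torsion function \<open>t\<close>, has the source \<open>f + M + 1 \<ge> 1\<close> and is
  therefore positive. The positive case applies to this sum and to \<open>t\<close>, and linearity
  gives the formula for \<open>v\<close>.\<close>

lemma green_representation:
  fixes D :: "(real ^ 'n) set"
  assumes reg: "regular_boundary D" and G: "green_function D G" and D: "open D" "bounded D" and x: "x \<in> D"
    and v: "continuous_on (closure D) v" "\<And>y. y \<in> frontier D \<Longrightarrow> v y = 0"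
    and C: "C2_real D v vv vw" and f: "\<And>y. y \<in> D \<Longrightarrow> f y = - (\<Sum>i\<in>UNIV. vw i i y)"
    and M: "\<And>y. y \<in> D \<Longrightarrow> \<bar>f y\<bar> \<le> M"
  shows "integrable lborel (\<lambda>y. G x y * f y)" and "v x = (\<integral>y. G x y * f y \<partial>lborel)"
proof -
  have M0: "M \<ge> 0" using M[OF x] abs_ge_zero order_trans by blast
  obtain t tv tw where t: "continuous_on (closure D) t" "\<And>y. y \<in> frontier D \<Longrightarrow> t y = 0"
    and tC: "C2_real D t tv tw" and tL: "\<And>y. y \<in> D \<Longrightarrow> (\<Sum>i\<in>UNIV. tw i i y) = - 1"
    by (rule torsion_function[OF reg]) blast
  have Gi: "integrable lborel (G x)" by (rule green_integrable[OF G D])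
  have G0: "\<And>y. y \<notin> D \<Longrightarrow> G x y = 0" using G by (auto simp: green_function_def)
  have cD: "continuous_on D (vw i j)" for i j using C by (auto simp: C2_real_def)
  have cf: "continuous_on D f"
    by (rule continuous_on_eq[of _ "\<lambda>y. - (\<Sum>i\<in>UNIV. vw i i y)"]) (auto intro!: continuous_intros cD simp: f)
  show i: "integrable lborel (\<lambda>y. G x y * f y)" by (rule integrable_bounded_on(2)[OF D cf M Gi G0])
  let ?c = "M + 1"
  have t_rep: "t x = (\<integral>y. G x y * 1 \<partial>lborel)"
    by (rule green_representation_pos[OF G D x t superharmonic_pos[OF D t tC] tC]) (auto simp: tL)
  note S = C2_real_add[OF C C2_real_cmult[OF tC, of ?c]]
  have lap: "(\<Sum>i\<in>UNIV. vw i i y + ?c * tw i i y) = - (f y + ?c)" if "y \<in> D" for y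
    using tL[OF that] f[OF that] by (simp add: sum.distrib sum_distrib_left[symmetric])
  have cs: "continuous_on (closure D) (\<lambda>y. v y + ?c * t y)" by (intro continuous_intros v t)
  have fs: "v y + ?c * t y = 0" if "y \<in> frontier D" for y using v(2)[OF that] t(2)[OF that] by simp
  have "v x + ?c * t x = (\<integral>y. G x y * (f y + ?c) \<partial>lborel)"
  proof (rule green_representation_pos[OF G D x cs fs superharmonic_pos[OF D cs fs S] S])
    show "(\<Sum>i\<in>UNIV. vw i i y + ?c * tw i i y) < 0" if "y \<in> D" for y
      unfolding lap[OF that] using M[OF that] by linarith
    show "f y + ?c = - (\<Sum>i\<in>UNIV. vw i i y + ?c * tw i i y)" if "y \<in> D" for y
      unfolding lap[OF that] by simp
    show "\<bar>f y + ?c\<bar> \<le> M + ?c" if "y \<in> D" for y using M[OF that] M0 by linarith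
  qed
  also have "\<dots> = (\<integral>y. G x y * f y \<partial>lborel) + (\<integral>y. ?c * G x y \<partial>lborel)"
    using Bochner_Integration.integral_add[OF i integrable_mult_right[OF Gi, of ?c]]
    by (simp add: algebra_simps)
  finally show "v x = (\<integral>y. G x y * f y \<partial>lborel)" using t_rep by simp
qed

section \<open>Hermite functions\<close>

text \<open>The probabilists' Hermite polynomials by their three-term recurrence, a form suited to
  induction; \<open>hermite_poly_eq\<close> identifies them with Rodrigues' formula.\<close>

fun hermite_rec :: "nat \<Rightarrow> real \<Rightarrow> real" where
  "hermite_rec 0 x = 1"
| "hermite_rec (Suc 0) x = x"
| "hermite_rec (Suc (Suc n)) x = x * hermite_rec (Suc n) x - real (Suc n) * hermite_rec n x"

text \<open>At \<open>n = 0\<close> the truncated index \<open>n - 1\<close> is harmless, since its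
  factor is 0.\<close>

lemma hermite_rec_Suc: "hermite_rec (Suc n) x = x * hermite_rec n x - real n * hermite_rec (n - 1) x"
  by (cases n) auto

lemma DERIV_hermite_rec: "(hermite_rec n has_real_derivative real n * hermite_rec (n - 1) x) (at x)"
proof (induction n x rule: hermite_rec.induct)
  case (1 x)
  show ?case by simp
next
  case (2 x)
  have "hermite_rec (Suc 0) = (\<lambda>x. x)" by auto
  then show ?case by simp
next
  case (3 n x)
  have eq: "hermite_rec (Suc (Suc n)) = (\<lambda>x. x * hermite_rec (Suc n) x - real (Suc n) * hermite_rec n x)" by auto
  have "((\<lambda>x. x * hermite_rec (Suc n) x - real (Suc n) * hermite_rec n x) has_real_derivative
      (1 * hermite_rec (Suc n) x + real (Suc n) * hermite_rec (Suc n - 1) x * x) - real (Suc n) * (real n * hermite_rec (n - 1) x)) (at x)"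
    by (intro DERIV_diff DERIV_mult DERIV_cmult DERIV_ident 3)
  moreover have "(1 * hermite_rec (Suc n) x + real (Suc n) * hermite_rec (Suc n - 1) x * x) - real (Suc n) * (real n * hermite_rec (n - 1) x)
     = real (Suc (Suc n)) * hermite_rec (Suc (Suc n) - 1) x"
  proof -
    have "(1 * hermite_rec (Suc n) x + real (Suc n) * hermite_rec (Suc n - 1) x * x) - real (Suc n) * (real n * hermite_rec (n - 1) x)
      = hermite_rec (Suc n) x + real (Suc n) * (x * hermite_rec n x - real n * hermite_rec (n - 1) x)"
      by (simp add: algebra_simps)
    then show ?thesis unfolding hermite_rec_Suc[of n x, symmetric] by (simp add: algebra_simps)
  qed
  ultimately show ?case unfolding eq by simp
qed

lemma hermite_poly_eq: "hermite_poly n x = hermite_rec n x"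
proof -
  have "(deriv ^^ n) (\<lambda>t. exp (- (t\<^sup>2 / 2))) = (\<lambda>t. (- 1) ^ n * hermite_rec n t * exp (- (t\<^sup>2 / 2)))"
  proof (induction n)
    case (Suc n)
    have "deriv (\<lambda>t. (- 1) ^ n * hermite_rec n t * exp (- (t\<^sup>2 / 2))) x =
        (- 1) ^ Suc n * hermite_rec (Suc n) x * exp (- (x\<^sup>2 / 2))" for x :: real
    proof (rule DERIV_imp_deriv)
      have e: "((\<lambda>t::real. exp (- (t\<^sup>2 / 2))) has_real_derivative exp (- (x\<^sup>2 / 2)) * (- x)) (at x)"
        by (auto intro!: derivative_eq_intros)
      have "((\<lambda>t. ((- 1) ^ n * hermite_rec n t) * exp (- (t\<^sup>2 / 2))) has_real_derivative
         (- 1) ^ n * (real n * hermite_rec (n - 1) x) * exp (- (x\<^sup>2 / 2)) + exp (- (x\<^sup>2 / 2)) * (- x) * ((- 1) ^ n * hermite_rec n x)) (at x)"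
        by (intro DERIV_mult DERIV_cmult DERIV_hermite_rec e)
      moreover have "(- 1) ^ n * (real n * hermite_rec (n - 1) x) * exp (- (x\<^sup>2 / 2)) + exp (- (x\<^sup>2 / 2)) * (- x) * ((- 1) ^ n * hermite_rec n x)
         = (- 1) ^ Suc n * hermite_rec (Suc n) x * exp (- (x\<^sup>2 / 2))"
        unfolding hermite_rec_Suc by (simp add: algebra_simps)
      ultimately show "((\<lambda>t. (- 1) ^ n * hermite_rec n t * exp (- (t\<^sup>2 / 2))) has_real_derivative
         (- 1) ^ Suc n * hermite_rec (Suc n) x * exp (- (x\<^sup>2 / 2))) (at x)" by simp
    qed
    then show ?case by (simp add: Suc.IH fun_eq_iff)
  qed simp
  then have "hermite_poly n x = (- 1) ^ n * exp (x\<^sup>2 / 2) * ((- 1) ^ n * hermite_rec n x * exp (- (x\<^sup>2 / 2)))"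
    by (simp add: hermite_poly_def)
  also have "\<dots> = ((- 1) ^ n * (- 1) ^ n) * (exp (x\<^sup>2 / 2) * exp (- (x\<^sup>2 / 2))) * hermite_rec n x" by simp
  also have "\<dots> = hermite_rec n x" by (simp add: power_add[symmetric] mult_exp_exp flip: power_mult_distrib)
  finally show ?thesis .
qed

text \<open>Provides the initial value of the energy estimate: after the normalisation by
  \<open>fact n\<close> the Hermite functions are bounded at the origin uniformly in
  \<open>n\<close>.\<close>

lemma hermite_rec_zero_le: "(hermite_rec n 0)\<^sup>2 \<le> fact n"
proof (induction n rule: induct_nat_012)
  case (ge2 n)
  have "(hermite_rec (Suc (Suc n)) 0)\<^sup>2 = (real (Suc n))\<^sup>2 * (hermite_rec n 0)\<^sup>2"
    by (simp add: power_mult_distrib)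
  also have "\<dots> \<le> (real (Suc n))\<^sup>2 * fact n" by (intro mult_left_mono ge2) auto
  also have "\<dots> \<le> real (Suc n) * real (Suc (Suc n)) * fact n"
    unfolding power2_eq_square by (intro mult_right_mono mult_left_mono) auto
  also have "\<dots> = fact (Suc (Suc n))" by (simp add: algebra_simps)
  finally show ?case .
qed auto

text \<open>The \<open>m\<close>-th derivative of \<open>hermite_fun k\<close> for \<open>m \<le> 2\<close>; the second one is read off from the
  differential equation of the harmonic oscillator.\<close>

definition hermite_der :: "nat \<Rightarrow> nat \<Rightarrow> real \<Rightarrow> real" where
  "hermite_der m k x = (if m = 0 then hermite_fun k x
     else if m = 1 then (sqrt 2 * real (k - 1) * hermite_rec (k - 1 - 1) (sqrt 2 * x) - x * hermite_rec (k - 1) (sqrt 2 * x))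
       * exp (- (x\<^sup>2 / 2)) / sqrt (sqrt pi * fact (k - 1))
     else (x\<^sup>2 - (2 * real (k - 1) + 1)) * hermite_fun k x)"

lemma DERIV_hermite_fun: "(hermite_der 0 k has_real_derivative hermite_der 1 k x) (at x)"
proof -
  define n where "n = k - 1"
  define N where "N = sqrt (sqrt pi * fact n)"
  have e: "((\<lambda>t::real. exp (- (t\<^sup>2 / 2))) has_real_derivative exp (- (x\<^sup>2 / 2)) * (- x)) (at x)"
    by (auto intro!: derivative_eq_intros)
  have s: "((\<lambda>t. sqrt 2 * t) has_real_derivative sqrt 2) (at x)" by (auto intro!: derivative_eq_intros)
  have "((\<lambda>t. hermite_rec n (sqrt 2 * t) * exp (- (t\<^sup>2 / 2)) / N) has_real_derivative
    (real n * hermite_rec (n - 1) (sqrt 2 * x) * sqrt 2 * exp (- (x\<^sup>2 / 2)) + exp (- (x\<^sup>2 / 2)) * (- x) * hermite_rec n (sqrt 2 * x)) / N) (at x)"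
    by (intro DERIV_cdivide DERIV_mult DERIV_chain2[OF DERIV_hermite_rec s] e)
  then show ?thesis
    unfolding hermite_der_def[abs_def] hermite_fun_def[abs_def] hermite_poly_eq n_def[symmetric] N_def[symmetric]
    by (simp add: algebra_simps)
qed

lemma DERIV_hermite_der: "(hermite_der 1 k has_real_derivative hermite_der 2 k x) (at x)"
proof -
  define n where "n = k - 1"
  define N where "N = sqrt (sqrt pi * fact n)"
  let ?H = "\<lambda>j. hermite_rec j (sqrt 2 * x)" and ?e = "exp (- (x\<^sup>2 / 2))"
  have e: "((\<lambda>t::real. exp (- (t\<^sup>2 / 2))) has_real_derivative ?e * (- x)) (at x)"
    by (auto intro!: derivative_eq_intros)
  have s: "((\<lambda>t. sqrt 2 * t) has_real_derivative sqrt 2) (at x)" by (auto intro!: derivative_eq_intros)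
  have d: "((\<lambda>t. (sqrt 2 * real n * hermite_rec (n - 1) (sqrt 2 * t) - t * hermite_rec n (sqrt 2 * t)) * exp (- (t\<^sup>2 / 2)) / N) has_real_derivative
     ((sqrt 2 * real n * (real (n - 1) * ?H (n - 1 - 1) * sqrt 2) - (1 * ?H n + real n * ?H (n - 1) * sqrt 2 * x)) * ?e
       + ?e * (- x) * (sqrt 2 * real n * ?H (n - 1) - x * ?H n)) / N) (at x)"
    by (intro DERIV_cdivide DERIV_mult DERIV_diff DERIV_cmult DERIV_ident DERIV_chain2[OF DERIV_hermite_rec s] e)
  \<comment> \<open>The recurrence one level below eliminates the polynomial with index
    \<open>n - 2\<close>; what remains is the oscillator equation.\<close>
  have rec: "real n * (real (n - 1) * ?H (n - 1 - 1)) = real n * (sqrt 2 * x * ?H (n - 1) - ?H n)"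
    using hermite_rec_Suc[of "n - 1" "sqrt 2 * x"] by (cases n) auto
  have "sqrt 2 * real n * (real (n - 1) * ?H (n - 1 - 1) * sqrt 2) = (sqrt 2 * sqrt 2) * (real n * (real (n - 1) * ?H (n - 1 - 1)))"
    by (simp only: mult_ac)
  also have "\<dots> = 2 * (real n * (sqrt 2 * x * ?H (n - 1) - ?H n))" unfolding rec by simp
  finally have Q: "sqrt 2 * real n * (real (n - 1) * ?H (n - 1 - 1) * sqrt 2) = 2 * (real n * (sqrt 2 * x * ?H (n - 1) - ?H n))" .
  have Deq: "((sqrt 2 * real n * (real (n - 1) * ?H (n - 1 - 1) * sqrt 2) - (1 * ?H n + real n * ?H (n - 1) * sqrt 2 * x)) * ?e
       + ?e * (- x) * (sqrt 2 * real n * ?H (n - 1) - x * ?H n)) / N = (x\<^sup>2 - (2 * real n + 1)) * (?H n * ?e / N)"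
    unfolding Q by (simp add: algebra_simps power2_eq_square diff_divide_distrib add_divide_distrib)
  show ?thesis
    using d[unfolded Deq] unfolding hermite_der_def[abs_def] hermite_fun_def[abs_def] hermite_poly_eq n_def[symmetric] N_def[symmetric]
    by simp
qed

text \<open>The oscillator energy \<open>\<xi>'\<^sup>2 + (2 n + 1) \<xi>\<^sup>2\<close> satisfies a Gronwall inequality with a rate that
  does not depend on \<open>n\<close>.\<close>

lemma hermite_energy:
  assumes x: "\<bar>x\<bar> \<le> R"
  shows "(hermite_der 1 k x)\<^sup>2 + (2 * real (k - 1) + 1) * (hermite_fun k x)\<^sup>2
     \<le> 2 * (2 * real (k - 1) + 1) * exp (R\<^sup>2 * R)"
proof -
  define n where "n = k - 1"
  define a where "a = 2 * real n + 1"
  have a: "a \<ge> 1" by (simp add: a_def)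
  define E where "E t = (hermite_der 1 k t)\<^sup>2 + a * (hermite_der 0 k t)\<^sup>2" for t
  \<comment> \<open>By the oscillator equation the two terms with the factor \<open>a\<close> cancel
    in the derivative of the energy, so its growth rate is free of \<open>n\<close>.\<close>
  define E' where "E' t = 2 * t\<^sup>2 * hermite_der 0 k t * hermite_der 1 k t" for t
  have R: "R \<ge> 0" using x by simp
  have dE: "(E has_real_derivative E' t) (at t)" for t
  proof -
    have "(E has_real_derivative real 2 * (hermite_der 2 k t * hermite_der 1 k t ^ (2 - Suc 0)) +
        a * (real 2 * (hermite_der 1 k t * hermite_der 0 k t ^ (2 - Suc 0)))) (at t)"
      unfolding E_def[abs_def]
      by (intro DERIV_add DERIV_cmult DERIV_power DERIV_hermite_fun DERIV_hermite_der)
    moreover have "real 2 * (hermite_der 2 k t * hermite_der 1 k t ^ (2 - Suc 0)) +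
        a * (real 2 * (hermite_der 1 k t * hermite_der 0 k t ^ (2 - Suc 0))) = E' t"
    proof -
      have "hermite_der 2 k t = (t\<^sup>2 - a) * hermite_der 0 k t"
        by (simp add: hermite_der_def a_def n_def)
      note eq = this
      show ?thesis unfolding eq by (simp add: E'_def algebra_simps)
    qed
    ultimately show ?thesis by simp
  qed
  have E0: "E t \<ge> 0" for t using a by (auto simp: E_def)
  have gr: "\<bar>E' t\<bar> \<le> R\<^sup>2 * E t" if "\<bar>t\<bar> \<le> R" for t
  proof -
    have t2: "t\<^sup>2 \<le> R\<^sup>2" using power_mono[OF that, of 2] by simp
    have "2 * \<bar>hermite_der 0 k t\<bar> * \<bar>hermite_der 1 k t\<bar> \<le> (hermite_der 0 k t)\<^sup>2 + (hermite_der 1 k t)\<^sup>2"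
      using sum_squares_bound[of "\<bar>hermite_der 0 k t\<bar>" "\<bar>hermite_der 1 k t\<bar>"] by simp
    also have "\<dots> \<le> E t" using mult_right_mono[OF a, of "(hermite_der 0 k t)\<^sup>2"] by (simp add: E_def)
    finally have "t\<^sup>2 * (2 * \<bar>hermite_der 0 k t\<bar> * \<bar>hermite_der 1 k t\<bar>) \<le> R\<^sup>2 * E t"
      using t2 by (intro mult_mono) auto
    then show ?thesis by (simp add: E'_def abs_mult mult_ac)
  qed
  \<comment> \<open>At the origin \<open>\<xi>\<^sup>2 \<le> 1\<close> and
    \<open>\<xi>'\<^sup>2 \<le> 2 n\<close>, so the energy is at most
    \<open>2 n + a\<close>.\<close>
  have start: "E 0 \<le> 2 * a"
  proof -
    have pi1: "1 \<le> sqrt pi" using pi_ge_two by simp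
    have f: "fact n > (0::real)" by simp
    have N: "(sqrt (sqrt pi * fact n))\<^sup>2 = sqrt pi * fact n" by simp
    have N1: "fact n \<le> sqrt pi * fact n" using mult_right_mono[OF pi1, of "fact n"] by simp
    have "(hermite_der 0 k 0)\<^sup>2 = (hermite_rec n 0)\<^sup>2 / (sqrt pi * fact n)"
      unfolding hermite_der_def hermite_fun_def hermite_poly_eq n_def[symmetric] by (simp add: power_divide)
    also have "\<dots> \<le> fact n / fact n"
      using hermite_rec_zero_le[of n] N1 by (intro frac_le) auto
    finally have h0: "(hermite_der 0 k 0)\<^sup>2 \<le> 1" by simp
    have "(hermite_der 1 k 0)\<^sup>2 = 2 * (real n)\<^sup>2 * (hermite_rec (n - 1) 0)\<^sup>2 / (sqrt pi * fact n)"
      unfolding hermite_der_def n_def[symmetric] by (simp add: power_divide power_mult_distrib)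
    also have "\<dots> \<le> 2 * (real n)\<^sup>2 * fact (n - 1) / fact n"
      using hermite_rec_zero_le[of "n - 1"] N1 by (intro frac_le mult_left_mono) auto
    also have "\<dots> = 2 * real n"
      by (cases "n = 0") (simp_all add: fact_reduce power2_eq_square)
    finally have "(hermite_der 1 k 0)\<^sup>2 \<le> 2 * real n" .
    moreover have "a * (hermite_der 0 k 0)\<^sup>2 \<le> a * 1" using h0 a by (intro mult_left_mono) auto
    ultimately have "E 0 \<le> 2 * real n + a" unfolding E_def by linarith
    then show ?thesis by (simp add: a_def)
  qed
  have "E x \<le> E 0 * exp (R\<^sup>2 * \<bar>x\<bar>)"
  proof (cases "x \<ge> 0")
    case True
    have "E x * exp (- (R\<^sup>2 * x)) \<le> E 0 * exp (- (R\<^sup>2 * 0))"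
    proof (rule DERIV_nonpos_imp_nonincreasing[OF True])
      fix t assume t: "0 \<le> t" "t \<le> x"
      have "((\<lambda>t. E t * exp (- (R\<^sup>2 * t))) has_real_derivative E' t * exp (- (R\<^sup>2 * t)) + exp (- (R\<^sup>2 * t)) * (- R\<^sup>2) * E t) (at t)"
        by (intro DERIV_mult dE) (auto intro!: derivative_eq_intros)
      moreover have "E' t * exp (- (R\<^sup>2 * t)) + exp (- (R\<^sup>2 * t)) * (- R\<^sup>2) * E t = exp (- (R\<^sup>2 * t)) * (E' t - R\<^sup>2 * E t)"
        by (simp add: algebra_simps)
      moreover have "E' t - R\<^sup>2 * E t \<le> 0" using gr[of t] t x by linarith
      ultimately show "\<exists>y. ((\<lambda>t. E t * exp (- (R\<^sup>2 * t))) has_real_derivative y) (at t) \<and> y \<le> 0"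
        by (metis exp_ge_zero mult_nonneg_nonpos)
    qed
    then show ?thesis using True by (simp add: exp_minus field_simps)
  next
    case False
    then have x0: "x \<le> 0" by simp
    have "E x * exp (R\<^sup>2 * x) \<le> E 0 * exp (R\<^sup>2 * 0)"
    proof (rule DERIV_nonneg_imp_nondecreasing[OF x0])
      fix t assume t: "x \<le> t" "t \<le> 0"
      have "((\<lambda>t. E t * exp (R\<^sup>2 * t)) has_real_derivative E' t * exp (R\<^sup>2 * t) + exp (R\<^sup>2 * t) * R\<^sup>2 * E t) (at t)"
        by (intro DERIV_mult dE) (auto intro!: derivative_eq_intros)
      moreover have "E' t * exp (R\<^sup>2 * t) + exp (R\<^sup>2 * t) * R\<^sup>2 * E t = exp (R\<^sup>2 * t) * (E' t + R\<^sup>2 * E t)"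
        by (simp add: algebra_simps)
      moreover have "E' t + R\<^sup>2 * E t \<ge> 0" using gr[of t] t x by linarith
      ultimately show "\<exists>y. ((\<lambda>t. E t * exp (R\<^sup>2 * t)) has_real_derivative y) (at t) \<and> y \<ge> 0"
        by (metis exp_ge_zero mult_nonneg_nonneg)
    qed
    then show ?thesis using x0 by (simp add: exp_minus field_simps)
  qed
  also have "\<dots> \<le> (2 * a) * exp (R\<^sup>2 * R)"
    using start x a E0[of 0] by (intro mult_mono) (auto intro!: mult_left_mono)
  finally show ?thesis by (simp add: E_def a_def n_def hermite_der_def)
qed

text \<open>By the energy bound the first derivative costs a factor \<open>sqrt (2 n + 1)\<close>
  with \<open>n = k - 1\<close>; the second one costs its square, by the oscillator equation. The
  constant is common to all \<open>k\<close>.\<close>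

lemma hermite_der_bound:
  assumes R: "R \<ge> 0"
  obtains C where "C \<ge> 1" "\<And>m k x. m \<le> 2 \<Longrightarrow> \<bar>x\<bar> \<le> R \<Longrightarrow> \<bar>hermite_der m k x\<bar> \<le> C * sqrt (2 * real (k - 1) + 1) ^ m"
proof -
  define B where "B = 2 * exp (R\<^sup>2 * R)"
  have B: "B \<ge> 1" using R by (simp add: B_def mult_le_one order_trans[of 1 "exp (R\<^sup>2 * R)"])
  define C where "C = (R\<^sup>2 + 1) * B"
  have BC: "B \<le> C" using mult_right_mono[of 1 "R\<^sup>2 + 1" B] B by (simp add: C_def)
  have main: "\<bar>hermite_der m k x\<bar> \<le> C * sqrt (2 * real (k - 1) + 1) ^ m" if m: "m \<le> 2" and x: "\<bar>x\<bar> \<le> R" for m k x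
  proof -
    define a where "a = 2 * real (k - 1) + 1"
    have a: "a \<ge> 1" by (simp add: a_def)
    have en: "(hermite_der 1 k x)\<^sup>2 + a * (hermite_fun k x)\<^sup>2 \<le> a * B"
      using hermite_energy[OF x, of k] by (simp only: a_def B_def mult_ac)
    have BB: "B \<le> B\<^sup>2" using mult_right_mono[OF B, of B] B by (simp add: power2_eq_square)
    have "a * (hermite_fun k x)\<^sup>2 \<le> a * B" using en zero_le_power2[of "hermite_der 1 k x"] by linarith
    then have "(hermite_fun k x)\<^sup>2 \<le> B\<^sup>2" using a BB by simp
    then have h0: "\<bar>hermite_fun k x\<bar> \<le> B" using B by (simp add: abs_le_square_iff[symmetric])
    have "0 \<le> a * (hermite_fun k x)\<^sup>2" using a by simp
    then have "(hermite_der 1 k x)\<^sup>2 \<le> a * B" using en by linarith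
    also have "\<dots> \<le> a * B\<^sup>2" using a BB by simp
    also have "\<dots> = (B * sqrt a)\<^sup>2" using a by (simp add: power_mult_distrib)
    finally have h1: "\<bar>hermite_der 1 k x\<bar> \<le> B * sqrt a"
      using B a by (simp add: abs_le_square_iff[symmetric])
    have x2: "x\<^sup>2 \<le> R\<^sup>2" using power_mono[OF x, of 2] by simp
    have "\<bar>x\<^sup>2 - a\<bar> \<le> (R\<^sup>2 + 1) * a"
    proof -
      have "R\<^sup>2 \<le> R\<^sup>2 * a" using mult_left_mono[OF a, of "R\<^sup>2"] by simp
      then have "R\<^sup>2 + a \<le> (R\<^sup>2 + 1) * a" by (simp add: algebra_simps)
      then show ?thesis using x2 a zero_le_power2[of x] by linarith
    qed
    then have "\<bar>x\<^sup>2 - a\<bar> * \<bar>hermite_fun k x\<bar> \<le> ((R\<^sup>2 + 1) * a) * B"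
      using h0 a by (intro mult_mono) auto
    then have h2: "\<bar>hermite_der 2 k x\<bar> \<le> C * a"
      by (simp add: hermite_der_def a_def C_def abs_mult mult_ac)
    consider "m = 0" | "m = 1" | "m = 2" using m by linarith
    then show ?thesis unfolding a_def[symmetric]
    proof cases
      case 1
      then show "\<bar>hermite_der m k x\<bar> \<le> C * sqrt a ^ m" using h0 BC by (simp add: hermite_der_def)
    next
      case 2
      have "B * sqrt a \<le> C * sqrt a" using BC a by (intro mult_right_mono) auto
      then show "\<bar>hermite_der m k x\<bar> \<le> C * sqrt a ^ m" using 2 h1 by simp
    next
      case 3
      then show "\<bar>hermite_der m k x\<bar> \<le> C * sqrt a ^ m" using h2 a by simp
    qed
  qed
  show thesis by (rule that[of C]) (use B BC main in auto)
qed

section \<open>Tensor products of Hermite functions\<close>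

lemma has_partial_real_prod:
  fixes f :: "'n::finite \<Rightarrow> real \<Rightarrow> real"
  assumes "\<And>s. (f j has_real_derivative f' s) (at s)"
  shows "has_partial_real UNIV j (\<lambda>x. \<Prod>l\<in>UNIV. f l (x $ l)) (\<lambda>x. \<Prod>l\<in>UNIV. (if l = j then f' else f l) (x $ l))"
  unfolding has_partial_real_def
proof
  fix x :: "real ^ 'n"
  let ?P = "\<Prod>l\<in>UNIV - {j}. f l (x $ l)"
  have 1: "(\<lambda>t. \<Prod>l\<in>UNIV. f l ((x + t *\<^sub>R axis j 1) $ l)) = (\<lambda>t. f j (x $ j + t) * ?P)"
  proof
    fix t
    have "(\<Prod>l\<in>UNIV. f l ((x + t *\<^sub>R axis j 1) $ l)) =
        f j ((x + t *\<^sub>R axis j 1) $ j) * (\<Prod>l\<in>UNIV - {j}. f l ((x + t *\<^sub>R axis j 1) $ l))"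
      by (rule prod.remove) auto
    moreover have "(\<Prod>l\<in>UNIV - {j}. f l ((x + t *\<^sub>R axis j 1) $ l)) = ?P"
      by (rule prod.cong) (auto simp: axis_def)
    ultimately show "(\<Prod>l\<in>UNIV. f l ((x + t *\<^sub>R axis j 1) $ l)) = f j (x $ j + t) * ?P"
      by (simp add: axis_def)
  qed
  have "(\<Prod>l\<in>UNIV. (if l = j then f' else f l) (x $ l)) =
      f' (x $ j) * (\<Prod>l\<in>UNIV - {j}. (if l = j then f' else f l) (x $ l))"
    by (subst prod.remove[of UNIV j]) auto
  moreover have "(\<Prod>l\<in>UNIV - {j}. (if l = j then f' else f l) (x $ l)) = ?P"
    by (rule prod.cong) auto
  ultimately have 2: "(\<Prod>l\<in>UNIV. (if l = j then f' else f l) (x $ l)) = f' (x $ j) * ?P" by simp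
  have "((\<lambda>t. f j (x $ j + t)) has_real_derivative f' (x $ j + 0) * 1) (at 0)"
    by (rule DERIV_chain2[OF assms]) (auto intro!: derivative_eq_intros)
  then show "((\<lambda>t. \<Prod>l\<in>UNIV. f l ((x + t *\<^sub>R axis j 1) $ l)) has_real_derivative
      (\<Prod>l\<in>UNIV. (if l = j then f' else f l) (x $ l))) (at 0)"
    unfolding 1 2 by (intro DERIV_cmult_right) simp
qed

text \<open>\<open>\<Lambda>\<close> is the sum of the one-dimensional eigenvalues
  \<open>2 n + 1\<close>. A derivative in one direction thus costs at most
  \<open>sqrt \<Lambda>\<close>, and a second derivative, pure or mixed, at most \<Lambda>. The
  constant is a power of the one-dimensional one, hence common to all \<open>h\<close> and
  \<open>k\<close>.\<close>

lemma zeta_basis_C2: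
  fixes h :: "nat ^ 'n \<Rightarrow> nat"
  assumes R: "R \<ge> 0"
  obtains C where "C \<ge> 0" "\<And>h k. \<exists>v w \<Lambda>. \<Lambda> \<ge> 1 \<and> C2_real UNIV (zeta_basis h k) v w \<and>
     (\<forall>x :: real ^ 'n. (\<Sum>i\<in>UNIV. w i i x) = ((norm x)\<^sup>2 - \<Lambda>) * zeta_basis h k x) \<and>
     (\<forall>x\<in>cball 0 R. \<bar>zeta_basis h k x\<bar> \<le> C \<and> (\<forall>i. \<bar>v i x\<bar> \<le> C * \<Lambda> \<and> (\<forall>j. \<bar>w i j x\<bar> \<le> C * \<Lambda>)))"
proof -
  obtain C0 where C0: "C0 \<ge> 1" "\<And>m k x. m \<le> 2 \<Longrightarrow> \<bar>x\<bar> \<le> R \<Longrightarrow> \<bar>hermite_der m k x\<bar> \<le> C0 * sqrt (2 * real (k - 1) + 1) ^ m"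
    by (rule hermite_der_bound[OF R]) blast
  define C where "C = C0 ^ CARD('n)"
  have main: "\<exists>v w \<Lambda>. \<Lambda> \<ge> 1 \<and> C2_real UNIV (zeta_basis h k) v w \<and>
     (\<forall>x :: real ^ 'n. (\<Sum>i\<in>UNIV. w i i x) = ((norm x)\<^sup>2 - \<Lambda>) * zeta_basis h k x) \<and>
     (\<forall>x\<in>cball 0 R. \<bar>zeta_basis h k x\<bar> \<le> C \<and> (\<forall>i. \<bar>v i x\<bar> \<le> C * \<Lambda> \<and> (\<forall>j. \<bar>w i j x\<bar> \<le> C * \<Lambda>)))" for h k
  proof -
    define q where "q l = inv_into pos_tuples h k $ l" for l :: 'n
    define a where "a l = 2 * real (q l - 1) + 1" for l
    define \<Lambda> where "\<Lambda> = (\<Sum>l\<in>UNIV. a l)"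
    have a1: "a l \<ge> 1" for l by (simp add: a_def)
    have a_le: "a l \<le> \<Lambda>" for l
      unfolding \<Lambda>_def by (rule member_le_sum) (use a1 in \<open>auto intro: order_trans[of 0 1]\<close>)
    have \<Lambda>1: "\<Lambda> \<ge> 1" using a1 a_le order_trans by blast
    \<comment> \<open>\<open>m l\<close> is the order of differentiation in the coordinate
      \<open>l\<close>: a second derivative has order 2 in one coordinate or order 1 in two of
      them.\<close>
    define T where "T m x = (\<Prod>l\<in>UNIV. hermite_der (m l) (q l) (x $ l))" for m and x :: "real ^ 'n"
    let ?v = "\<lambda>i. T (\<lambda>l. if l = i then 1 else 0)"
    let ?w = "\<lambda>i j. T (\<lambda>l. if l = i then if l = j then 2 else 1 else if l = j then 1 else 0)"
    have z: "zeta_basis h k = T (\<lambda>_. 0)"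
      by (simp add: zeta_basis_def T_def q_def hermite_der_def fun_eq_iff)
    have cont: "continuous_on UNIV (T m)" if m2: "\<And>l. m l \<le> 2" for m
    proof -
      have ch: "continuous_on UNIV (hermite_der r n)" if "r \<le> 2" for r n
      proof -
        have c: "continuous_on UNIV (hermite_der 0 n)" "continuous_on UNIV (hermite_der 1 n)"
          using DERIV_hermite_fun DERIV_hermite_der by (auto intro!: continuous_at_imp_continuous_on DERIV_isCont)
        have "hermite_der 2 n = (\<lambda>x. (x\<^sup>2 - (2 * real (n - 1) + 1)) * hermite_der 0 n x)"
          by (auto simp: hermite_der_def)
        then have "continuous_on UNIV (hermite_der 2 n)" using c by (auto intro!: continuous_intros)
        moreover have "r = 0 \<or> r = 1 \<or> r = 2" using that by linarith
        ultimately show ?thesis using c by auto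
      qed
      show ?thesis unfolding T_def
      proof (rule continuous_on_prod)
        show "continuous_on UNIV (\<lambda>x. hermite_der (m l) (q l) (x $ l))" for l
          by (rule continuous_on_compose2[OF ch[OF m2]]) (auto intro!: continuous_intros)
      qed
    qed
    have p1: "has_partial_real UNIV i (T (\<lambda>_. 0)) (?v i)" for i
    proof -
      have "?v i = (\<lambda>x. \<Prod>l\<in>UNIV. (if l = i then hermite_der 1 (q i) else hermite_der 0 (q l)) (x $ l))"
        unfolding T_def by (intro ext prod.cong) auto
      then show ?thesis
        unfolding T_def[of "\<lambda>_. 0", abs_def]
        using has_partial_real_prod[of "\<lambda>l. hermite_der 0 (q l)" i "hermite_der 1 (q i)"] DERIV_hermite_fun by simp
    qed
    have p2: "has_partial_real UNIV j (?v i) (?w i j)" for i j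
    proof -
      let ?f = "\<lambda>l. hermite_der (if l = i then 1 else 0) (q l)"
      let ?f' = "hermite_der (if j = i then 2 else 1) (q j)"
      have "(?f j has_real_derivative ?f' s) (at s)" for s
        using DERIV_hermite_fun DERIV_hermite_der by auto
      from has_partial_real_prod[of ?f j ?f', OF this]
      have "has_partial_real UNIV j (\<lambda>x. \<Prod>l\<in>UNIV. ?f l (x $ l)) (\<lambda>x. \<Prod>l\<in>UNIV. (if l = j then ?f' else ?f l) (x $ l))" .
      moreover have "(\<lambda>x. \<Prod>l\<in>UNIV. (if l = j then ?f' else ?f l) (x $ l)) = ?w i j"
        unfolding T_def by (intro ext prod.cong) auto
      ultimately show ?thesis unfolding T_def by simp
    qed
    have C2: "C2_real UNIV (zeta_basis h k) ?v ?w"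
      unfolding C2_real_def z by (intro conjI allI p1 p2 cont) auto
    have lap: "(\<Sum>i\<in>UNIV. ?w i i x) = ((norm x)\<^sup>2 - \<Lambda>) * zeta_basis h k x" for x
    proof -
      have "?w i i x = ((x $ i)\<^sup>2 - a i) * T (\<lambda>_. 0) x" for i
      proof -
        have "?w i i x = hermite_der 2 (q i) (x $ i) * (\<Prod>l\<in>UNIV - {i}. hermite_der 0 (q l) (x $ l))"
          unfolding T_def by (subst prod.remove[of UNIV i]) (auto intro!: prod.cong)
        moreover have "T (\<lambda>_. 0) x = hermite_der 0 (q i) (x $ i) * (\<Prod>l\<in>UNIV - {i}. hermite_der 0 (q l) (x $ l))"
          unfolding T_def by (subst prod.remove[of UNIV i]) auto
        moreover have "hermite_der 2 (q i) (x $ i) = ((x $ i)\<^sup>2 - a i) * hermite_der 0 (q i) (x $ i)"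
          by (simp add: hermite_der_def a_def)
        ultimately show ?thesis by simp
      qed
      then have "(\<Sum>i\<in>UNIV. ?w i i x) = (\<Sum>i\<in>UNIV. ((x $ i)\<^sup>2 - a i)) * T (\<lambda>_. 0) x"
        by (simp add: sum_distrib_right)
      moreover have "(norm x)\<^sup>2 = (\<Sum>i\<in>UNIV. (x $ i)\<^sup>2)"
        unfolding power2_norm_eq_inner inner_vec_def by (simp add: power2_eq_square)
      ultimately show ?thesis by (simp add: z \<Lambda>_def sum_subtractf)
    qed
    have bnd: "\<bar>T m x\<bar> \<le> C * (\<Prod>l\<in>UNIV. sqrt (a l) ^ m l)" if "\<And>l. m l \<le> 2" "x \<in> cball 0 R" for m x
    proof -
      have "\<bar>x $ l\<bar> \<le> R" for l using that(2) component_le_norm_cart[of x l] by simp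
      then have "\<bar>T m x\<bar> \<le> (\<Prod>l\<in>UNIV. C0 * sqrt (a l) ^ m l)"
        unfolding T_def abs_prod a_def using C0(2) that(1) by (intro prod_mono) auto
      also have "\<dots> = C * (\<Prod>l\<in>UNIV. sqrt (a l) ^ m l)"
        by (simp add: prod.distrib C_def)
      finally show ?thesis .
    qed
    have C0': "C \<ge> 0" using C0(1) by (simp add: C_def)
    have s\<Lambda>: "sqrt (a l) \<le> sqrt \<Lambda>" "0 \<le> sqrt (a l)" "sqrt \<Lambda> \<le> \<Lambda>" "sqrt \<Lambda> * sqrt \<Lambda> = \<Lambda>" for l
    proof -
      show "sqrt (a l) \<le> sqrt \<Lambda>" using a_le by simp
      show "0 \<le> sqrt (a l)" using a1[of l] by simp
      show 1: "sqrt \<Lambda> * sqrt \<Lambda> = \<Lambda>" using \<Lambda>1 by simp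
      have "1 \<le> sqrt \<Lambda>" using \<Lambda>1 by simp
      then have "sqrt \<Lambda> * 1 \<le> sqrt \<Lambda> * sqrt \<Lambda>" by (intro mult_left_mono) auto
      then show "sqrt \<Lambda> \<le> \<Lambda>" using 1 by simp
    qed
    have pv: "(\<Prod>l\<in>UNIV. sqrt (a l) ^ (if l = i then 1 else 0)) \<le> \<Lambda>" for i
    proof -
      have "(\<Prod>l\<in>UNIV. sqrt (a l) ^ (if l = i then 1 else 0)) = (\<Prod>l\<in>UNIV. if l = i then sqrt (a l) else 1)"
        by (intro prod.cong) auto
      also have "\<dots> = sqrt (a i)" by (simp add: prod.delta)
      finally show ?thesis using s\<Lambda> order_trans by metis
    qed
    have pw: "(\<Prod>l\<in>UNIV. sqrt (a l) ^ (if l = i then if l = j then 2 else 1 else if l = j then 1 else 0)) \<le> \<Lambda>" for i j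
    proof -
      have "(\<Prod>l\<in>UNIV. sqrt (a l) ^ (if l = i then if l = j then 2 else 1 else if l = j then 1 else 0)) =
          (\<Prod>l\<in>UNIV. (if l = i then sqrt (a l) else 1) * (if l = j then sqrt (a l) else 1))"
        by (intro prod.cong) (auto simp: power2_eq_square)
      also have "\<dots> = sqrt (a i) * sqrt (a j)" by (simp add: prod.distrib prod.delta)
      also have "\<dots> \<le> sqrt \<Lambda> * sqrt \<Lambda>" using s\<Lambda> \<Lambda>1 by (intro mult_mono) auto
      finally show ?thesis using s\<Lambda> by simp
    qed
    show ?thesis
    proof (intro exI conjI ballI allI)
      show "\<Lambda> \<ge> 1" by (rule \<Lambda>1)
      show "C2_real UNIV (zeta_basis h k) ?v ?w" by (rule C2)
      show "(\<Sum>i\<in>UNIV. ?w i i x) = ((norm x)\<^sup>2 - \<Lambda>) * zeta_basis h k x" for x by (rule lap)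
      fix x :: "real ^ 'n" assume x: "x \<in> cball 0 R"
      show "\<bar>zeta_basis h k x\<bar> \<le> C" using bnd[of "\<lambda>_. 0", OF _ x] by (simp add: z)
      fix i
      show "\<bar>?v i x\<bar> \<le> C * \<Lambda>"
        by (rule order_trans[OF bnd[OF _ x] mult_left_mono[OF pv C0']]) simp
      fix j
      show "\<bar>?w i j x\<bar> \<le> C * \<Lambda>"
        by (rule order_trans[OF bnd[OF _ x] mult_left_mono[OF pw C0']]) simp
    qed
  qed
  show thesis by (rule that[of C]) (use C0 main in \<open>auto simp: C_def\<close>)
qed

section \<open>The Poisson equation for the basis functions\<close>

text \<open>\<open>S\<close> is the third difference of \<open>max 0 s ^ 3 / 6\<close>, that is, the
  integral of a quadratic B-spline: a C^2 step from 0 to 1 over the interval from \<open>A\<close>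
  to \<open>A + 3\<close>. The function sought is \<open>s * (1 - S s)\<close>.\<close>

lemma square_cutoff_real:
  fixes A :: real
  obtains b b' b'' :: "real \<Rightarrow> real"
  where "\<And>s. (b has_real_derivative b' s) (at s)" "\<And>s. (b' has_real_derivative b'' s) (at s)"
    "continuous_on UNIV b''" "\<And>s. s \<le> A \<Longrightarrow> b s = s"
    "\<And>s. s \<ge> A + 3 \<Longrightarrow> b s = 0 \<and> b' s = 0 \<and> b'' s = 0"
proof -
  let ?p = "\<lambda>c n s. max 0 (s - (A + c)) ^ n :: real"
  define S where "S s = (?p 0 3 s - 3 * ?p 1 3 s + 3 * ?p 2 3 s - ?p 3 3 s) / 6" for s
  define S' where "S' s = (?p 0 2 s - 3 * ?p 1 2 s + 3 * ?p 2 2 s - ?p 3 2 s) / 2" for s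
  define S'' where "S'' s = ?p 0 1 s - 3 * ?p 1 1 s + 3 * ?p 2 1 s - ?p 3 1 s" for s
  have 1: "(S has_real_derivative S' s) (at s)" for s
  proof -
    note d = DERIV_pos_part_shift[of 3 _ s]
    have "(S has_real_derivative (real 3 * ?p 0 (3 - 1) s - 3 * (real 3 * ?p 1 (3 - 1) s) + 3 * (real 3 * ?p 2 (3 - 1) s) - real 3 * ?p 3 (3 - 1) s) / 6) (at s)"
      unfolding S_def[abs_def] by (intro DERIV_cdivide DERIV_add DERIV_diff DERIV_cmult d) auto
    moreover have "(real 3 * ?p 0 (3 - 1) s - 3 * (real 3 * ?p 1 (3 - 1) s) + 3 * (real 3 * ?p 2 (3 - 1) s) - real 3 * ?p 3 (3 - 1) s) / 6 = S' s"
      by (simp add: S'_def)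
    ultimately show ?thesis by simp
  qed
  have 2: "(S' has_real_derivative S'' s) (at s)" for s
  proof -
    note d = DERIV_pos_part_shift[of 2 _ s]
    have "(S' has_real_derivative (real 2 * ?p 0 (2 - 1) s - 3 * (real 2 * ?p 1 (2 - 1) s) + 3 * (real 2 * ?p 2 (2 - 1) s) - real 2 * ?p 3 (2 - 1) s) / 2) (at s)"
      unfolding S'_def[abs_def] by (intro DERIV_cdivide DERIV_add DERIV_diff DERIV_cmult d) auto
    moreover have "(real 2 * ?p 0 (2 - 1) s - 3 * (real 2 * ?p 1 (2 - 1) s) + 3 * (real 2 * ?p 2 (2 - 1) s) - real 2 * ?p 3 (2 - 1) s) / 2 = S'' s"
      by (simp add: S''_def)
    ultimately show ?thesis by simp
  qed
  have large: "S s = 1" "S' s = 0" "S'' s = 0" if "s \<ge> A + 3" for s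
  proof -
    define t where "t = s - (A + 3)"
    have t0: "max 0 (s - (A + 0)) = t + 3" "max 0 (s - (A + 1)) = t + 2" "max 0 (s - (A + 2)) = t + 1" "max 0 (s - (A + 3)) = t"
      using that by (auto simp: t_def max_def)
    have t: "?p 0 n s = (t + 3) ^ n" "?p 1 n s = (t + 2) ^ n" "?p 2 n s = (t + 1) ^ n" "?p 3 n s = t ^ n" for n
      unfolding t0 by simp_all
    show "S s = 1" unfolding S_def t by (simp add: power3_eq_cube algebra_simps)
    show "S' s = 0" unfolding S'_def t by (simp add: power2_eq_square algebra_simps)
    show "S'' s = 0" unfolding S''_def t by (simp add: algebra_simps)
  qed
  have small: "S s = 0" if "s \<le> A" for s using that by (simp add: S_def)
  show thesis
  proof (rule that[of "\<lambda>s. s * (1 - S s)" "\<lambda>s. (1 - S s) - s * S' s" "\<lambda>s. - (2 * S' s) - s * S'' s"])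
    fix s
    have "((\<lambda>s. s * (1 - S s)) has_real_derivative 1 * (1 - S s) + (0 - S' s) * s) (at s)"
      by (intro DERIV_mult DERIV_ident DERIV_diff DERIV_const 1)
    then show "((\<lambda>s. s * (1 - S s)) has_real_derivative (1 - S s) - s * S' s) (at s)" by (simp add: algebra_simps)
    have "((\<lambda>s. (1 - S s) - s * S' s) has_real_derivative (0 - S' s) - (1 * S' s + S'' s * s)) (at s)"
      by (intro DERIV_mult DERIV_ident DERIV_diff DERIV_const 1 2)
    moreover have "(0 - S' s) - (1 * S' s + S'' s * s) = - (2 * S' s) - s * S'' s" by (simp add: algebra_simps)
    ultimately show "((\<lambda>s. (1 - S s) - s * S' s) has_real_derivative - (2 * S' s) - s * S'' s) (at s)"
      by (simp add: mult.commute)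
    show "s * (1 - S s) = s" if "s \<le> A" using small[OF that] by simp
    show "s * (1 - S s) = 0 \<and> (1 - S s) - s * S' s = 0 \<and> - (2 * S' s) - s * S'' s = 0" if "s \<ge> A + 3"
      using large[OF that] by simp
  next
    have "continuous_on UNIV S'" using 2 by (auto intro!: continuous_at_imp_continuous_on DERIV_isCont)
    moreover have "continuous_on UNIV S''" unfolding S''_def by (intro continuous_intros)
    ultimately show "continuous_on UNIV (\<lambda>s. - (2 * S' s) - s * S'' s)" by (intro continuous_intros)
  qed
qed

lemma finite_family_bound:
  fixes f :: "'n::finite \<Rightarrow> 'a \<Rightarrow> real"
  assumes "\<And>i. \<exists>B. \<forall>x. \<bar>f i x\<bar> \<le> B"
  shows "\<exists>B. \<forall>i x. \<bar>f i x\<bar> \<le> B"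
proof -
  obtain B where B: "\<And>i x. \<bar>f i x\<bar> \<le> B i" using assms by metis
  have "\<bar>f i x\<bar> \<le> (\<Sum>j\<in>UNIV. \<bar>B j\<bar>)" for i x
  proof -
    have "\<bar>f i x\<bar> \<le> \<bar>B i\<bar>" using B[of i x] by linarith
    also have "\<dots> \<le> (\<Sum>j\<in>UNIV. \<bar>B j\<bar>)" by (rule member_le_sum) auto
    finally show ?thesis .
  qed
  then show ?thesis by blast
qed

text \<open>A compactly supported replacement of the squared norm, unchanged on a ball that will
  contain \<open>D\<close>. It gives the Newton potential a compactly supported density.\<close>

lemma norm_square_cutoff:
  fixes R :: real
  obtains \<beta> :: "real ^ 'n \<Rightarrow> real" and \<beta>v \<beta>w R1 B where
    "C2_real UNIV \<beta> \<beta>v \<beta>w" "\<And>x. x \<in> cball 0 R \<Longrightarrow> \<beta> x = (norm x)\<^sup>2" "R1 \<ge> R" "R1 \<ge> 0"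
    "\<And>x. x \<notin> cball 0 R1 \<Longrightarrow> \<beta> x = 0 \<and> (\<forall>i. \<beta>v i x = 0 \<and> (\<forall>j. \<beta>w i j x = 0))"
    "\<And>x i j. \<bar>\<beta> x\<bar> \<le> B \<and> \<bar>\<beta>v i x\<bar> \<le> B \<and> \<bar>\<beta>w i j x\<bar> \<le> B"
proof -
  obtain b b' b'' :: "real \<Rightarrow> real" where b: "\<And>s. (b has_real_derivative b' s) (at s)"
    "\<And>s. (b' has_real_derivative b'' s) (at s)"
    "continuous_on UNIV b''" "\<And>s. s \<le> R\<^sup>2 \<Longrightarrow> b s = s"
    "\<And>s. s \<ge> R\<^sup>2 + 3 \<Longrightarrow> b s = 0 \<and> b' s = 0 \<and> b'' s = 0"
    by (rule square_cutoff_real[of "R\<^sup>2"]) blast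
  let ?q = "\<lambda>y :: real ^ 'n. 0 + (norm (y - 0))\<^sup>2"
  let ?b = "\<lambda>y. b (?q y)" and ?v = "\<lambda>i y. b' (?q y) * (2 * (y $ i - 0 $ i))"
    and ?w = "\<lambda>i j y. b'' (?q y) * (2 * (y $ j - 0 $ j)) * (2 * (y $ i - 0 $ i)) + b' (?q y) * (if i = j then 2 else 0)"
  have C: "C2_real UNIV ?b ?v ?w"
    by (rule C2_real_compose[OF C2_real_norm_sq UNIV_I b(1,2,3)])
  define R1 where "R1 = sqrt (R\<^sup>2 + 3)"
  have R1: "R1 \<ge> R" "R1 \<ge> 0" unfolding R1_def by (auto intro: real_le_rsqrt)
  have z: "?b x = 0 \<and> (\<forall>i. ?v i x = 0 \<and> (\<forall>j. ?w i j x = 0))" if "x \<notin> cball 0 R1" for x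
  proof -
    have "sqrt (R\<^sup>2 + 3) \<le> norm x" using that by (simp add: R1_def)
    then have "R\<^sup>2 + 3 \<le> (norm x)\<^sup>2" by (rule sqrt_le_D)
    then show ?thesis using b(5)[of "?q x"] by simp
  qed
  have bd: "\<exists>B. \<forall>x. \<bar>f x\<bar> \<le> B" if "continuous_on UNIV f" "\<And>x. x \<notin> cball 0 R1 \<Longrightarrow> f x = 0" for f :: "real ^ 'n \<Rightarrow> real"
  proof -
    have cf: "continuous_on (cball 0 R1) f" using that(1) by (rule continuous_on_subset) simp
    show ?thesis using bounded_compact_support[OF compact_cball cf that(2)] by metis
  qed
  have c: "continuous_on UNIV ?b" "\<And>i. continuous_on UNIV (?v i)" "\<And>i j. continuous_on UNIV (?w i j)"
    using C unfolding C2_real_def by blast+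
  obtain B1 where B1: "\<And>x. \<bar>?b x\<bar> \<le> B1" using bd[OF c(1)] z by blast
  have "\<exists>B. \<forall>i x. \<bar>?v i x\<bar> \<le> B" by (rule finite_family_bound, rule bd[OF c(2)]) (use z in blast)
  then obtain B2 where B2: "\<And>i x. \<bar>?v i x\<bar> \<le> B2" by blast
  have "\<exists>B. \<forall>i x. \<bar>(case i of (i, j) \<Rightarrow> ?w i j) x\<bar> \<le> B"
  proof (rule finite_family_bound)
    fix i :: "'n \<times> 'n"
    show "\<exists>B. \<forall>x. \<bar>(case i of (i, j) \<Rightarrow> ?w i j) x\<bar> \<le> B"
    proof (cases i)
      case (Pair a c')
      have "\<exists>B. \<forall>x. \<bar>?w a c' x\<bar> \<le> B" by (rule bd[OF c(3)]) (use z in blast)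
      then show ?thesis unfolding Pair by simp
    qed
  qed
  then obtain B3 where "\<forall>i x. \<bar>(case i of (i, j) \<Rightarrow> ?w i j) x\<bar> \<le> B3" by blast
  then have B3: "\<bar>?w i j x\<bar> \<le> B3" for i j x by (drule_tac spec[of _ "(i, j)"]) simp
  show thesis
  proof (rule that[OF C _ R1 z])
    show "?b x = (norm x)\<^sup>2" if "x \<in> cball 0 R" for x
    proof -
      have "(norm x)\<^sup>2 \<le> R\<^sup>2" using that by (intro power_mono) auto
      then show ?thesis using b(4) by simp
    qed
    show "\<bar>?b x\<bar> \<le> max B1 (max B2 B3) \<and> \<bar>?v i x\<bar> \<le> max B1 (max B2 B3) \<and> \<bar>?w i j x\<bar> \<le> max B1 (max B2 B3)" for x i j
      using B1[of x] B2[where i=i and x=x] B3[where i=i and j=j and x=x] by (intro conjI) (simp_all only: le_max_iff_disj simp_thms)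
  qed
qed

text \<open>Since \<open>\<zeta> = (\<bar>x\<bar>\<^sup>2 \<zeta> - \<Delta>\<zeta>) / \<Lambda>\<close>, a solution of \<open>- \<Delta> p = \<zeta>\<close> is \<open>\<zeta> / \<Lambda>\<close> plus the Newton
  potential of \<open>\<bar>x\<bar>\<^sup>2 \<zeta> / \<Lambda>\<close>. Both have second derivatives that are bounded uniformly in \<open>k\<close>, however
  irregular the enumeration \<open>h\<close> is.\<close>

lemma zeta_particular_solution:
  fixes h :: "nat ^ 'n \<Rightarrow> nat"
  assumes R: "R \<ge> 0"
  obtains C where "C \<ge> 0" "\<And>k. \<exists>p v w. C2_real UNIV p v w \<and>
     (\<forall>x\<in>cball 0 R. (\<Sum>i\<in>UNIV. w i i x) = - zeta_basis h k x \<and> \<bar>zeta_basis h k x\<bar> \<le> C \<and>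
        \<bar>p x\<bar> \<le> C \<and> (\<forall>i. \<bar>v i x\<bar> \<le> C \<and> (\<forall>j. \<bar>w i j x\<bar> \<le> C)))"
proof -
  obtain \<beta> :: "real ^ 'n \<Rightarrow> real" and \<beta>v \<beta>w R1 B where \<beta>: "C2_real UNIV \<beta> \<beta>v \<beta>w"
    and \<beta>R: "\<And>x. x \<in> cball 0 R \<Longrightarrow> \<beta> x = (norm x)\<^sup>2" and R1: "R1 \<ge> R" "R1 \<ge> 0"
    and z: "\<And>x. x \<notin> cball 0 R1 \<Longrightarrow> \<beta> x = 0 \<and> (\<forall>i. \<beta>v i x = 0 \<and> (\<forall>j. \<beta>w i j x = 0))"
    and B: "\<And>x i j. \<bar>\<beta> x\<bar> \<le> B \<and> \<bar>\<beta>v i x\<bar> \<le> B \<and> \<bar>\<beta>w i j x\<bar> \<le> B"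
    by (rule norm_square_cutoff) blast
  have B0: "B \<ge> 0" using B[of 0] abs_ge_zero order_trans by blast
  obtain Z where Z0: "Z \<ge> 0" and Z: "\<And>h k. \<exists>v w \<Lambda>. \<Lambda> \<ge> 1 \<and> C2_real UNIV (zeta_basis h k) v w \<and>
     (\<forall>x :: real ^ 'n. (\<Sum>i\<in>UNIV. w i i x) = ((norm x)\<^sup>2 - \<Lambda>) * zeta_basis h k x) \<and>
     (\<forall>x\<in>cball 0 R1. \<bar>zeta_basis h k x\<bar> \<le> Z \<and> (\<forall>i. \<bar>v i x\<bar> \<le> Z * \<Lambda> \<and> (\<forall>j. \<bar>w i j x\<bar> \<le> Z * \<Lambda>)))"
    by (rule zeta_basis_C2[OF R1(2), where 'n='n]) blast
  define A where "A = (\<integral>y. indicator (cball 0 (R1 + R)) (y :: real ^ 'n) * \<bar>newton_kernel y\<bar> \<partial>lborel)"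
  have A0: "A \<ge> 0" unfolding A_def by (rule integral_nonneg_AE) auto
  \<comment> \<open>\<open>Z\<close> comes from the basis function after division by \<Lambda>. The
    product rule for a second derivative has four terms, each at most
    \<open>B * (Z * \<Lambda>)\<close>; the potential multiplies this by the kernel mass
    \<open>A\<close>, and dividing by \<Lambda> leaves \<open>4 * B * Z * A\<close>.\<close>
  define C where "C = Z + 4 * B * Z * A"
  have C0: "C \<ge> 0" using B0 Z0 A0 by (simp add: C_def)
  have main: "\<exists>p v w. C2_real UNIV p v w \<and>
     (\<forall>x\<in>cball 0 R. (\<Sum>i\<in>UNIV. w i i x) = - zeta_basis h k x \<and> \<bar>zeta_basis h k x\<bar> \<le> C \<and>
        \<bar>p x\<bar> \<le> C \<and> (\<forall>i. \<bar>v i x\<bar> \<le> C \<and> (\<forall>j. \<bar>w i j x\<bar> \<le> C)))" for k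
  proof -
    let ?\<zeta> = "zeta_basis h k"
    obtain zv zw \<Lambda> where L: "\<Lambda> \<ge> 1" and \<zeta>: "C2_real UNIV ?\<zeta> zv zw"
      and lap: "\<And>x. (\<Sum>i\<in>UNIV. zw i i x) = ((norm x)\<^sup>2 - \<Lambda>) * ?\<zeta> x"
      and b\<zeta>: "\<And>x. x \<in> cball 0 R1 \<Longrightarrow> \<bar>?\<zeta> x\<bar> \<le> Z \<and> (\<forall>i. \<bar>zv i x\<bar> \<le> Z * \<Lambda> \<and> (\<forall>j. \<bar>zw i j x\<bar> \<le> Z * \<Lambda>))"
      using Z[of h k] by blast
    define g where "g x = \<beta> x * ?\<zeta> x" for x
    define gv where "gv i x = \<beta>v i x * ?\<zeta> x + \<beta> x * zv i x" for i x
    define gw where "gw i j x = \<beta>w i j x * ?\<zeta> x + \<beta>v i x * zv j x + (\<beta>v j x * zv i x + \<beta> x * zw i j x)" for i j x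
    have gC: "C2_real UNIV g gv gw"
      unfolding g_def[abs_def] gv_def[abs_def] gw_def[abs_def] by (rule C2_real_mult[OF \<beta> \<zeta>])
    have gz: "g x = 0 \<and> (\<forall>i. gv i x = 0 \<and> (\<forall>j. gw i j x = 0))" if "x \<notin> cball 0 R1" for x
      using z[OF that] by (simp add: g_def gv_def gw_def)
    let ?K = "4 * B * (Z * \<Lambda>)"
    have ZL: "Z \<le> Z * \<Lambda>" using mult_left_mono[OF L Z0] by simp
    have prod_le: "\<bar>s * t\<bar> \<le> B * (Z * \<Lambda>)" if "\<bar>s\<bar> \<le> B" "\<bar>t\<bar> \<le> Z * \<Lambda>" for s t
      unfolding abs_mult using that B0 by (intro mult_mono) auto
    have K0: "B * (Z * \<Lambda>) \<ge> 0" using B0 Z0 L by simp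
    have gb: "\<bar>g x\<bar> \<le> ?K" "\<bar>gv i x\<bar> \<le> ?K" "\<bar>gw i j x\<bar> \<le> ?K" for x i j
    proof -
      have "\<bar>g x\<bar> \<le> ?K \<and> \<bar>gv i x\<bar> \<le> ?K \<and> \<bar>gw i j x\<bar> \<le> ?K"
      proof (cases "x \<in> cball 0 R1")
        case True
        have zz: "\<bar>?\<zeta> x\<bar> \<le> Z * \<Lambda>" "\<And>i. \<bar>zv i x\<bar> \<le> Z * \<Lambda>" "\<And>i j. \<bar>zw i j x\<bar> \<le> Z * \<Lambda>"
          using b\<zeta>[OF True] ZL by (auto intro: order_trans)
        have bb: "\<bar>\<beta> x\<bar> \<le> B" "\<And>i. \<bar>\<beta>v i x\<bar> \<le> B" "\<And>i j. \<bar>\<beta>w i j x\<bar> \<le> B" using B by blast+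
        have "\<bar>\<beta> x * ?\<zeta> x\<bar> \<le> B * (Z * \<Lambda>)" "\<bar>\<beta>v i x * ?\<zeta> x\<bar> \<le> B * (Z * \<Lambda>)" "\<bar>\<beta> x * zv i x\<bar> \<le> B * (Z * \<Lambda>)"
          "\<bar>\<beta>w i j x * ?\<zeta> x\<bar> \<le> B * (Z * \<Lambda>)" "\<bar>\<beta>v i x * zv j x\<bar> \<le> B * (Z * \<Lambda>)" "\<bar>\<beta>v j x * zv i x\<bar> \<le> B * (Z * \<Lambda>)"
          "\<bar>\<beta> x * zw i j x\<bar> \<le> B * (Z * \<Lambda>)"
          by (intro prod_le bb zz)+
        then show ?thesis using K0 unfolding g_def gv_def gw_def by (simp only: mult.assoc) linarith
      next
        case False
        then show ?thesis using gz[OF False] K0 by simp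
      qed
      then show "\<bar>g x\<bar> \<le> ?K" "\<bar>gv i x\<bar> \<le> ?K" "\<bar>gw i j x\<bar> \<le> ?K" by blast+
    qed
    have gc: "continuous_on UNIV g" "continuous_on UNIV (gv i)" "continuous_on UNIV (gw i j)" for i j
      using gC by (auto simp: C2_real_def)
    have N_le: "\<bar>newton_potential f x\<bar> \<le> ?K * A" if "continuous_on UNIV f" "\<And>x. \<bar>f x\<bar> \<le> ?K"
      "\<And>x. x \<notin> cball 0 R1 \<Longrightarrow> f x = 0" "x \<in> cball 0 R" for f :: "real ^ 'n \<Rightarrow> real" and x
      unfolding A_def
    proof (rule newton_potential_bound(3))
      show "f \<in> borel_measurable borel" using that(1) by (rule borel_measurable_continuous_onI)
    qed (use that in auto)
    have NC: "C2_real UNIV (newton_potential g) (\<lambda>i. newton_potential (gv i)) (\<lambda>i j. newton_potential (gw i j))"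
      by (rule newton_potential_C2(1)[where r=R1, OF gC]) (rule gz)
    have NL: "(\<Sum>i\<in>UNIV. newton_potential (gw i i) x) = - g x" for x
      by (rule newton_potential_C2(2)[where r=R1, OF gC]) (rule gz)
    let ?c = "1 / \<Lambda>"
    note PC = C2_real_cmult[OF C2_real_add[OF \<zeta> NC], where c="?c"]
    have fin: "\<bar>?c * (s + t)\<bar> \<le> C" if "\<bar>s\<bar> \<le> Z * \<Lambda>" "\<bar>t\<bar> \<le> ?K * A" for s t
    proof -
      have "\<bar>s + t\<bar> \<le> Z * \<Lambda> + ?K * A" using that by linarith
      also have "\<dots> = C * \<Lambda>" by (simp add: C_def algebra_simps)
      finally show ?thesis using L by (simp add: abs_mult divide_le_eq)
    qed
    show ?thesis
    proof (intro exI conjI ballI allI)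
      show "C2_real UNIV (\<lambda>x. ?c * (?\<zeta> x + newton_potential g x)) (\<lambda>i x. ?c * (zv i x + newton_potential (gv i) x))
         (\<lambda>i j x. ?c * (zw i j x + newton_potential (gw i j) x))" by (rule PC)
      fix x :: "real ^ 'n" assume x: "x \<in> cball 0 R"
      then have x1: "x \<in> cball 0 R1" using R1 by auto
      have "(\<Sum>i\<in>UNIV. ?c * (zw i i x + newton_potential (gw i i) x)) = ?c * ((\<Sum>i\<in>UNIV. zw i i x) + (\<Sum>i\<in>UNIV. newton_potential (gw i i) x))"
        by (simp only: sum_distrib_left[symmetric] sum.distrib)
      also have "\<dots> = ?c * (- \<Lambda> * ?\<zeta> x)"
        unfolding lap NL g_def \<beta>R[OF x] by (simp add: algebra_simps)
      also have "\<dots> = - ?\<zeta> x" using L by simp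
      finally show "(\<Sum>i\<in>UNIV. ?c * (zw i i x + newton_potential (gw i i) x)) = - ?\<zeta> x" .
      have "4 * B * Z * A \<ge> 0" using B0 Z0 A0 by simp
      then show "\<bar>?\<zeta> x\<bar> \<le> C" using b\<zeta>[OF x1] unfolding C_def by linarith
      have zz: "\<bar>?\<zeta> x\<bar> \<le> Z * \<Lambda>" "\<And>i. \<bar>zv i x\<bar> \<le> Z * \<Lambda>" "\<And>i j. \<bar>zw i j x\<bar> \<le> Z * \<Lambda>"
        using b\<zeta>[OF x1] ZL by (auto intro: order_trans)
      show "\<bar>?c * (?\<zeta> x + newton_potential g x)\<bar> \<le> C"
        by (intro fin zz N_le gc gb x) (use gz in blast)
      fix i
      show "\<bar>?c * (zv i x + newton_potential (gv i) x)\<bar> \<le> C"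
        by (intro fin zz N_le gc gb x) (use gz in blast)
      fix j
      show "\<bar>?c * (zw i j x + newton_potential (gw i j) x)\<bar> \<le> C"
        by (intro fin zz N_le gc gb x) (use gz in blast)
    qed
  qed
  show thesis by (rule that[OF C0 main])
qed

section \<open>Solutions with zero boundary values, uniformly in the index\<close>

lemma harmonic_max_bound:
  fixes D :: "(real ^ 'n) set"
  assumes D: "open D" "bounded D" and u: "continuous_on (closure D) u" "C2_real D u v w"
    "\<And>x. x \<in> D \<Longrightarrow> (\<Sum>i\<in>UNIV. w i i x) = 0" and B: "\<And>x. x \<in> frontier D \<Longrightarrow> \<bar>u x\<bar> \<le> B" and x: "x \<in> closure D"
  shows "\<bar>u x\<bar> \<le> B"
proof -
  have le: "c * u x \<le> B" if c: "c = 1 \<or> c = - 1" for c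
  proof (rule max_principle[OF D _ _ _ _ _ x])
    show "continuous_on (closure D) (\<lambda>x. c * u x)" by (intro continuous_intros u)
    show "has_partial_real D j (\<lambda>x. c * u x) (\<lambda>x. c * v j x)" "has_partial_real D j (\<lambda>x. c * v j x) (\<lambda>x. c * w j j x)" for j
      using C2_real_cmult[OF u(2), of c] unfolding C2_real_def by blast+
    show "0 \<le> (\<Sum>j\<in>UNIV. c * w j j y)" if "y \<in> D" for y using u(3)[OF that] by (simp add: sum_distrib_left[symmetric])
    show "c * u y \<le> B" if "y \<in> frontier D" for y using B[OF that] c by auto
  qed
  show ?thesis using le[of 1] le[of "- 1"] by auto
qed

text \<open>Every bound is common to all \<open>k\<close>, including the radius and the constant of
  the last clause; termwise differentiation of the chaos sum rests on this.\<close>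

lemma poisson_zeta_family:
  fixes h :: "nat ^ 'n \<Rightarrow> nat" and D :: "(real ^ 'n) set"
  assumes D: "open D" "bounded D" and reg: "regular_boundary D"
  obtains u v w M where
    "\<And>k. continuous_on (closure D) (u k)" "\<And>k y. y \<in> frontier D \<Longrightarrow> u k y = 0"
    "\<And>k. C2_real D (u k) (v k) (w k)" "\<And>k y. y \<in> D \<Longrightarrow> (\<Sum>i\<in>UNIV. w k i i y) = - zeta_basis h k y"
    "\<And>k y. y \<in> closure D \<Longrightarrow> \<bar>u k y\<bar> \<le> M" "\<And>k y. y \<in> closure D \<Longrightarrow> \<bar>zeta_basis h k y\<bar> \<le> M" "M \<ge> 0"
    "\<And>x0. x0 \<in> D \<Longrightarrow> \<exists>r>0. \<exists>C. ball x0 r \<subseteq> D \<and> (\<forall>k. \<forall>x\<in>ball x0 r. \<forall>i j. \<bar>v k i x\<bar> \<le> C \<and> \<bar>w k i j x\<bar> \<le> C)"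
proof -
  have "bounded (closure D)" by (rule bounded_closure[OF D(2)])
  then obtain R0 where R0: "\<forall>y\<in>closure D. norm y \<le> R0" unfolding bounded_iff by blast
  define R where "R = \<bar>R0\<bar>"
  have R: "R \<ge> 0" "\<And>y. y \<in> closure D \<Longrightarrow> y \<in> cball 0 R" using R0 by (force simp: R_def)+
  obtain C where C0: "C \<ge> 0" and C: "\<And>k. \<exists>p v w. C2_real UNIV p v w \<and>
     (\<forall>x\<in>cball 0 R. (\<Sum>i\<in>UNIV. w i i x) = - zeta_basis h k x \<and> \<bar>zeta_basis h k x\<bar> \<le> C \<and>
        \<bar>p x\<bar> \<le> C \<and> (\<forall>i. \<bar>v i x\<bar> \<le> C \<and> (\<forall>j. \<bar>w i j x\<bar> \<le> C)))"
    by (rule zeta_particular_solution[OF R(1), of h]) blast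
  have "\<forall>k. \<exists>t. C2_real UNIV (fst t) (fst (snd t)) (snd (snd t)) \<and>
     (\<forall>x\<in>cball 0 R. (\<Sum>i\<in>UNIV. snd (snd t) i i x) = - zeta_basis h k x \<and> \<bar>zeta_basis h k x\<bar> \<le> C \<and>
        \<bar>fst t x\<bar> \<le> C \<and> (\<forall>i. \<bar>fst (snd t) i x\<bar> \<le> C \<and> (\<forall>j. \<bar>snd (snd t) i j x\<bar> \<le> C)))"
  proof
    fix k
    obtain p v w where "C2_real UNIV p v w \<and>
     (\<forall>x\<in>cball 0 R. (\<Sum>i\<in>UNIV. w i i x) = - zeta_basis h k x \<and> \<bar>zeta_basis h k x\<bar> \<le> C \<and>
        \<bar>p x\<bar> \<le> C \<and> (\<forall>i. \<bar>v i x\<bar> \<le> C \<and> (\<forall>j. \<bar>w i j x\<bar> \<le> C)))"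
      using C[of k] by (elim exE)
    then show "\<exists>t. C2_real UNIV (fst t) (fst (snd t)) (snd (snd t)) \<and>
     (\<forall>x\<in>cball 0 R. (\<Sum>i\<in>UNIV. snd (snd t) i i x) = - zeta_basis h k x \<and> \<bar>zeta_basis h k x\<bar> \<le> C \<and>
        \<bar>fst t x\<bar> \<le> C \<and> (\<forall>i. \<bar>fst (snd t) i x\<bar> \<le> C \<and> (\<forall>j. \<bar>snd (snd t) i j x\<bar> \<le> C)))"
      by (intro exI[of _ "(p, v, w)"]) simp
  qed
  from choice[OF this] obtain t where t: "\<forall>k. C2_real UNIV (fst (t k)) (fst (snd (t k))) (snd (snd (t k))) \<and>
     (\<forall>x\<in>cball 0 R. (\<Sum>i\<in>UNIV. snd (snd (t k)) i i x) = - zeta_basis h k x \<and> \<bar>zeta_basis h k x\<bar> \<le> C \<and>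
        \<bar>fst (t k) x\<bar> \<le> C \<and> (\<forall>i. \<bar>fst (snd (t k)) i x\<bar> \<le> C \<and> (\<forall>j. \<bar>snd (snd (t k)) i j x\<bar> \<le> C)))" ..
  define p where "p k = fst (t k)" for k
  define pv where "pv k = fst (snd (t k))" for k
  define pw where "pw k = snd (snd (t k))" for k
  note t' = t[folded p_def pv_def pw_def, rule_format]
  have p: "C2_real UNIV (p k) (pv k) (pw k)" for k using t' by (rule conjunct1)
  have pL: "(\<Sum>i\<in>UNIV. pw k i i x) = - zeta_basis h k x" and z: "\<bar>zeta_basis h k x\<bar> \<le> C"
    and pb: "\<bar>p k x\<bar> \<le> C" and pvb: "\<bar>pv k i x\<bar> \<le> C" and pwb: "\<bar>pw k i j x\<bar> \<le> C"
    if "x \<in> cball 0 R" for k x i j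
    using conjunct2[OF t'[of k]] that by blast+
  have pc: "continuous_on S (p k)" for k S
    using p[of k] unfolding C2_real_def by (blast intro: continuous_on_subset)
  have "\<forall>k. \<exists>t. continuous_on (closure D) (fst t) \<and> C2_real D (fst t) (fst (snd t)) (snd (snd t)) \<and>
      (\<forall>x\<in>D. (\<Sum>i\<in>UNIV. snd (snd t) i i x) = 0) \<and> (\<forall>x\<in>frontier D. fst t x = p k x)"
  proof
    fix k
    obtain q where q: "solves_dirichlet D (p k) q"
      using reg pc[of "frontier D" k] unfolding regular_boundary_def by blast
    show "\<exists>t. continuous_on (closure D) (fst t) \<and> C2_real D (fst t) (fst (snd t)) (snd (snd t)) \<and>
      (\<forall>x\<in>D. (\<Sum>i\<in>UNIV. snd (snd t) i i x) = 0) \<and> (\<forall>x\<in>frontier D. fst t x = p k x)"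
    proof (rule solves_dirichletD[OF q])
      fix v w assume "continuous_on (closure D) q" "C2_real D q v w"
        "\<And>x. x \<in> D \<Longrightarrow> (\<Sum>i\<in>UNIV. w i i x) = 0" "\<And>x. x \<in> frontier D \<Longrightarrow> q x = p k x"
      then show ?thesis by (intro exI[of _ "(q, v, w)"]) simp
    qed
  qed
  from choice[OF this] obtain s where s: "\<forall>k. continuous_on (closure D) (fst (s k)) \<and>
      C2_real D (fst (s k)) (fst (snd (s k))) (snd (snd (s k))) \<and>
      (\<forall>x\<in>D. (\<Sum>i\<in>UNIV. snd (snd (s k)) i i x) = 0) \<and> (\<forall>x\<in>frontier D. fst (s k) x = p k x)" ..
  define q where "q k = fst (s k)" for k
  define qv where "qv k = fst (snd (s k))" for k
  define qw where "qw k = snd (snd (s k))" for k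
  note s' = s[folded q_def qv_def qw_def, rule_format]
  have qc: "continuous_on (closure D) (q k)" and qC: "C2_real D (q k) (qv k) (qw k)" for k
    using s'[of k] by blast+
  have qL: "(\<Sum>i\<in>UNIV. qw k i i x) = 0" if "x \<in> D" for k x using s'[of k] that by blast
  have qp: "q k x = p k x" if "x \<in> frontier D" for k x using s'[of k] that by blast
  have fr: "frontier D \<subseteq> closure D" by (auto simp: frontier_def)
  have qb: "\<bar>q k x\<bar> \<le> C" if "x \<in> closure D" for k x
    by (rule harmonic_max_bound[OF D qc qC qL _ that]) (use qp pb R(2) fr in auto)
  show thesis
  proof (rule that[of "\<lambda>k y. p k y + (-1) * q k y" "\<lambda>k i y. pv k i y + (-1) * qv k i y" "\<lambda>k i j y. pw k i j y + (-1) * qw k i j y" "C + C"])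
    show "continuous_on (closure D) (\<lambda>y. p k y + (-1) * q k y)" for k by (intro continuous_intros pc qc)
    show "p k y + (-1) * q k y = 0" if "y \<in> frontier D" for k y using qp[OF that] by simp
    show "C2_real D (\<lambda>y. p k y + (-1) * q k y) (\<lambda>i y. pv k i y + (-1) * qv k i y) (\<lambda>i j y. pw k i j y + (-1) * qw k i j y)" for k
      by (intro C2_real_add C2_real_cmult qC C2_real_subset[OF p]) auto
    show "(\<Sum>i\<in>UNIV. pw k i i y + (-1) * qw k i i y) = - zeta_basis h k y" if "y \<in> D" for k y
      using pL[OF R(2), of y k] qL[OF that, of k] that closure_subset
      by (auto simp: sum_subtractf)
    show "\<bar>p k y + (-1) * q k y\<bar> \<le> C + C" "\<bar>zeta_basis h k y\<bar> \<le> C + C" if "y \<in> closure D" for k y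
      using pb[OF R(2)[OF that], of k] qb[OF that, of k] z[OF R(2)[OF that], of k] C0 by linarith+
    show "C + C \<ge> 0" using C0 by simp
    fix x0 assume x0: "x0 \<in> D"
    obtain r where r: "r > 0" "ball x0 r \<subseteq> D" using D(1) x0 by (meson open_contains_ball)
    obtain K where K: "K \<ge> 0" "\<And>u v w B x i j. \<lbrakk>C2_real D u v w; \<And>y. y \<in> D \<Longrightarrow> (\<Sum>i\<in>UNIV. w i i y) = 0;
       \<And>y. y \<in> D \<Longrightarrow> \<bar>u y\<bar> \<le> B; x \<in> ball x0 (r / 2)\<rbrakk> \<Longrightarrow> \<bar>v i x\<bar> \<le> K * B \<and> \<bar>w i j x\<bar> \<le> K * B"
      by (rule harmonic_interior_bounds[OF D(1) r]) blast
    have qbD: "\<bar>q k y\<bar> \<le> C" if "y \<in> D" for k y using qb that closure_subset by blast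
    have "ball x0 (r / 2) \<subseteq> D" using r by (auto simp: subset_eq)
    moreover have "\<bar>pv k i x + (-1) * qv k i x\<bar> \<le> C + K * C \<and> \<bar>pw k i j x + (-1) * qw k i j x\<bar> \<le> C + K * C"
      if x: "x \<in> ball x0 (r / 2)" for k x i j
    proof -
      have "x \<in> cball 0 R" using x \<open>ball x0 (r / 2) \<subseteq> D\<close> closure_subset R(2) by blast
      then show ?thesis using K(2)[OF qC qL qbD x, of k i j] pvb[of x k i] pwb[of x k i j] by linarith
    qed
    ultimately show "\<exists>r>0. \<exists>C. ball x0 r \<subseteq> D \<and> (\<forall>k. \<forall>x\<in>ball x0 r. \<forall>i j.
        \<bar>pv k i x + (-1) * qv k i x\<bar> \<le> C \<and> \<bar>pw k i j x + (-1) * qw k i j x\<bar> \<le> C)"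
      using r(1) by (intro exI[of _ "r / 2"] conjI exI[of _ "C + K * C"]) auto
  qed
qed

section \<open>First-order chaos\<close>

text \<open>The indices \<open>\<epsilon>(z(k, 1))\<close>, \<open>k \<ge> 1\<close>, enumerated from 0.\<close>

definition noise_index :: "nat \<Rightarrow> multi_index" where
  "noise_index n = unit_index (zpair (Suc n) 1)"

text \<open>\<open>zpair (Suc n) 1\<close> is \<open>1 + n (n + 1) / 2\<close>, and positions are
  shifted by one, so the noise occupies the triangular numbers.\<close>

lemma noise_index_eq: "noise_index n = Poly_Mapping.single (n * Suc n div 2) 1"
  by (simp add: noise_index_def unit_index_def zpair_def)

lemma triangular_strict_mono: "strict_mono (\<lambda>n::nat. n * Suc n div 2)"
proof (rule strict_mono_Suc_iff[THEN iffD2], intro allI)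
  fix n :: nat
  have "Suc n * Suc (Suc n) = n * Suc n + Suc n * 2" by simp
  then have "Suc n * Suc (Suc n) div 2 = n * Suc n div 2 + Suc n" by simp
  then show "n * Suc n div 2 < Suc n * Suc (Suc n) div 2" by simp
qed

lemma inj_noise_index: "inj noise_index"
proof (rule injI)
  fix m n assume "noise_index m = noise_index n"
  then have "Poly_Mapping.lookup (Poly_Mapping.single (m * Suc m div 2) 1) (n * Suc n div 2) = (1 :: nat)"
    unfolding noise_index_eq by simp
  then have "m * Suc m div 2 = n * Suc n div 2" by (simp add: lookup_single when_def split: if_splits)
  then show "m = n" using strict_mono_eq[OF triangular_strict_mono] by blast
qed

definition noise_weight :: "nat \<Rightarrow> real" where
  "noise_weight n = mi_weight 1 (noise_index n)"

lemma mi_fact_noise_index: "mi_fact (noise_index n) = 1"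
  by (simp add: mi_fact_def noise_index_eq lookup_single)

lemma noise_weight_eq: "noise_weight n = 2 * real (n * Suc n div 2 + 1)"
  by (simp add: noise_weight_def mi_weight_def noise_index_eq lookup_single)

lemma noise_weight_pos: "noise_weight n > 0" by (simp add: noise_weight_eq)

lemma noise_weight_ge: "noise_weight n \<ge> (real n)\<^sup>2"
proof -
  have "even (n * Suc n)" by simp
  then have e: "2 * (n * Suc n div 2) = n * Suc n" by (rule dvd_mult_div_cancel)
  have "noise_weight n = real (2 * (n * Suc n div 2)) + 2"
    unfolding noise_weight_eq by (simp only: of_nat_add of_nat_mult of_nat_numeral of_nat_1 distrib_left mult_1_right)
  then have "noise_weight n = real (n * Suc n) + 2" unfolding e .
  then show ?thesis by (simp add: power2_eq_square algebra_simps)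
qed

text \<open>The weight is \<open>n (n + 1) + 2\<close>, so bounded coefficients already define an
  element of the space with exponent 1.\<close>

lemma summable_noise_weight: "summable (\<lambda>n. 1 / noise_weight n)"
proof (rule summable_comparison_test_ev)
  show "summable (\<lambda>n. inverse ((real n)\<^sup>2))" by (rule inverse_power_summable) simp
  show "eventually (\<lambda>n. norm (1 / noise_weight n) \<le> inverse ((real n)\<^sup>2)) sequentially"
    using eventually_gt_at_top[of 0]
  proof eventually_elim
    case (elim n)
    then show ?case using noise_weight_ge[of n] noise_weight_pos[of n]
      by (simp add: divide_inverse le_imp_inverse_le)
  qed
qed

section \<open>First-chaos sums and their norms\<close>

text \<open>With \<open>first_chaos_sum_off\<close> this determines the whole family, so linear
  operations are checked index by index. The index number \<open>n\<close> belongs to the summand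
  \<open>k = Suc n\<close>, because the sum starts at 1.\<close>

lemma first_chaos_sum_noise_index: "first_chaos_sum c a (noise_index n) = c * a (Suc n)"
proof -
  have "(\<Sum>\<^sub>\<infinity>k\<in>{1..}. a k * chaos_K (unit_index (zpair k 1)) (noise_index n)) =
      (\<Sum>\<^sub>\<infinity>k\<in>{Suc n}. a k * chaos_K (unit_index (zpair k 1)) (noise_index n))"
  proof (rule infsum_cong_neutral)
    fix k assume k: "k \<in> {1..} - {Suc n}"
    then obtain m where m: "k = Suc m" "m \<noteq> n" by (cases k) auto
    then have "noise_index m \<noteq> noise_index n" using inj_noise_index by (auto simp: inj_def)
    then show "a k * chaos_K (unit_index (zpair k 1)) (noise_index n) = 0"
      using m by (auto simp: chaos_K_def noise_index_def)
  qed auto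
  then show ?thesis by (simp add: first_chaos_sum_def chaos_K_def noise_index_def)
qed

lemma first_chaos_sum_off:
  assumes "\<alpha> \<notin> range noise_index" shows "first_chaos_sum c a \<alpha> = 0"
proof -
  have "(\<Sum>\<^sub>\<infinity>k\<in>{1..}. a k * chaos_K (unit_index (zpair k 1)) \<alpha>) = 0"
  proof (rule infsum_0)
    fix k :: nat assume "k \<in> {1..}"
    then obtain m where "k = Suc m" by (cases k) auto
    then have "unit_index (zpair k 1) \<in> range noise_index" by (simp add: noise_index_def)
    then show "a k * chaos_K (unit_index (zpair k 1)) \<alpha> = 0" using assms by (auto simp: chaos_K_def)
  qed
  then show ?thesis by (simp add: first_chaos_sum_def)
qed

lemma first_chaos_sum_cong:
  assumes "\<And>k. k \<ge> 1 \<Longrightarrow> a k = b k" shows "first_chaos_sum c a = first_chaos_sum c b"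
proof
  fix \<alpha> show "first_chaos_sum c a \<alpha> = first_chaos_sum c b \<alpha>"
    using assms by (cases "\<alpha> \<in> range noise_index") (auto simp: first_chaos_sum_noise_index first_chaos_sum_off)
qed

lemma first_chaos_sum_diff:
  "first_chaos_sum c a \<alpha> - first_chaos_sum c b \<alpha> = first_chaos_sum c (\<lambda>k. a k - b k) \<alpha>"
  by (cases "\<alpha> \<in> range noise_index") (auto simp: first_chaos_sum_noise_index first_chaos_sum_off algebra_simps)

lemma first_chaos_sum_cmult: "first_chaos_sum c (\<lambda>k. r * a k) \<alpha> = r * first_chaos_sum c a \<alpha>"
  by (cases "\<alpha> \<in> range noise_index") (auto simp: first_chaos_sum_noise_index first_chaos_sum_off)

lemma first_chaos_sum_sum:
  "(\<Sum>i\<in>I. first_chaos_sum c (a i) \<alpha>) = first_chaos_sum c (\<lambda>k. \<Sum>i\<in>I. a i k) \<alpha>"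
  by (cases "\<alpha> \<in> range noise_index") (auto simp: first_chaos_sum_noise_index first_chaos_sum_off sum_distrib_left)

lemma first_chaos_sum_zero: "first_chaos_sum c (\<lambda>_. 0) = (\<lambda>\<alpha>. 0)"
  using first_chaos_sum_cmult[of c 0 "\<lambda>_. 0"] by (auto simp: fun_eq_iff)

lemma noise_index_sum:
  fixes g :: "multi_index \<Rightarrow> real"
  assumes "\<And>\<alpha>. \<alpha> \<notin> range noise_index \<Longrightarrow> g \<alpha> = 0"
  shows "g summable_on UNIV \<longleftrightarrow> (\<lambda>n. g (noise_index n)) summable_on UNIV"
    and "infsum g UNIV = (\<Sum>\<^sub>\<infinity>n. g (noise_index n))"
proof -
  have "g summable_on UNIV \<longleftrightarrow> g summable_on range noise_index"
    by (rule summable_on_cong_neutral) (use assms in auto)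
  then show "g summable_on UNIV \<longleftrightarrow> (\<lambda>n. g (noise_index n)) summable_on UNIV"
    using summable_on_reindex[OF inj_noise_index, of g] by (simp add: o_def)
  have "infsum g UNIV = infsum g (range noise_index)"
    by (rule infsum_cong_neutral) (use assms in auto)
  then show "infsum g UNIV = (\<Sum>\<^sub>\<infinity>n. g (noise_index n))"
    using infsum_reindex[OF inj_noise_index, of g] by (simp add: o_def)
qed

lemma infsum_eq_suminf_real:
  fixes f :: "nat \<Rightarrow> real" assumes "f summable_on UNIV" shows "infsum f UNIV = suminf f"
  using has_sum_imp_sums[OF has_sum_infsum[OF assms]] by (simp add: sums_iff)

lemma summable_bounded_noise:
  assumes "\<And>n. \<bar>b n\<bar> \<le> B"
  shows "summable (\<lambda>n. (c * b n)\<^sup>2 / noise_weight n)"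
proof (rule summable_comparison_test)
  show "summable (\<lambda>n. (c\<^sup>2 * B\<^sup>2) * (1 / noise_weight n))" by (rule summable_mult[OF summable_noise_weight])
  have "norm ((c * b n)\<^sup>2 / noise_weight n) \<le> (c\<^sup>2 * B\<^sup>2) * (1 / noise_weight n)" for n
  proof -
    have "(b n)\<^sup>2 \<le> B\<^sup>2" using power_mono[OF assms[of n], of 2] by simp
    then show ?thesis using noise_weight_pos[of n]
      by (simp add: power_mult_distrib divide_right_mono mult_left_mono)
  qed
  then show "\<exists>N. \<forall>n\<ge>N. norm ((c * b n)\<^sup>2 / noise_weight n) \<le> (c\<^sup>2 * B\<^sup>2) * (1 / noise_weight n)" by blast
qed

text \<open>The value of the norm is the same for every \<rho>, because the factorial is 1 on all
  indices involved; Hida and Kondratiev estimates therefore coincide.\<close>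

lemma first_chaos_sum_norm:
  fixes a :: "nat \<Rightarrow> real"
  assumes "\<And>k. k \<ge> 1 \<Longrightarrow> \<bar>a k\<bar> \<le> B"
  shows "first_chaos_sum c a \<in> dist_space_at \<rho> 1"
    and "dist_norm \<rho> 1 (first_chaos_sum c a) = sqrt (suminf (\<lambda>n. (c * a (Suc n))\<^sup>2 / noise_weight n))"
proof -
  let ?g = "\<lambda>\<alpha>. mi_fact \<alpha> ^ (1 - \<rho>) * (first_chaos_sum c a \<alpha>)\<^sup>2 / mi_weight 1 \<alpha>"
  have off: "?g \<alpha> = 0" if "\<alpha> \<notin> range noise_index" for \<alpha> by (simp add: first_chaos_sum_off[OF that])
  have on: "(\<lambda>n. ?g (noise_index n)) = (\<lambda>n. (c * a (Suc n))\<^sup>2 / noise_weight n)"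
    by (simp add: first_chaos_sum_noise_index mi_fact_noise_index noise_weight_def)
  have "summable (\<lambda>n. (c * a (Suc n))\<^sup>2 / noise_weight n)"
    by (rule summable_bounded_noise) (use assms in auto)
  then have s: "(\<lambda>n. (c * a (Suc n))\<^sup>2 / noise_weight n) summable_on UNIV"
    by (rule summable_nonneg_imp_summable_on) (use noise_weight_pos in \<open>auto simp: less_imp_le\<close>)
  show "first_chaos_sum c a \<in> dist_space_at \<rho> 1"
    unfolding dist_space_at_def mem_Collect_eq using noise_index_sum(1)[of ?g, OF off] s unfolding on by simp
  show "dist_norm \<rho> 1 (first_chaos_sum c a) = sqrt (suminf (\<lambda>n. (c * a (Suc n))\<^sup>2 / noise_weight n))"
    unfolding dist_norm_def using noise_index_sum(2)[of ?g, OF off] infsum_eq_suminf_real[OF s] unfolding on by simp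
qed

lemma first_chaos_sum_dist_space:
  assumes "\<And>k. k \<ge> 1 \<Longrightarrow> \<bar>a k\<bar> \<le> B"
  shows "first_chaos_sum c a \<in> dist_space \<rho>"
proof -
  have "first_chaos_sum c a \<in> dist_space_at \<rho> 1" by (rule first_chaos_sum_norm(1)) (rule assms)
  then show ?thesis unfolding dist_space_def by (rule UN_I[OF UNIV_I])
qed

text \<open>Tannery's theorem: the reciprocal weights are summable, so coefficientwise convergence
  with a common bound gives convergence in norm.\<close>

lemma first_chaos_sum_norm_tendsto:
  fixes a :: "'t \<Rightarrow> nat \<Rightarrow> real"
  assumes lim: "\<And>k. k \<ge> 1 \<Longrightarrow> ((\<lambda>t. a t k) \<longlongrightarrow> b k) F"
    and bnd: "eventually (\<lambda>t. \<forall>k\<ge>1. \<bar>a t k\<bar> \<le> B) F" and b: "\<And>k. k \<ge> 1 \<Longrightarrow> \<bar>b k\<bar> \<le> B"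
  shows "((\<lambda>t. dist_norm \<rho> 1 (\<lambda>\<alpha>. first_chaos_sum c (a t) \<alpha> - first_chaos_sum c b \<alpha>)) \<longlongrightarrow> 0) F"
proof (cases "F = bot")
  case False
  have "((\<lambda>t. suminf (\<lambda>n. (c * (a t (Suc n) - b (Suc n)))\<^sup>2 / noise_weight n)) \<longlongrightarrow> (suminf (\<lambda>n. 0))) F"
  proof (rule tannerys_theorem[THEN conjunct2, THEN conjunct2, OF _ _ _ False])
    show "((\<lambda>t. (c * (a t (Suc n) - b (Suc n)))\<^sup>2 / noise_weight n) \<longlongrightarrow> 0) F" for n
    proof -
      have "((\<lambda>t. (c * (a t (Suc n) - b (Suc n)))\<^sup>2 / noise_weight n) \<longlongrightarrow> (c * (b (Suc n) - b (Suc n)))\<^sup>2 / noise_weight n) F"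
        using noise_weight_pos[of n] by (intro tendsto_intros lim) auto
      then show ?thesis by simp
    qed
    show "summable (\<lambda>n. (c\<^sup>2 * (2 * B)\<^sup>2) * (1 / noise_weight n))" by (rule summable_mult[OF summable_noise_weight])
    show "eventually (\<lambda>(n, t). norm ((c * (a t (Suc n) - b (Suc n)))\<^sup>2 / noise_weight n) \<le> (c\<^sup>2 * (2 * B)\<^sup>2) * (1 / noise_weight n)) (at_top \<times>\<^sub>F F)"
      unfolding eventually_prod_filter
    proof (intro exI conjI)
      show "eventually (\<lambda>_. True) at_top" by simp
      show "eventually (\<lambda>t. \<forall>k\<ge>1. \<bar>a t k\<bar> \<le> B) F" by (rule bnd)
      show "\<forall>n t. True \<longrightarrow> (\<forall>k\<ge>1. \<bar>a t k\<bar> \<le> B) \<longrightarrow> (case (n, t) of (n, t) \<Rightarrow>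
          norm ((c * (a t (Suc n) - b (Suc n)))\<^sup>2 / noise_weight n) \<le> (c\<^sup>2 * (2 * B)\<^sup>2) * (1 / noise_weight n))"
      proof (intro allI impI, unfold prod.case)
        fix n t assume "\<forall>k\<ge>1. \<bar>a t k\<bar> \<le> B"
        then have "\<bar>a t (Suc n) - b (Suc n)\<bar> \<le> 2 * B" using b[of "Suc n"] abs_triangle_ineq4[of "a t (Suc n)" "b (Suc n)"]
          by (smt (verit) le_add1 plus_1_eq_Suc)
        then have "(a t (Suc n) - b (Suc n))\<^sup>2 \<le> (2 * B)\<^sup>2"
          using power_mono[of "\<bar>a t (Suc n) - b (Suc n)\<bar>" "2 * B" 2] by simp
        then have "c\<^sup>2 * (a t (Suc n) - b (Suc n))\<^sup>2 / noise_weight n \<le> c\<^sup>2 * (2 * B)\<^sup>2 / noise_weight n"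
          using noise_weight_pos[of n] by (intro divide_right_mono mult_left_mono) auto
        then show "norm ((c * (a t (Suc n) - b (Suc n)))\<^sup>2 / noise_weight n) \<le> (c\<^sup>2 * (2 * B)\<^sup>2) * (1 / noise_weight n)"
          using noise_weight_pos[of n] by (simp add: power_mult_distrib)
      qed
    qed
  qed
  then have "((\<lambda>t. sqrt (suminf (\<lambda>n. (c * (a t (Suc n) - b (Suc n)))\<^sup>2 / noise_weight n))) \<longlongrightarrow> sqrt 0) F"
    by (intro tendsto_real_sqrt) simp
  moreover have "eventually (\<lambda>t. sqrt (suminf (\<lambda>n. (c * (a t (Suc n) - b (Suc n)))\<^sup>2 / noise_weight n)) =
      dist_norm \<rho> 1 (\<lambda>\<alpha>. first_chaos_sum c (a t) \<alpha> - first_chaos_sum c b \<alpha>)) F"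
    using bnd
  proof eventually_elim
    case (elim t)
    have "\<bar>a t k - b k\<bar> \<le> B + B" if "k \<ge> 1" for k
      using elim b[OF that] that abs_triangle_ineq4[of "a t k" "b k"] by (smt (verit))
    then show ?case unfolding first_chaos_sum_diff
      by (subst first_chaos_sum_norm(2)[where B="B + B"]) auto
  qed
  ultimately show ?thesis by (auto intro: Lim_transform_eventually)
qed simp

section \<open>Limits, continuity and derivatives in the inductive topology\<close>

text \<open>A basic neighbourhood of 0 contains a norm ball of every step
  \<open>dist_space_at \<rho> k\<close>, so norm convergence in a single step implies convergence in
  the inductive limit.\<close>

lemma limitin_dist_topology:
  assumes l: "l \<in> dist_space \<rho>" and e: "eventually (\<lambda>t. (\<lambda>\<alpha>. f t \<alpha> - l \<alpha>) \<in> dist_space_at \<rho> k) F"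
    and n: "((\<lambda>t. dist_norm \<rho> k (\<lambda>\<alpha>. f t \<alpha> - l \<alpha>)) \<longlongrightarrow> 0) F"
  shows "limitin (dist_topology \<rho>) f l F"
  unfolding limitin_def topspace_dist_topology
proof (intro conjI allI impI l)
  fix U assume "openin (dist_topology \<rho>) U \<and> l \<in> U"
  then obtain W where W: "W \<in> dist_nhds0 \<rho>" "\<forall>H\<in>W. (\<lambda>\<alpha>. l \<alpha> + H \<alpha>) \<in> U"
    unfolding openin_dist_topology by blast
  obtain d where d: "d > 0" "\<forall>H\<in>dist_space_at \<rho> k. dist_norm \<rho> k H < d \<longrightarrow> H \<in> W"
    using W(1) unfolding dist_nhds0_def by blast
  have "eventually (\<lambda>t. dist_norm \<rho> k (\<lambda>\<alpha>. f t \<alpha> - l \<alpha>) < d) F"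
    using order_tendstoD(2)[OF n d(1)] .
  with e show "eventually (\<lambda>t. f t \<in> U) F"
  proof eventually_elim
    case (elim t)
    have "(\<lambda>\<alpha>. f t \<alpha> - l \<alpha>) \<in> W" by (rule mp[OF bspec[OF d(2) elim(1)] elim(2)])
    from bspec[OF W(2) this] have "(\<lambda>\<alpha>. l \<alpha> + (f t \<alpha> - l \<alpha>)) \<in> U" .
    moreover have "(\<lambda>\<alpha>. l \<alpha> + (f t \<alpha> - l \<alpha>)) = f t" by (simp add: fun_eq_iff)
    ultimately show ?case by (simp only:)
  qed
qed

lemma first_chaos_sum_limitin:
  fixes a :: "'t \<Rightarrow> nat \<Rightarrow> real"
  assumes lim: "\<And>k. k \<ge> 1 \<Longrightarrow> ((\<lambda>t. a t k) \<longlongrightarrow> b k) F"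
    and bnd: "eventually (\<lambda>t. \<forall>k\<ge>1. \<bar>a t k\<bar> \<le> B) F" and b: "\<And>k. k \<ge> 1 \<Longrightarrow> \<bar>b k\<bar> \<le> B"
  shows "limitin (dist_topology \<rho>) (\<lambda>t. first_chaos_sum c (a t)) (first_chaos_sum c b) F"
proof (rule limitin_dist_topology)
  show "first_chaos_sum c b \<in> dist_space \<rho>"
    by (rule first_chaos_sum_dist_space) (rule b)
  show "eventually (\<lambda>t. (\<lambda>\<alpha>. first_chaos_sum c (a t) \<alpha> - first_chaos_sum c b \<alpha>) \<in> dist_space_at \<rho> 1) F"
    using bnd
  proof eventually_elim
    case (elim t)
    have "\<bar>a t k - b k\<bar> \<le> B + B" if "k \<ge> 1" for k
      using elim b[OF that] that abs_triangle_ineq4[of "a t k" "b k"] by (smt (verit))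
    then show ?case unfolding first_chaos_sum_diff by (rule first_chaos_sum_norm(1))
  qed
qed (rule first_chaos_sum_norm_tendsto[OF lim bnd b])

lemma continuous_map_within_limitin:
  fixes f :: "'a::metric_space \<Rightarrow> 'b"
  assumes "\<And>x. x \<in> S \<Longrightarrow> limitin X f (f x) (at x within S)"
  shows "continuous_map (top_of_set S) X f"
  unfolding continuous_map_def
proof (intro conjI allI impI)
  show "f \<in> topspace (top_of_set S) \<rightarrow> topspace X" using assms by (auto simp: limitin_def)
  fix U assume U: "openin X U"
  have "\<exists>e>0. \<forall>y\<in>S. dist y x < e \<longrightarrow> f y \<in> U" if x: "x \<in> S" "f x \<in> U" for x
  proof -
    have "eventually (\<lambda>y. f y \<in> U) (at x within S)" using assms[OF x(1)] U x(2) by (auto simp: limitin_def)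
    then obtain e where "e > 0" "\<forall>y\<in>S. y \<noteq> x \<and> dist y x < e \<longrightarrow> f y \<in> U" unfolding eventually_at by blast
    then show ?thesis using x(2) by metis
  qed
  then show "openin (top_of_set S) {x \<in> topspace (top_of_set S). f x \<in> U}"
    unfolding openin_euclidean_subtopology_iff by auto
qed

lemma first_chaos_sum_continuous_map:
  fixes u :: "nat \<Rightarrow> 'a::metric_space \<Rightarrow> real"
  assumes c: "\<And>k. k \<ge> 1 \<Longrightarrow> continuous_on S (u k)"
    and b: "\<And>x. x \<in> S \<Longrightarrow> \<exists>r>0. \<exists>C. \<forall>k\<ge>1. \<forall>y\<in>S \<inter> ball x r. \<bar>u k y\<bar> \<le> C"
  shows "continuous_map (top_of_set S) (dist_topology \<rho>) (\<lambda>x. first_chaos_sum c0 (\<lambda>k. u k x))"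
proof (rule continuous_map_within_limitin)
  fix x assume x: "x \<in> S"
  obtain r C where r: "r > 0" "\<forall>k\<ge>1. \<forall>y\<in>S \<inter> ball x r. \<bar>u k y\<bar> \<le> C" using b[OF x] by blast
  show "limitin (dist_topology \<rho>) (\<lambda>x. first_chaos_sum c0 (\<lambda>k. u k x)) (first_chaos_sum c0 (\<lambda>k. u k x)) (at x within S)"
  proof (rule first_chaos_sum_limitin)
    show "((\<lambda>t. u k t) \<longlongrightarrow> u k x) (at x within S)" if "k \<ge> 1" for k
      using c[OF that] x by (simp add: continuous_on_def)
    show "eventually (\<lambda>t. \<forall>k\<ge>1. \<bar>u k t\<bar> \<le> C) (at x within S)"
      unfolding eventually_at using r by (intro exI[of _ r]) (auto simp: dist_commute)
    show "\<bar>u k x\<bar> \<le> C" if "k \<ge> 1" for k using r x that by simp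
  qed
qed

text \<open>Difference quotients of the sum are first-chaos sums of difference quotients. The mean
  value inequality bounds these by \<open>C\<close> for all \<open>k\<close> at once, which is the
  common bound that the passage to the limit requires.\<close>

lemma first_chaos_sum_partial_dist:
  fixes u :: "nat \<Rightarrow> real ^ 'n \<Rightarrow> real"
  assumes D: "open D" and p: "\<And>k. k \<ge> 1 \<Longrightarrow> has_partial_real D i (u k) (v k)"
    and b: "\<And>x. x \<in> D \<Longrightarrow> \<exists>r>0. \<exists>C. ball x r \<subseteq> D \<and> (\<forall>k\<ge>1. \<forall>y\<in>ball x r. \<bar>v k y\<bar> \<le> C)"
  shows "has_partial_dist \<rho> D i (\<lambda>x. first_chaos_sum c0 (\<lambda>k. u k x)) (\<lambda>x. first_chaos_sum c0 (\<lambda>k. v k x))"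
  unfolding has_partial_dist_def
proof
  fix x assume x: "x \<in> D"
  obtain r C where r: "r > 0" "ball x r \<subseteq> D" "\<forall>k\<ge>1. \<forall>y\<in>ball x r. \<bar>v k y\<bar> \<le> C" using b[OF x] by blast
  have q: "(\<lambda>t \<alpha>. (first_chaos_sum c0 (\<lambda>k. u k (x + t *\<^sub>R axis i 1)) \<alpha> - first_chaos_sum c0 (\<lambda>k. u k x) \<alpha>) / t) =
    (\<lambda>t. first_chaos_sum c0 (\<lambda>k. inverse t * (u k (x + t *\<^sub>R axis i 1) - u k x)))"
    unfolding first_chaos_sum_diff by (intro ext) (simp add: first_chaos_sum_cmult divide_inverse mult.commute)
  have quot: "\<bar>inverse t * (u k (x + t *\<^sub>R axis i 1) - u k x)\<bar> \<le> C" if t: "\<bar>t\<bar> < r" "t \<noteq> 0" and k: "k \<ge> 1" for t k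
  proof -
    let ?S = "{- \<bar>t\<bar>..\<bar>t\<bar>}"
    have "norm (u k (x + t *\<^sub>R axis i 1) - u k (x + 0 *\<^sub>R axis i 1)) \<le> C * norm (t - 0)"
    proof (rule field_differentiable_bound[of ?S])
      fix s assume s: "s \<in> ?S"
      then have ball: "x + s *\<^sub>R axis i 1 \<in> ball x r" using t by (auto simp: dist_norm)
      then show "((\<lambda>s. u k (x + s *\<^sub>R axis i 1)) has_field_derivative v k (x + s *\<^sub>R axis i 1)) (at s within ?S)"
        using has_partial_real_at[OF p[OF k]] r(2) by (blast intro: has_field_derivative_at_within)
      show "norm (v k (x + s *\<^sub>R axis i 1)) \<le> C" using r(3) ball k by simp
    qed auto
    then show ?thesis using t by (simp add: abs_mult field_simps)
  qed
  show "limitin (dist_topology \<rho>)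
     (\<lambda>t \<alpha>. (first_chaos_sum c0 (\<lambda>k. u k (x + t *\<^sub>R axis i 1)) \<alpha> - first_chaos_sum c0 (\<lambda>k. u k x) \<alpha>) / t)
     (first_chaos_sum c0 (\<lambda>k. v k x)) (at 0)"
    unfolding q
  proof (rule first_chaos_sum_limitin)
    show "((\<lambda>t. inverse t * (u k (x + t *\<^sub>R axis i 1) - u k x)) \<longlongrightarrow> v k x) (at 0)" if "k \<ge> 1" for k
    proof -
      have "(\<lambda>t. (u k (x + t *\<^sub>R axis i 1) - u k x) / t) \<midarrow>0\<rightarrow> v k x"
        using p[OF that] x unfolding has_partial_real_def DERIV_def by auto
      then show ?thesis by (simp add: divide_inverse mult.commute)
    qed
    show "eventually (\<lambda>t. \<forall>k\<ge>1. \<bar>inverse t * (u k (x + t *\<^sub>R axis i 1) - u k x)\<bar> \<le> C) (at 0)"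
      unfolding eventually_at using r(1) quot by (intro exI[of _ r]) auto
    show "\<bar>v k x\<bar> \<le> C" if "k \<ge> 1" for k using r that by simp
  qed
qed

section \<open>Continuity of the coefficient functionals\<close>

lemma dist_norm_coeff_le:
  assumes "F \<in> dist_space_at \<rho> k"
  shows "sqrt (mi_fact \<alpha> ^ (1 - \<rho>) / mi_weight k \<alpha>) * \<bar>F \<alpha>\<bar> \<le> dist_norm \<rho> k F"
proof -
  let ?g = "\<lambda>\<alpha>. mi_fact \<alpha> ^ (1 - \<rho>) * (F \<alpha>)\<^sup>2 / mi_weight k \<alpha>"
  have "sum ?g {\<alpha>} \<le> infsum ?g UNIV"
    using assms mi_fact_pos mi_weight_pos unfolding dist_space_at_def
    by (intro finite_sum_le_infsum) (auto simp: less_imp_le)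
  then have "sqrt (?g \<alpha>) \<le> dist_norm \<rho> k F" by (simp add: dist_norm_def)
  moreover have "sqrt (?g \<alpha>) = sqrt (mi_fact \<alpha> ^ (1 - \<rho>) / mi_weight k \<alpha>) * \<bar>F \<alpha>\<bar>"
    by (simp add: real_sqrt_mult[symmetric] flip: real_sqrt_abs)
  ultimately show ?thesis by simp
qed

text \<open>The strip is absolutely convex, and it contains a ball of every step because a single
  coefficient is bounded by a multiple of each norm.\<close>

lemma coeff_nhds0:
  assumes "\<delta> > 0" shows "{F \<in> dist_space \<rho>. \<bar>F \<alpha>\<bar> < \<delta>} \<in> dist_nhds0 \<rho>"
  unfolding dist_nhds0_def
proof (rule CollectI, intro conjI ballI allI impI)
  show "{F \<in> dist_space \<rho>. \<bar>F \<alpha>\<bar> < \<delta>} \<subseteq> dist_space \<rho>" by blast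
next
  fix F G and a b :: real
  assume F: "F \<in> {F \<in> dist_space \<rho>. \<bar>F \<alpha>\<bar> < \<delta>}" and G: "G \<in> {F \<in> dist_space \<rho>. \<bar>F \<alpha>\<bar> < \<delta>}"
    and ab: "\<bar>a\<bar> + \<bar>b\<bar> \<le> 1"
  have "(\<lambda>\<alpha>. a * F \<alpha> + b * G \<alpha>) \<in> dist_space \<rho>"
    using dist_space_nhds0[of \<rho>] F G ab unfolding dist_nhds0_def by blast
  moreover have "\<bar>a * F \<alpha> + b * G \<alpha>\<bar> < \<delta>"
  proof -
    define m where "m = max \<bar>F \<alpha>\<bar> \<bar>G \<alpha>\<bar>"
    have m: "\<bar>F \<alpha>\<bar> \<le> m" "\<bar>G \<alpha>\<bar> \<le> m" "m < \<delta>" "0 \<le> m" using F G by (auto simp: m_def)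
    have "\<bar>a * F \<alpha> + b * G \<alpha>\<bar> \<le> \<bar>a\<bar> * \<bar>F \<alpha>\<bar> + \<bar>b\<bar> * \<bar>G \<alpha>\<bar>"
      using abs_triangle_ineq[of "a * F \<alpha>" "b * G \<alpha>"] by (simp add: abs_mult)
    also have "\<dots> \<le> \<bar>a\<bar> * m + \<bar>b\<bar> * m" using m by (intro add_mono mult_left_mono) auto
    also have "\<dots> = (\<bar>a\<bar> + \<bar>b\<bar>) * m" by (simp add: algebra_simps)
    also have "\<dots> \<le> 1 * m" using ab m(4) by (rule mult_right_mono)
    finally show ?thesis using m(3) by simp
  qed
  ultimately show "(\<lambda>\<alpha>. a * F \<alpha> + b * G \<alpha>) \<in> {F \<in> dist_space \<rho>. \<bar>F \<alpha>\<bar> < \<delta>}" by simp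
next
  fix k
  define w where "w = sqrt (mi_fact \<alpha> ^ (1 - \<rho>) / mi_weight k \<alpha>)"
  have w: "w > 0" using mi_fact_pos[of \<alpha>] mi_weight_pos[of k \<alpha>] by (simp add: w_def)
  show "\<exists>e>0. \<forall>F\<in>dist_space_at \<rho> k. dist_norm \<rho> k F < e \<longrightarrow> F \<in> {F \<in> dist_space \<rho>. \<bar>F \<alpha>\<bar> < \<delta>}"
  proof (intro exI[of _ "w * \<delta>"] conjI ballI impI)
    show "w * \<delta> > 0" using w assms by simp
    fix F assume F: "F \<in> dist_space_at \<rho> k" "dist_norm \<rho> k F < w * \<delta>"
    then have "w * \<bar>F \<alpha>\<bar> < w * \<delta>" using dist_norm_coeff_le[OF F(1), of \<alpha>] by (simp add: w_def)
    then show "F \<in> {F \<in> dist_space \<rho>. \<bar>F \<alpha>\<bar> < \<delta>}" using w F(1) by (auto simp: dist_space_def)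
  qed
qed

lemma limitin_coeff:
  assumes "limitin (dist_topology \<rho>) f l F"
  shows "((\<lambda>t. f t \<alpha>) \<longlongrightarrow> l \<alpha>) F"
proof (rule tendstoI)
  fix \<epsilon> :: real assume \<epsilon>: "\<epsilon> > 0"
  let ?U = "{H \<in> dist_space \<rho>. \<bar>H \<alpha> - l \<alpha>\<bar> < \<epsilon>}"
  have "openin (dist_topology \<rho>) ?U"
    unfolding openin_dist_topology
  proof (intro conjI ballI)
    fix H assume H: "H \<in> ?U"
    let ?W = "{K \<in> dist_space \<rho>. \<bar>K \<alpha>\<bar> < \<epsilon> - \<bar>H \<alpha> - l \<alpha>\<bar>}"
    have "?W \<in> dist_nhds0 \<rho>" by (rule coeff_nhds0) (use H in simp)
    moreover have "(\<lambda>\<alpha>. H \<alpha> + K \<alpha>) \<in> ?U" if "K \<in> ?W" for K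
      using H that dist_space_add[of H \<rho> K] by auto
    ultimately show "\<exists>W\<in>dist_nhds0 \<rho>. \<forall>K\<in>W. (\<lambda>\<alpha>. H \<alpha> + K \<alpha>) \<in> ?U" by blast
  qed blast
  moreover have "l \<in> ?U" using assms \<epsilon> by (simp add: limitin_def topspace_dist_topology)
  ultimately have "eventually (\<lambda>t. f t \<in> ?U) F" using assms unfolding limitin_def by blast
  then show "eventually (\<lambda>t. dist (f t \<alpha>) (l \<alpha>) < \<epsilon>) F"
    by eventually_elim (simp add: dist_real_def)
qed

lemma continuous_map_coeff:
  fixes U :: "'a::metric_space \<Rightarrow> chaos"
  assumes "continuous_map (top_of_set S) (dist_topology \<rho>) U"
  shows "continuous_on S (\<lambda>x. U x \<alpha>)"
  unfolding continuous_on_def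
proof
  fix x assume x: "x \<in> S"
  have "limitin (dist_topology \<rho>) U (U x) (at x within S)"
    unfolding limitin_def
  proof (intro conjI allI impI)
    show "U x \<in> topspace (dist_topology \<rho>)" using assms x unfolding continuous_map_def by auto
    fix V assume V: "openin (dist_topology \<rho>) V \<and> U x \<in> V"
    then have "openin (top_of_set S) {x \<in> topspace (top_of_set S). U x \<in> V}"
      using assms unfolding continuous_map_def by blast
    then obtain e where "e > 0" "\<forall>y\<in>S. dist y x < e \<longrightarrow> U y \<in> V"
      using x V unfolding openin_euclidean_subtopology_iff by auto
    then show "eventually (\<lambda>y. U y \<in> V) (at x within S)" unfolding eventually_at by blast
  qed
  then show "((\<lambda>x. U x \<alpha>) \<longlongrightarrow> U x \<alpha>) (at x within S)" by (rule limitin_coeff)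
qed

lemma has_partial_dist_coeff:
  assumes "has_partial_dist \<rho> D j U V" shows "has_partial_real D j (\<lambda>x. U x \<alpha>) (\<lambda>x. V x \<alpha>)"
  unfolding has_partial_real_def DERIV_def
proof
  fix x assume "x \<in> D"
  then have "limitin (dist_topology \<rho>) (\<lambda>t \<alpha>. (U (x + t *\<^sub>R axis j 1) \<alpha> - U x \<alpha>) / t) (V x) (at 0)"
    using assms by (simp add: has_partial_dist_def)
  from limitin_coeff[OF this, of \<alpha>]
  show "(\<lambda>h. (U (x + (0 + h) *\<^sub>R axis j 1) \<alpha> - U (x + 0 *\<^sub>R axis j 1) \<alpha>) / h) \<midarrow>0\<rightarrow> V x \<alpha>" by simp
qed

section \<open>The stochastic Poisson equation\<close>

text \<open>A value with nonzero coefficient is not the zero family, so its level set has finite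
  measure; the other values contribute 0 to this coefficient. Integrals of simple functions thus
  reduce to real integrals.\<close>

lemma simple_dist_integral_coeff:
  assumes s: "simple_dist_integrable \<rho> k M s"
  shows "simple_dist_integral M s \<alpha> = (\<integral>y. s y \<alpha> \<partial>M)"
proof -
  have sf: "simple_function M s" and fin: "emeasure M {y\<in>space M. s y \<noteq> (\<lambda>\<alpha>. 0)} < \<infinity>"
    using s by (auto simp: simple_dist_integrable_def)
  have fi: "finite (s ` space M)" using sf by (simp add: simple_function_def)
  let ?A = "\<lambda>F. {y\<in>space M. s y = F}"
  have A: "?A F \<in> sets M" for F
  proof -
    have "?A F = s -` {F} \<inter> space M" by auto
    then show ?thesis using simple_functionD(2)[OF sf] by simp
  qed
  have nz: "{y\<in>space M. s y \<noteq> (\<lambda>\<alpha>. 0)} \<in> sets M"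
  proof -
    have "{y\<in>space M. s y \<noteq> (\<lambda>\<alpha>. 0)} = space M - ?A (\<lambda>\<alpha>. 0)" by auto
    then show ?thesis using A by simp
  qed
  have int: "integrable M (\<lambda>y. F \<alpha> * indicator (?A F) y)" for F
  proof (cases "F \<alpha> = 0")
    case False
    then have "?A F \<subseteq> {y\<in>space M. s y \<noteq> (\<lambda>\<alpha>. 0)}" by auto
    then have "emeasure M (?A F) < \<infinity>" using emeasure_mono[OF _ nz] fin by (meson le_less_trans)
    then have "integrable M (indicator (?A F) :: _ \<Rightarrow> real)" using A by (intro integrable_real_indicator) auto
    then show ?thesis by (rule integrable_mult_right)
  qed simp
  have "(\<integral>y. s y \<alpha> \<partial>M) = (\<integral>y. (\<Sum>F\<in>s ` space M. F \<alpha> * indicator (?A F) y) \<partial>M)"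
  proof (rule Bochner_Integration.integral_cong[OF refl])
    fix y assume y: "y \<in> space M"
    have "(\<Sum>F\<in>s ` space M. F \<alpha> * indicator (?A F) y) = (\<Sum>F\<in>s ` space M. if F = s y then F \<alpha> else 0)"
      using y by (intro sum.cong) (auto simp: indicator_def)
    also have "\<dots> = s y \<alpha>" using fi y by (simp add: sum.delta')
    finally show "s y \<alpha> = (\<Sum>F\<in>s ` space M. F \<alpha> * indicator (?A F) y)" by simp
  qed
  also have "\<dots> = (\<Sum>F\<in>s ` space M. (\<integral>y. F \<alpha> * indicator (?A F) y \<partial>M))"
    by (rule Bochner_Integration.integral_sum) (rule int)
  also have "\<dots> = (\<Sum>F\<in>s ` space M. measure M (?A F) * F \<alpha>)"
  proof (rule sum.cong[OF refl])
    fix F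
    have "(\<integral>y. F \<alpha> * indicator (?A F) y \<partial>M) = F \<alpha> * measure M (?A F \<inter> space M)"
      by simp
    moreover have "?A F \<inter> space M = ?A F" by auto
    ultimately show "(\<integral>y. F \<alpha> * indicator (?A F) y \<partial>M) = measure M (?A F) * F \<alpha>" by (simp only: mult.commute)
  qed
  finally show ?thesis by (simp add: simple_dist_integral_def)
qed

text \<open>Each coefficient involves at most one summand, so this is a constant factor pulled out
  of an integral and not an exchange of limits.\<close>

lemma integral_first_chaos_sum:
  "(\<integral>y. first_chaos_sum c (a y) \<alpha> \<partial>M) = first_chaos_sum c (\<lambda>k. \<integral>y. a y k \<partial>M) \<alpha>"
  by (cases "\<alpha> \<in> range noise_index") (auto simp: first_chaos_sum_noise_index first_chaos_sum_off)

lemma abs_integral_le: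
  fixes f g :: "'a \<Rightarrow> real"
  assumes "integrable M f" "integrable M g" "\<And>x. x \<in> space M \<Longrightarrow> \<bar>f x\<bar> \<le> g x"
  shows "\<bar>\<integral>x. f x \<partial>M\<bar> \<le> (\<integral>x. g x \<partial>M)"
proof -
  have "\<bar>\<integral>x. f x \<partial>M\<bar> \<le> (\<integral>x. \<bar>f x\<bar> \<partial>M)" by (rule integral_abs_bound)
  also have "\<dots> \<le> (\<integral>x. g x \<partial>M)" using assms by (intro integral_mono) auto
  finally show ?thesis .
qed

text \<open>The approximants use scalar simple functions for the first \<open>n\<close> coefficients
  and 0 for the others. The distance to the integrand is at most a multiple of the common majorant
  \<open>H\<close>, so dominated convergence gives the L^1 limit; for the integrals it is applied
  coefficientwise.\<close>

lemma has_bochner_integral_first_chaos: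
  fixes g :: "nat \<Rightarrow> 'a \<Rightarrow> real"
  assumes g: "\<And>k. k \<ge> 1 \<Longrightarrow> integrable M (g k)" and H: "integrable M H"
    and gH: "\<And>k y. k \<ge> 1 \<Longrightarrow> y \<in> space M \<Longrightarrow> \<bar>g k y\<bar> \<le> H y"
  shows "has_bochner_integral_dist \<rho> M (\<lambda>y. first_chaos_sum c (\<lambda>k. g k y)) (first_chaos_sum c (\<lambda>k. \<integral>y. g k y \<partial>M))"
proof -
  have H0: "H y \<ge> 0" if "y \<in> space M" for y using gH[of 1 y] that by simp
  have "\<exists>s. (\<forall>n. simple_function M (s n)) \<and> (\<forall>y\<in>space M. (\<lambda>n. s n y) \<longlonglongrightarrow> g k y) \<and> (\<forall>n. \<forall>y\<in>space M. \<bar>s n y\<bar> \<le> 2 * \<bar>g k y\<bar>)"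
    if "k \<ge> 1" for k
    using borel_measurable_implies_sequence_metric[OF borel_measurable_integrable[OF g[OF that]], of 0]
    by (simp add: dist_real_def)
  then have "\<forall>k. \<exists>s. k \<ge> 1 \<longrightarrow> (\<forall>n. simple_function M (s n)) \<and> (\<forall>y\<in>space M. (\<lambda>n. s n y) \<longlonglongrightarrow> g k y) \<and> (\<forall>n. \<forall>y\<in>space M. \<bar>s n y\<bar> \<le> 2 * \<bar>g k y\<bar>)"
    by blast
  from choice[OF this] obtain s where s: "\<forall>k. k \<ge> 1 \<longrightarrow> (\<forall>n. simple_function M (s k n)) \<and> (\<forall>y\<in>space M. (\<lambda>n. s k n y) \<longlonglongrightarrow> g k y)
      \<and> (\<forall>n. \<forall>y\<in>space M. \<bar>s k n y\<bar> \<le> 2 * \<bar>g k y\<bar>)" ..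
  have s1: "simple_function M (s k n)" if "k \<ge> 1" for k n using s that by blast
  have s2: "(\<lambda>n. s k n y) \<longlonglongrightarrow> g k y" if "k \<ge> 1" "y \<in> space M" for k y using s that by blast
  have s3: "\<bar>s k n y\<bar> \<le> 2 * H y" if "k \<ge> 1" "y \<in> space M" for k n y
  proof -
    have "\<bar>s k n y\<bar> \<le> 2 * \<bar>g k y\<bar>" using s that by blast
    then show ?thesis using gH[OF that] by linarith
  qed
  \<comment> \<open>After truncation at \<open>k \<le> n\<close> only finitely many scalar simple
    functions are left, so the approximant takes finitely many values.\<close>
  define t where "t n y k = (if k \<in> {1..n} then s k n y else 0)" for n y k
  have t_bd: "\<bar>t n y k\<bar> \<le> 2 * H y" if "y \<in> space M" for n y k
    using s3[OF _ that] H0[OF that] by (auto simp: t_def)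
  have t_lim: "(\<lambda>n. t n y k) \<longlonglongrightarrow> g k y" if "k \<ge> 1" "y \<in> space M" for k y
  proof (rule Lim_transform_eventually[OF s2[OF that]])
    show "eventually (\<lambda>n. s k n y = t n y k) sequentially"
      using eventually_ge_at_top[of k] by eventually_elim (use that in \<open>simp add: t_def\<close>)
  qed
  have t_meas: "(\<lambda>y. t n y k) \<in> borel_measurable M" for n k
  proof (cases "k \<in> {1..n}")
    case True
    then show ?thesis using borel_measurable_simple_function[OF s1[of k n]] by (simp add: t_def)
  next
    case False
    then have "(\<lambda>y. t n y k) = (\<lambda>y. 0)" by (auto simp: t_def)
    then show ?thesis by simp
  qed
  have t_int: "integrable M (\<lambda>y. t n y k)" for n k
    by (rule Bochner_Integration.integrable_bound[OF integrable_mult_right[OF H, of 2] t_meas])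
      (use t_bd in \<open>auto intro!: AE_I2 intro: order_trans[OF _ abs_ge_self]\<close>)
  define S where "S n y = first_chaos_sum c (t n y)" for n y
  have S_simple: "simple_function M (S n)" for n
  proof -
    \<comment> \<open>The coefficients enter one at a time by function update, each step being a
      composition of two simple functions.\<close>
    have "simple_function M (\<lambda>y k. if k \<in> {1..m} then s k n y else 0)" for m
    proof (induction m)
      case 0
      have "(\<lambda>y k. if k \<in> {1..0::nat} then s k n y else 0) = (\<lambda>y k. 0)" by (auto simp: fun_eq_iff)
      then show ?case by simp
    next
      case (Suc m)
      have eq: "(\<lambda>y k. if k \<in> {1..Suc m} then s k n y else 0) =
          (\<lambda>y. (\<lambda>\<phi> r. \<phi>(Suc m := r)) (\<lambda>k. if k \<in> {1..m} then s k n y else 0) (s (Suc m) n y))"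
        by (auto simp: fun_eq_iff)
      show ?case unfolding eq by (rule simple_function_compose2[OF Suc.IH s1]) simp
    qed
    then have "simple_function M (t n)" by (simp add: t_def[abs_def])
    from simple_function_compose[OF this, of "first_chaos_sum c"]
    show ?thesis by (simp add: S_def[abs_def] o_def)
  qed
  have S_int: "simple_dist_integrable \<rho> 1 M (S n)" for n
    unfolding simple_dist_integrable_def
  proof (intro conjI S_simple)
    show "S n ` space M \<subseteq> dist_space_at \<rho> 1"
    proof
      fix F assume "F \<in> S n ` space M"
      then obtain y where y: "y \<in> space M" "F = first_chaos_sum c (t n y)" by (auto simp: S_def)
      show "F \<in> dist_space_at \<rho> 1" unfolding y(2) by (rule first_chaos_sum_norm(1)[of _ "2 * H y"]) (rule t_bd[OF y(1)])
    qed
    let ?N = "\<lambda>k. {y\<in>space M. s k n y \<noteq> 0}"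
    have fm: "?N k \<in> fmeasurable M" if "k \<in> {1..n}" for k
    proof -
      have k: "k \<ge> 1" using that by simp
      have tk: "(\<lambda>y. t n y k) = s k n" using that by (auto simp: t_def)
      have "(\<integral>\<^sup>+y. norm (s k n y) \<partial>M) < \<infinity>"
        using t_int[of n k] unfolding tk by (simp add: integrable_iff_bounded)
      then have "Bochner_Integration.simple_bochner_integrable M (s k n)"
        using simple_bochner_integrableI_bounded[OF s1[OF k, of n]] by simp
      then have "emeasure M (?N k) \<noteq> \<infinity>"
        by (rule Bochner_Integration.simple_bochner_integrable.cases)
      then have "emeasure M (?N k) < \<infinity>" by (simp add: less_top)
      moreover have "?N k \<in> sets M" using borel_measurable_simple_function[OF s1[OF k]] by measurable
      ultimately show ?thesis by (intro fmeasurableI)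
    qed
    have UN: "(\<Union>k\<in>{1..n}. ?N k) \<in> fmeasurable M" by (rule fmeasurable.finite_UN) (use fm in auto)
    have "{y\<in>space M. S n y \<noteq> (\<lambda>\<alpha>. 0)} \<subseteq> (\<Union>k\<in>{1..n}. ?N k)"
    proof
      fix y assume y: "y \<in> {y\<in>space M. S n y \<noteq> (\<lambda>\<alpha>. 0)}"
      have "\<exists>k\<in>{1..n}. s k n y \<noteq> 0"
      proof (rule ccontr)
        assume "\<not> ?thesis"
        then have "t n y = (\<lambda>_. 0)" by (auto simp: t_def)
        then show False using y by (simp add: S_def first_chaos_sum_zero)
      qed
      then show "y \<in> (\<Union>k\<in>{1..n}. ?N k)" using y by blast
    qed
    from emeasure_mono[OF this fmeasurableD[OF UN]]
    have "emeasure M {y\<in>space M. S n y \<noteq> (\<lambda>\<alpha>. 0)} \<le> emeasure M (\<Union>k\<in>{1..n}. ?N k)" .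
    also have "\<dots> < \<infinity>" using fmeasurableD2[OF UN] by (simp add: less_top)
    finally show "emeasure M {y\<in>space M. S n y \<noteq> (\<lambda>\<alpha>. 0)} < \<infinity>" .
  qed
  let ?d = "\<lambda>n y. dist_norm \<rho> 1 (\<lambda>\<alpha>. first_chaos_sum c (\<lambda>k. g k y) \<alpha> - S n y \<alpha>)"
  have d_bd: "\<bar>g k y - t n y k\<bar> \<le> 3 * H y" if "k \<ge> 1" "y \<in> space M" for k n y
    using gH[OF that] t_bd[OF that(2), of n k] by linarith
  have d_eq: "?d n y = sqrt (suminf (\<lambda>j. (c * (g (Suc j) y - t n y (Suc j)))\<^sup>2 / noise_weight j))" if y: "y \<in> space M" for n y
    unfolding S_def first_chaos_sum_diff by (rule first_chaos_sum_norm(2)[of _ "3 * H y"]) (rule d_bd[OF _ y])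
  have d_meas: "?d n \<in> borel_measurable M" for n
  proof -
    have [measurable]: "(\<lambda>y. t n y k) \<in> borel_measurable M" "g (Suc k) \<in> borel_measurable M" for k
      using t_meas borel_measurable_integrable[OF g] by auto
    have "(\<lambda>y. sqrt (suminf (\<lambda>j. (c * (g (Suc j) y - t n y (Suc j)))\<^sup>2 / noise_weight j))) \<in> borel_measurable M"
      by measurable
    then show ?thesis by (rule measurable_cong[THEN iffD1, rotated]) (rule d_eq[symmetric])
  qed
  define K where "K = sqrt (suminf (\<lambda>j. (c * 3)\<^sup>2 * (1 / noise_weight j)))"
  have K_sum: "summable (\<lambda>j. (c * 3)\<^sup>2 * (1 / noise_weight j))" by (rule summable_mult[OF summable_noise_weight])
  have d_le: "?d n y \<le> K * H y" if y: "y \<in> space M" for n y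
  proof -
    have le: "(c * (g (Suc j) y - t n y (Suc j)))\<^sup>2 / noise_weight j \<le> (H y)\<^sup>2 * ((c * 3)\<^sup>2 * (1 / noise_weight j))" for j
    proof -
      have "(g (Suc j) y - t n y (Suc j))\<^sup>2 \<le> (3 * H y)\<^sup>2"
        using power_mono[OF d_bd[OF _ y, of "Suc j" n], of 2] by simp
      then have "c\<^sup>2 * (g (Suc j) y - t n y (Suc j))\<^sup>2 / noise_weight j \<le> c\<^sup>2 * (3 * H y)\<^sup>2 / noise_weight j"
        using noise_weight_pos[of j] by (intro divide_right_mono mult_left_mono) auto
      then show ?thesis by (simp add: power_mult_distrib mult_ac)
    qed
    have "suminf (\<lambda>j. (c * (g (Suc j) y - t n y (Suc j)))\<^sup>2 / noise_weight j) \<le> suminf (\<lambda>j. (H y)\<^sup>2 * ((c * 3)\<^sup>2 * (1 / noise_weight j)))"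
      by (rule suminf_le[OF le summable_bounded_noise[OF d_bd[OF _ y]] summable_mult[OF K_sum]]) simp
    also have "\<dots> = (H y)\<^sup>2 * suminf (\<lambda>j. (c * 3)\<^sup>2 * (1 / noise_weight j))" by (rule suminf_mult[OF K_sum])
    finally have "?d n y \<le> sqrt ((H y)\<^sup>2 * suminf (\<lambda>j. (c * 3)\<^sup>2 * (1 / noise_weight j)))"
      unfolding d_eq[OF y] by (rule real_sqrt_le_mono)
    then show ?thesis using H0[OF y] by (simp add: real_sqrt_mult K_def mult.commute)
  qed
  have d_nonneg: "0 \<le> ?d n y" for n y unfolding dist_norm_def
    by (intro real_sqrt_ge_zero infsum_nonneg divide_nonneg_nonneg mult_nonneg_nonneg)
      (use mi_fact_pos mi_weight_pos in \<open>auto simp: less_imp_le\<close>)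
  have d_lim: "(\<lambda>n. ?d n y) \<longlonglongrightarrow> 0" if y: "y \<in> space M" for y
  proof -
    have "(\<lambda>n. dist_norm \<rho> 1 (\<lambda>\<alpha>. first_chaos_sum c (t n y) \<alpha> - first_chaos_sum c (\<lambda>k. g k y) \<alpha>)) \<longlonglongrightarrow> 0"
    proof (rule first_chaos_sum_norm_tendsto[where B="2 * H y"])
      show "(\<lambda>n. t n y k) \<longlonglongrightarrow> g k y" if "k \<ge> 1" for k by (rule t_lim[OF that y])
      show "eventually (\<lambda>n. \<forall>k\<ge>1. \<bar>t n y k\<bar> \<le> 2 * H y) sequentially" using t_bd[OF y] by simp
      show "\<bar>g k y\<bar> \<le> 2 * H y" if "k \<ge> 1" for k using gH[OF that y] H0[OF y] by linarith
    qed
    moreover have "dist_norm \<rho> 1 (\<lambda>\<alpha>. first_chaos_sum c (t n y) \<alpha> - first_chaos_sum c (\<lambda>k. g k y) \<alpha>) = ?d n y" for n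
      unfolding dist_norm_def S_def by (simp add: power2_commute)
    ultimately show ?thesis by simp
  qed
  have L1: "(\<lambda>n. \<integral>\<^sup>+y. ennreal (?d n y) \<partial>M) \<longlonglongrightarrow> 0"
  proof -
    have "(\<lambda>n. \<integral>\<^sup>+y. norm (0 - ?d n y) \<partial>M) \<longlonglongrightarrow> 0"
    proof (rule nn_integral_dominated_convergence_norm[where w="\<lambda>y. K * H y"])
      show "(\<lambda>y. K * H y) \<in> borel_measurable M" using H by simp
      show "AE y in M. norm (?d n y) \<le> K * H y" for n using d_le d_nonneg by (intro AE_I2) simp
      have "integrable M (\<lambda>y. K * H y)" by (rule integrable_mult_right[OF H])
      moreover have "K \<ge> 0" unfolding K_def using noise_weight_pos
        by (intro real_sqrt_ge_zero suminf_nonneg K_sum) (auto simp: less_imp_le)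
      ultimately have "(\<integral>\<^sup>+y. ennreal (K * H y) \<partial>M) = ennreal (\<integral>y. K * H y \<partial>M)"
        using H0 by (intro nn_integral_eq_integral) auto
      then show "(\<integral>\<^sup>+y. ennreal (K * H y) \<partial>M) < \<infinity>" by simp
      show "AE y in M. (\<lambda>n. ?d n y) \<longlonglongrightarrow> 0" using d_lim by (intro AE_I2) simp
    qed (use d_meas in auto)
    then show ?thesis using d_nonneg by simp
  qed
  have int_eq: "simple_dist_integral M (S n) = first_chaos_sum c (\<lambda>k. \<integral>y. t n y k \<partial>M)" for n
    using simple_dist_integral_coeff[OF S_int] unfolding S_def by (auto simp: integral_first_chaos_sum)
  let ?h = "\<integral>y. H y \<partial>M"
  have g_bd: "\<bar>\<integral>y. g k y \<partial>M\<bar> \<le> 2 * ?h" if "k \<ge> 1" for k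
  proof -
    have "\<bar>\<integral>y. g k y \<partial>M\<bar> \<le> ?h"
      by (rule abs_integral_le[OF g[OF that] H]) (rule gH[OF that])
    moreover have "0 \<le> ?h" using H0 by (intro integral_nonneg_AE AE_I2) 
    ultimately show ?thesis by linarith
  qed
  have L2: "(\<lambda>n. dist_norm \<rho> 1 (\<lambda>\<alpha>. simple_dist_integral M (S n) \<alpha> - first_chaos_sum c (\<lambda>k. \<integral>y. g k y \<partial>M) \<alpha>)) \<longlonglongrightarrow> 0"
    unfolding int_eq
  proof (rule first_chaos_sum_norm_tendsto[where B="2 * ?h"])
    show "(\<lambda>n. \<integral>y. t n y k \<partial>M) \<longlonglongrightarrow> (\<integral>y. g k y \<partial>M)" if "k \<ge> 1" for k
    proof (rule integral_dominated_convergence[where w="\<lambda>y. 2 * H y"])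
      show "AE y in M. (\<lambda>n. t n y k) \<longlonglongrightarrow> g k y" using t_lim[OF that] by (intro AE_I2)
      show "AE y in M. norm (t n y k) \<le> 2 * H y" for n using t_bd by (intro AE_I2) simp
    qed (use g[OF that] t_meas H in auto)
    have "\<bar>\<integral>y. t n y k \<partial>M\<bar> \<le> (\<integral>y. 2 * H y \<partial>M)" for n k
      by (rule abs_integral_le[OF t_int integrable_mult_right[OF H]]) (rule t_bd)
    then show "eventually (\<lambda>n. \<forall>k\<ge>1. \<bar>\<integral>y. t n y k \<partial>M\<bar> \<le> 2 * ?h) sequentially" by simp
  qed (rule g_bd)
  show ?thesis
    unfolding has_bochner_integral_dist_def
  proof (intro exI[of _ "1::nat"] exI[of _ S] conjI allI)
    show "AE y in M. first_chaos_sum c (\<lambda>k. g k y) \<in> dist_space_at \<rho> 1"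
    proof (rule AE_I2)
      fix y assume y: "y \<in> space M"
      show "first_chaos_sum c (\<lambda>k. g k y) \<in> dist_space_at \<rho> 1"
        by (rule first_chaos_sum_norm(1)[of _ "H y"]) (rule gH[OF _ y])
    qed
    show "first_chaos_sum c (\<lambda>k. \<integral>y. g k y \<partial>M) \<in> dist_space_at \<rho> 1"
      by (rule first_chaos_sum_norm(1)[of _ "2 * ?h"]) (rule g_bd)
  qed (use S_int d_meas L1 L2 in auto)
qed

section \<open>Pairing with test functions\<close>

text \<open>With the weight \<open>W\<close> one has
  \<open>2 \<bar>f\<bar> \<le> f\<^sup>2 W + 1 / W\<close>: the first term is summable by the test
  function condition with exponent 1, the second by \<open>summable_noise_weight\<close>.\<close>

lemma hida_test_noise_summable:
  assumes "f \<in> hida_test" shows "summable (\<lambda>n. \<bar>f (noise_index n)\<bar>)"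
proof -
  let ?g = "\<lambda>\<alpha>. mi_fact \<alpha> * (f \<alpha>)\<^sup>2 * mi_weight 1 \<alpha>"
  have "?g summable_on UNIV" using assms by (simp add: hida_test_def)
  then have "?g summable_on range noise_index" by (rule summable_on_subset_banach) simp
  then have "(\<lambda>n. ?g (noise_index n)) summable_on UNIV"
    using summable_on_reindex[OF inj_noise_index, of ?g] by (simp add: o_def)
  then have "(\<lambda>n. (f (noise_index n))\<^sup>2 * noise_weight n) summable_on UNIV"
    by (simp add: mi_fact_noise_index noise_weight_def)
  then have "summable (\<lambda>n. (f (noise_index n))\<^sup>2 * noise_weight n)" by (rule summable_on_imp_summable)
  then have s: "summable (\<lambda>n. (f (noise_index n))\<^sup>2 * noise_weight n + 1 / noise_weight n)"
    by (rule summable_add[OF _ summable_noise_weight])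
  show ?thesis
  proof (rule summable_comparison_test[OF _ s], intro exI[of _ 0] allI impI)
    fix n
    let ?W = "noise_weight n" and ?f = "\<bar>f (noise_index n)\<bar>"
    have W: "?W > 0" by (rule noise_weight_pos)
    have "2 * (?f * sqrt ?W) * (1 / sqrt ?W) \<le> (?f * sqrt ?W)\<^sup>2 + (1 / sqrt ?W)\<^sup>2" by (rule sum_squares_bound)
    then have "2 * ?f \<le> (f (noise_index n))\<^sup>2 * ?W + 1 / ?W"
      using W by (simp add: power_mult_distrib power_divide)
    then show "norm ?f \<le> (f (noise_index n))\<^sup>2 * ?W + 1 / ?W" by simp
  qed
qed

lemma dist_pairing_first_chaos_sum:
  assumes f: "f \<in> hida_test" and a: "\<And>k. k \<ge> 1 \<Longrightarrow> \<bar>a k\<bar> \<le> B"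
  shows "dist_pairing (first_chaos_sum c a) f = suminf (\<lambda>n. c * a (Suc n) * f (noise_index n))"
proof -
  let ?g = "\<lambda>\<alpha>. mi_fact \<alpha> * first_chaos_sum c a \<alpha> * f \<alpha>"
  have off: "?g \<alpha> = 0" if "\<alpha> \<notin> range noise_index" for \<alpha> by (simp add: first_chaos_sum_off[OF that])
  have on: "(\<lambda>n. ?g (noise_index n)) = (\<lambda>n. c * a (Suc n) * f (noise_index n))"
    by (simp add: first_chaos_sum_noise_index mi_fact_noise_index)
  have "summable (\<lambda>n. norm (c * a (Suc n) * f (noise_index n)))"
  proof (rule summable_comparison_test[OF _ summable_mult[OF hida_test_noise_summable[OF f], of "\<bar>c\<bar> * B"]], intro exI[of _ 0] allI impI)
    fix n
    show "norm (norm (c * a (Suc n) * f (noise_index n))) \<le> \<bar>c\<bar> * B * \<bar>f (noise_index n)\<bar>"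
      using a[of "Suc n"] by (simp add: abs_mult mult_left_mono mult_right_mono)
  qed
  then have "(\<lambda>n. c * a (Suc n) * f (noise_index n)) summable_on UNIV" by (rule norm_summable_imp_summable_on)
  from infsum_eq_suminf_real[OF this] noise_index_sum(2)[of ?g, OF off]
  show ?thesis unfolding dist_pairing_def on by simp
qed

section \<open>Comparison of solutions and the existence theorem\<close>

text \<open>Each coefficient of \<open>V - U\<close> is a real function with zero Laplacian and zero
  boundary values. A one-sided bound suffices, since the hypotheses are symmetric in
  \<open>U\<close> and \<open>V\<close>.\<close>

lemma solves_stochastic_poisson_le:
  fixes D :: "(real ^ 'n) set"
  assumes D: "open D" "bounded D" and U: "solves_stochastic_poisson \<nu> h D U"
    and V: "solves_stochastic_poisson \<nu> h D V" and x: "x \<in> closure D"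
  shows "V x \<alpha> \<le> U x \<alpha>"
proof -
  obtain U1 U2 where U12: "\<And>j. has_partial_dist 1 D j U (U1 j)" "\<And>j. has_partial_dist 1 D j (U1 j) (U2 j)"
    and UL: "\<And>x. x \<in> D \<Longrightarrow> (\<lambda>\<alpha>. - levy_noise \<nu> h x \<alpha>) = (\<lambda>\<alpha>. \<Sum>j\<in>UNIV. U2 j x \<alpha>)"
    using U unfolding solves_stochastic_poisson_def has_laplacian_dist_def by blast
  obtain V1 V2 where V12: "\<And>j. has_partial_dist 1 D j V (V1 j)" "\<And>j. has_partial_dist 1 D j (V1 j) (V2 j)"
    and VL: "\<And>x. x \<in> D \<Longrightarrow> (\<lambda>\<alpha>. - levy_noise \<nu> h x \<alpha>) = (\<lambda>\<alpha>. \<Sum>j\<in>UNIV. V2 j x \<alpha>)"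
    using V unfolding solves_stochastic_poisson_def has_laplacian_dist_def by blast
  have "V x \<alpha> - U x \<alpha> \<le> 0"
  proof (rule max_principle[OF D, of "\<lambda>x. V x \<alpha> - U x \<alpha>" "\<lambda>j x. V1 j x \<alpha> - U1 j x \<alpha>" "\<lambda>j x. V2 j x \<alpha> - U2 j x \<alpha>"])
    show "continuous_on (closure D) (\<lambda>x. V x \<alpha> - U x \<alpha>)"
      using U V unfolding solves_stochastic_poisson_def
      by (intro continuous_on_diff continuous_map_coeff[where \<rho>=1]) auto
    show "has_partial_real D j (\<lambda>x. V x \<alpha> - U x \<alpha>) (\<lambda>x. V1 j x \<alpha> - U1 j x \<alpha>)" for j
      by (intro has_partial_real_diff has_partial_dist_coeff[where \<rho>=1] U12 V12)
    show "has_partial_real D j (\<lambda>x. V1 j x \<alpha> - U1 j x \<alpha>) (\<lambda>x. V2 j x \<alpha> - U2 j x \<alpha>)" for j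
      by (intro has_partial_real_diff has_partial_dist_coeff[where \<rho>=1] U12 V12)
    show "0 \<le> (\<Sum>j\<in>UNIV. V2 j y \<alpha> - U2 j y \<alpha>)" if "y \<in> D" for y
      using fun_cong[OF UL[OF that], of \<alpha>] fun_cong[OF VL[OF that], of \<alpha>] by (simp add: sum_subtractf)
    show "V y \<alpha> - U y \<alpha> \<le> 0" if "y \<in> frontier D" for y
      using U V that unfolding solves_stochastic_poisson_def by simp
  qed (rule x)
  then show ?thesis by simp
qed

theorem theorem3p2:
  fixes \<nu> :: "real measure"
    and h :: "nat ^ 'n \<Rightarrow> nat"
    and D :: "(real ^ 'n) set"
    and G :: "real ^ 'n \<Rightarrow> real ^ 'n \<Rightarrow> real"
  assumes "levy_measure \<nu>"
    and "bij_betw h pos_tuples {1..}"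
    and "open D" and "connected D" and "D \<noteq> {}" and "bounded D"
    and "regular_boundary D"
    and "green_function D G"
  shows "\<exists>U. solves_stochastic_poisson \<nu> h D U \<and>
    (\<forall>V. solves_stochastic_poisson \<nu> h D V \<longrightarrow> (\<forall>x\<in>closure D. V x = U x)) \<and>
    continuous_map (top_of_set (closure D)) hida_topology U \<and>
    C2_dist 0 D U \<and>
    (\<forall>x\<in>closure D.
       has_bochner_integral_dist 0 lborel (\<lambda>y \<alpha>. G x y * levy_noise \<nu> h y \<alpha>) (U x) \<and>
       (\<forall>f\<in>hida_test. integrable lborel (\<lambda>y. G x y * dist_pairing (levy_noise \<nu> h y) f) \<and>
          dist_pairing (U x) f = (\<integral>y. G x y * dist_pairing (levy_noise \<nu> h y) f \<partial>lborel)) \<and>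
       (\<forall>k\<ge>1. integrable lborel (\<lambda>y. G x y * zeta_basis h k y)) \<and>
       U x = first_chaos_sum (levy_L2_norm \<nu>)
               (\<lambda>k. \<integral>y. G x y * zeta_basis h k y \<partial>lborel))"
proof -
  note D = \<open>open D\<close> \<open>bounded D\<close> and reg = \<open>regular_boundary D\<close> and G = \<open>green_function D G\<close>
  let ?m = "levy_L2_norm \<nu>"
  obtain u v w M where
    uc: "\<And>k. continuous_on (closure D) (u k)" and u0: "\<And>k y. y \<in> frontier D \<Longrightarrow> u k y = 0"
    and uC: "\<And>k. C2_real D (u k) (v k) (w k)" and uL: "\<And>k y. y \<in> D \<Longrightarrow> (\<Sum>i\<in>UNIV. w k i i y) = - zeta_basis h k y"
    and uM: "\<And>k y. y \<in> closure D \<Longrightarrow> \<bar>u k y\<bar> \<le> M" and zM: "\<And>k y. y \<in> closure D \<Longrightarrow> \<bar>zeta_basis h k y\<bar> \<le> M"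
    and M0: "M \<ge> 0"
    and loc: "\<And>x0. x0 \<in> D \<Longrightarrow> \<exists>r>0. \<exists>C. ball x0 r \<subseteq> D \<and> (\<forall>k. \<forall>x\<in>ball x0 r. \<forall>i j. \<bar>v k i x\<bar> \<le> C \<and> \<bar>w k i j x\<bar> \<le> C)"
    by (rule poisson_zeta_family[OF D reg, of h]) blast
  have DcD: "D \<subseteq> closure D" by (rule closure_subset)
  have fr: "x \<in> frontier D" if "x \<in> closure D" "x \<notin> D" for x
    using that D(1) by (simp add: frontier_def interior_open)
  have G0: "G x y = 0" if "x \<notin> D \<or> y \<notin> D" for x y using G that by (auto simp: green_function_def)
  define U where "U x = first_chaos_sum ?m (\<lambda>k. u k x)" for x
  define V where "V i x = first_chaos_sum ?m (\<lambda>k. v k i x)" for i x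
  define W where "W i j x = first_chaos_sum ?m (\<lambda>k. w k i j x)" for i j x
  \<comment> \<open>\<rho> is left free: the value 1 serves the equation, the value 0 the
    differentiability in the Hida space.\<close>
  have pU: "has_partial_dist \<rho> D i U (V i)" for \<rho> i
    unfolding U_def[abs_def] V_def[abs_def]
  proof (rule first_chaos_sum_partial_dist[OF D(1)])
    show "has_partial_real D i (u k) (v k i)" for k using uC[of k] by (simp add: C2_real_def)
    show "\<exists>r>0. \<exists>C. ball x r \<subseteq> D \<and> (\<forall>k\<ge>1. \<forall>y\<in>ball x r. \<bar>v k i y\<bar> \<le> C)" if "x \<in> D" for x
      using loc[OF that] by blast
  qed
  have pV: "has_partial_dist \<rho> D j (V i) (W i j)" for \<rho> i j
    unfolding V_def[abs_def] W_def[abs_def]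
  proof (rule first_chaos_sum_partial_dist[OF D(1)])
    show "has_partial_real D j (v k i) (w k i j)" for k using uC[of k] by (simp add: C2_real_def)
    show "\<exists>r>0. \<exists>C. ball x r \<subseteq> D \<and> (\<forall>k\<ge>1. \<forall>y\<in>ball x r. \<bar>w k i j y\<bar> \<le> C)" if "x \<in> D" for x
      using loc[OF that] by blast
  qed
  have cU: "continuous_map (top_of_set (closure D)) (dist_topology \<rho>) U" for \<rho>
    unfolding U_def[abs_def]
  proof (rule first_chaos_sum_continuous_map)
    show "\<exists>r>0. \<exists>C. \<forall>k\<ge>1. \<forall>y\<in>closure D \<inter> ball x r. \<bar>u k y\<bar> \<le> C" for x
      using uM by (intro exI[of _ 1] conjI exI[of _ M]) auto
  qed (rule uc)
  have cUD: "continuous_map (top_of_set D) (dist_topology \<rho>) U" for \<rho>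
    using continuous_map_from_subtopology_mono[OF cU DcD] .
  have cV: "continuous_map (top_of_set D) (dist_topology \<rho>) (V i)" for \<rho> i
    unfolding V_def[abs_def]
  proof (rule first_chaos_sum_continuous_map)
    show "continuous_on D (v k i)" for k using uC[of k] by (simp add: C2_real_def)
    show "\<exists>r>0. \<exists>C. \<forall>k\<ge>1. \<forall>y\<in>D \<inter> ball x r. \<bar>v k i y\<bar> \<le> C" if "x \<in> D" for x
      using loc[OF that] by blast
  qed
  have cW: "continuous_map (top_of_set D) (dist_topology \<rho>) (W i j)" for \<rho> i j
    unfolding W_def[abs_def]
  proof (rule first_chaos_sum_continuous_map)
    show "continuous_on D (w k i j)" for k using uC[of k] by (simp add: C2_real_def)
    show "\<exists>r>0. \<exists>C. \<forall>k\<ge>1. \<forall>y\<in>D \<inter> ball x r. \<bar>w k i j y\<bar> \<le> C" if "x \<in> D" for x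
      using loc[OF that] by blast
  qed
  have sol: "solves_stochastic_poisson \<nu> h D U"
    unfolding solves_stochastic_poisson_def
  proof (intro conjI ballI cU)
    show "U x \<in> hida_dist" if "x \<in> closure D" for x
      unfolding U_def by (rule first_chaos_sum_dist_space) (rule uM[OF that])
    have "(\<lambda>\<alpha>. - levy_noise \<nu> h x \<alpha>) = (\<lambda>\<alpha>. \<Sum>j\<in>UNIV. W j j x \<alpha>)" if "x \<in> D" for x
    proof
      fix \<alpha>
      have "(\<Sum>j\<in>UNIV. W j j x \<alpha>) = first_chaos_sum ?m (\<lambda>k. \<Sum>j\<in>UNIV. w k j j x) \<alpha>"
        unfolding W_def by (rule first_chaos_sum_sum)
      also have "\<dots> = first_chaos_sum ?m (\<lambda>k. (- 1) * zeta_basis h k x) \<alpha>" using uL[OF that] by simp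
      also have "\<dots> = - levy_noise \<nu> h x \<alpha>" unfolding first_chaos_sum_cmult levy_noise_def by simp
      finally show "- levy_noise \<nu> h x \<alpha> = (\<Sum>j\<in>UNIV. W j j x \<alpha>)" by simp
    qed
    then show "has_laplacian_dist 1 D U (\<lambda>x \<alpha>. - levy_noise \<nu> h x \<alpha>)"
      unfolding has_laplacian_dist_def
      by (intro exI[of _ V] exI[of _ "\<lambda>j. W j j"]) (use pU pV in blast)
    show "U x = (\<lambda>\<alpha>. 0)" if "x \<in> frontier D" for x
      unfolding U_def by (simp add: u0[OF that] first_chaos_sum_zero)
  qed
  have rep: "integrable lborel (\<lambda>y. G x y * zeta_basis h k y) \<and> u k x = (\<integral>y. G x y * zeta_basis h k y \<partial>lborel)"
    if "x \<in> closure D" for x k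
  proof (cases "x \<in> D")
    case True
    have "zeta_basis h k y = - (\<Sum>i\<in>UNIV. w k i i y)" if "y \<in> D" for y using uL[OF that] by simp
    moreover have "\<bar>zeta_basis h k y\<bar> \<le> M" if "y \<in> D" for y using zM DcD that by blast
    ultimately show ?thesis
      using green_representation[OF reg G D True uc u0 uC, of "zeta_basis h k" k M] by blast
  next
    \<comment> \<open>At boundary points \<open>G x\<close> is 0 by convention and
      \<open>u k x\<close> is 0 by the boundary condition.\<close>
    case False
    then show ?thesis using u0[OF fr[OF that False]] G0 by simp
  qed
  have Gi: "integrable lborel (G x)" for x by (rule green_integrable[OF G D])
  \<comment> \<open>The bound \<open>M\<close> on the basis functions is available on the closure of
    \<open>D\<close>; elsewhere \<open>G\<close> vanishes.\<close>
  have GzM: "\<bar>G x y * zeta_basis h k y\<bar> \<le> M * \<bar>G x y\<bar>" for x y k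
  proof (cases "y \<in> D")
    case True
    then have "\<bar>zeta_basis h k y\<bar> \<le> M" using zM DcD by blast
    from mult_right_mono[OF this abs_ge_zero[of "G x y"]] show ?thesis by (simp add: abs_mult mult.commute)
  qed (simp add: G0)
  have MGi: "integrable lborel (\<lambda>y. M * \<bar>G x y\<bar>)" for x using Gi by simp
  show ?thesis
  proof (intro exI[of _ U] conjI sol cU allI impI ballI)
    fix V' x assume V': "solves_stochastic_poisson \<nu> h D V'" and x: "x \<in> closure D"
    show "V' x = U x"
      by (intro ext antisym solves_stochastic_poisson_le[OF D sol V' x] solves_stochastic_poisson_le[OF D V' sol x])
  next
    show "C2_dist 0 D U"
      unfolding C2_dist_def using cUD pU pV cV cW by blast
  next
    fix x assume x: "x \<in> closure D"
    show U_eq: "U x = first_chaos_sum ?m (\<lambda>k. \<integral>y. G x y * zeta_basis h k y \<partial>lborel)"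
      unfolding U_def by (rule first_chaos_sum_cong) (use rep[OF x] in blast)
    show Gz: "integrable lborel (\<lambda>y. G x y * zeta_basis h k y)" for k using rep[OF x] by blast
    have eq: "(\<lambda>y \<alpha>. G x y * levy_noise \<nu> h y \<alpha>) = (\<lambda>y. first_chaos_sum ?m (\<lambda>k. G x y * zeta_basis h k y))"
      by (intro ext) (simp add: levy_noise_def first_chaos_sum_cmult)
    show "has_bochner_integral_dist 0 lborel (\<lambda>y \<alpha>. G x y * levy_noise \<nu> h y \<alpha>) (U x)"
      unfolding eq U_eq by (rule has_bochner_integral_first_chaos[OF Gz MGi GzM])
    fix f assume f: "f \<in> hida_test"
    let ?t = "\<lambda>n y. ?m * (G x y * zeta_basis h (Suc n) y) * f (noise_index n)"
    \<comment> \<open>In \<open>D\<close> the pairing is an absolutely convergent series into which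
      \<open>G x y\<close> can be pulled; off \<open>D\<close> both sides vanish.\<close>
    have pt: "G x y * dist_pairing (levy_noise \<nu> h y) f = suminf (\<lambda>n. ?t n y)" for y
    proof (cases "y \<in> D")
      case True
      have z: "\<bar>zeta_basis h k y\<bar> \<le> M" for k using zM DcD True by blast
      have "dist_pairing (levy_noise \<nu> h y) f = suminf (\<lambda>n. ?m * zeta_basis h (Suc n) y * f (noise_index n))"
        unfolding levy_noise_def by (rule dist_pairing_first_chaos_sum[OF f]) (rule z)
      moreover have "summable (\<lambda>n. ?m * zeta_basis h (Suc n) y * f (noise_index n))"
      proof (rule summable_comparison_test[OF _ summable_mult[OF hida_test_noise_summable[OF f], of "\<bar>?m\<bar> * M"]], intro exI[of _ 0] allI impI)
        fix n
        show "norm (?m * zeta_basis h (Suc n) y * f (noise_index n)) \<le> \<bar>?m\<bar> * M * \<bar>f (noise_index n)\<bar>"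
          using z[of "Suc n"] by (simp add: abs_mult mult_left_mono mult_right_mono)
      qed
      ultimately show ?thesis by (simp add: suminf_mult[symmetric] mult_ac)
    qed (simp add: G0)
    have ti: "integrable lborel (?t n)" for n
      using Gz by (intro integrable_mult_left integrable_mult_right)
    have ts: "summable (\<lambda>n. norm (?t n y))" for y
    proof (rule summable_comparison_test[OF _ summable_mult[OF hida_test_noise_summable[OF f], of "\<bar>?m\<bar> * (M * \<bar>G x y\<bar>)"]], intro exI[of _ 0] allI impI)
      fix n
      show "norm (norm (?t n y)) \<le> \<bar>?m\<bar> * (M * \<bar>G x y\<bar>) * \<bar>f (noise_index n)\<bar>"
        using GzM[of x y "Suc n"] unfolding abs_mult norm_mult real_norm_def abs_abs
        by (intro mult_right_mono mult_left_mono) auto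
    qed
    \<comment> \<open>This summability justifies exchanging series and integral; it combines
      integrability of \<open>M * \<bar>G x y\<bar>\<close> with absolute summability of the
      coefficients of \<open>f\<close>.\<close>
    have tI: "summable (\<lambda>n. \<integral>y. norm (?t n y) \<partial>lborel)"
    proof (rule summable_comparison_test[OF _ summable_mult[OF hida_test_noise_summable[OF f], of "\<integral>y. \<bar>?m\<bar> * (M * \<bar>G x y\<bar>) \<partial>lborel"]], intro exI[of _ 0] allI impI)
      fix n
      have "(\<integral>y. norm (?t n y) \<partial>lborel) \<le> (\<integral>y. \<bar>?m\<bar> * (M * \<bar>G x y\<bar>) * \<bar>f (noise_index n)\<bar> \<partial>lborel)"
      proof (rule integral_mono)
        show "norm (?t n y) \<le> \<bar>?m\<bar> * (M * \<bar>G x y\<bar>) * \<bar>f (noise_index n)\<bar>" for y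
          using GzM[of x y "Suc n"] unfolding abs_mult norm_mult real_norm_def
          by (intro mult_right_mono mult_left_mono) auto
      qed (use ti MGi in \<open>auto intro!: integrable_mult_left integrable_mult_right\<close>)
      then show "norm (\<integral>y. norm (?t n y) \<partial>lborel) \<le> (\<integral>y. \<bar>?m\<bar> * (M * \<bar>G x y\<bar>) \<partial>lborel) * \<bar>f (noise_index n)\<bar>"
        by (simp add: integral_nonneg_AE)
    qed
    show "integrable lborel (\<lambda>y. G x y * dist_pairing (levy_noise \<nu> h y) f)"
      unfolding pt by (rule integrable_suminf[OF ti _ tI]) (use ts in auto)
    have "(\<integral>y. suminf (\<lambda>n. ?t n y) \<partial>lborel) = suminf (\<lambda>n. \<integral>y. ?t n y \<partial>lborel)"
      by (rule integral_suminf[OF ti _ tI]) (use ts in auto)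
    also have "\<dots> = suminf (\<lambda>n. ?m * u (Suc n) x * f (noise_index n))"
      using rep[OF x] by simp
    also have "\<dots> = dist_pairing (U x) f"
      unfolding U_def by (rule dist_pairing_first_chaos_sum[OF f, symmetric]) (rule uM[OF x])
    finally show "dist_pairing (U x) f = (\<integral>y. G x y * dist_pairing (levy_noise \<nu> h y) f \<partial>lborel)"
      unfolding pt by simp
  qed
qed

end
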